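(* (i) For every $n\ge 1$, the incompatibility robustness of the degree-2 Majorana observables satisfies $\eta_2^*\le \frac{1}{\sqrt{2n-1}}$, with equality if and only if there exists a real $2n\times 2n$ skew-Hadamard matrix. Moreover $\eta_2^*=\Theta(n^{-1/2})$ as $n\to\infty$. (ii) For every fixed integer $1\le k\le 5$ and all sufficiently large $n$, $\eta_{2k}^*\le \sqrt{\binom{n}{k}\big/\binom{2n}{2k}}$. Moreover $\eta_{2k}^*=\Theta(n^{-k/2})$ as $n\to\infty$.
   Context: Let $\gamma_1,\dots,\gamma_{2n}$ be Majorana operators on $(\mathbb C^2)^{\otimes n}$ (Hermitian, $\gamma_j\gamma_{j'}+\gamma_{j'}\gamma_j=2\delta_{jj'}I$). For $S=\{j_1<\dots<j_m\}\subseteq[2n]$, $\gamma_S=i^{\binom m2}\gamma_{j_1}\cdots\gamma_{j_m}$, and $\mathcal S_m=\{S\subseteq[2n]:|S|=m\}$. For $\eta\in[0,1]$ let $\mathsf M^\eta_S(\pm)=\frac12(I\pm\eta\gamma_S)$. A finite family of POVMs $\mathsf M_j$ is jointly measurable (compatible) if there exist a POVM $\mathsf G$ on a finite set $\Lambda$ and stochastic maps $D(e|j,\lambda)\ge0$, $\sum_eD(e|j,\lambda)=1$, with $\mathsf M_j(e)=\sum_\lambda D(e|j,\lambda)\mathsf G(\lambda)$. The incompatibility robustness is $\eta_m^*=\sup\{\eta\in[0,1]:\{\mathsf M^\eta_S\}_{S\in\mathcal S_m}\text{ is jointly measurable}\}$. A real $m\times m$ Hadamard matrix is a matrix $H$ with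 entries $\pm1$ and $HH^T=mI$; it is skew-Hadamard if moreover $H+H^T=2I$. *)

theory Defs
  imports Complex_Main "HOL-Library.Landau_Symbols" "Jordan_Normal_Form.Matrix"
begin

(* Hilbert space (C^2)^{\<otimes> n} is represented by complex 2^n x 2^n matrices (indices 0..<2^n). *)

definition is_herm :: "nat \<Rightarrow> complex mat \<Rightarrow> bool" where
  "is_herm d A \<longleftrightarrow> A \<in> carrier_mat d d \<and> (\<forall>a<d. \<forall>b<d. A $$ (a,b) = cnj (A $$ (b,a)))"

definition is_psd :: "nat \<Rightarrow> complex mat \<Rightarrow> bool" where
  "is_psd d A \<longleftrightarrow> A \<in> carrier_mat d d \<and>
     (\<forall>v :: nat \<Rightarrow> complex. let q = (\<Sum>a<d. \<Sum>b<d. cnj (v a) * A $$ (a,b) * v b)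
        in Im q = 0 \<and> Re q \<ge> 0)"

definition majorana :: "nat \<Rightarrow> (nat \<Rightarrow> complex mat) \<Rightarrow> bool" where
  "majorana n \<gamma> \<longleftrightarrow>
     (\<forall>j<2*n. is_herm (2^n) (\<gamma> j)) \<and>
     (\<forall>j<2*n. \<forall>j'<2*n. \<gamma> j * \<gamma> j' + \<gamma> j' * \<gamma> j =
        (if j = j' then 2 else 0) \<cdot>\<^sub>m (1\<^sub>m (2^n)))"

definition gamma_S :: "nat \<Rightarrow> (nat \<Rightarrow> complex mat) \<Rightarrow> nat set \<Rightarrow> complex mat" where
  "gamma_S n \<gamma> S = (\<i> ^ (card S choose 2)) \<cdot>\<^sub>m
      foldr (\<lambda>j M. \<gamma> j * M) (sorted_list_of_set S) (1\<^sub>m (2^n))"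

definition subsets_m :: "nat \<Rightarrow> nat \<Rightarrow> nat set set" where
  "subsets_m n m = {S. S \<subseteq> {0..<2*n} \<and> card S = m}"

definition noisy_obs :: "nat \<Rightarrow> (nat \<Rightarrow> complex mat) \<Rightarrow> real \<Rightarrow> nat set \<Rightarrow> bool \<Rightarrow> complex mat" where
  "noisy_obs n \<gamma> \<eta> S e = (1/2 :: complex) \<cdot>\<^sub>m
      (1\<^sub>m (2^n) + (if e then complex_of_real \<eta> else - complex_of_real \<eta>) \<cdot>\<^sub>m gamma_S n \<gamma> S)"

definition is_povm :: "nat \<Rightarrow> 'e set \<Rightarrow> ('e \<Rightarrow> complex mat) \<Rightarrow> bool" where
  "is_povm d E M \<longleftrightarrow> finite E \<and> (\<forall>e\<in>E. is_psd d (M e)) \<and>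
     (\<forall>a<d. \<forall>b<d. (\<Sum>e\<in>E. M e $$ (a,b)) = (if a = b then 1 else 0))"

(* a family of POVMs M j (j \<in> J) with outcome sets E j is jointly measurable:
   there are a POVM G on a finite set \<Lambda> and stochastic maps D with
   M j e = \<Sum>l\<in>\<Lambda>. D j e l G \<lambda>.  (Any finite \<Lambda> may be taken inside nat.) *)
definition jointly_measurable ::
    "nat \<Rightarrow> 'j set \<Rightarrow> ('j \<Rightarrow> 'e set) \<Rightarrow> ('j \<Rightarrow> 'e \<Rightarrow> complex mat) \<Rightarrow> bool" where
  "jointly_measurable d J E M \<longleftrightarrow>
     (\<exists>(\<Lambda> :: nat set) (G :: nat \<Rightarrow> complex mat) (D :: 'j \<Rightarrow> 'e \<Rightarrow> nat \<Rightarrow> real).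
        is_povm d \<Lambda> G \<and>
        (\<forall>j\<in>J. \<forall>l\<in>\<Lambda>. (\<forall>e\<in>E j. D j e l \<ge> 0) \<and> (\<Sum>e\<in>E j. D j e l) = 1) \<and>
        (\<forall>j\<in>J. \<forall>e\<in>E j. M j e \<in> carrier_mat d d \<and>
           (\<forall>a<d. \<forall>b<d. M j e $$ (a,b) = (\<Sum>l\<in>\<Lambda>. complex_of_real (D j e l) * G l $$ (a,b)))))"

definition eta_star :: "nat \<Rightarrow> (nat \<Rightarrow> complex mat) \<Rightarrow> nat \<Rightarrow> real" where
  "eta_star n \<gamma> m = Sup {\<eta> \<in> {0..1}.
      jointly_measurable (2^n) (subsets_m n m) (\<lambda>_. UNIV) (\<lambda>S e. noisy_obs n \<gamma> \<eta> S e)}"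

definition is_hadamard :: "nat \<Rightarrow> real mat \<Rightarrow> bool" where
  "is_hadamard m H \<longleftrightarrow> H \<in> carrier_mat m m \<and>
     (\<forall>a<m. \<forall>b<m. H $$ (a,b) \<in> {1, -1}) \<and> H * transpose_mat H = real m \<cdot>\<^sub>m 1\<^sub>m m"

definition is_skew_hadamard :: "nat \<Rightarrow> real mat \<Rightarrow> bool" where
  "is_skew_hadamard m H \<longleftrightarrow> is_hadamard m H \<and> H + transpose_mat H = 2 \<cdot>\<^sub>m 1\<^sub>m m"

end

theory Submission
  imports Defs "HOL-Real_Asymp.Real_Asymp" "HOL-Analysis.Convex" "Jordan_Normal_Form.Determinant"
begin

text \<open>
  If the noisy observables are jointly measurable at level \<open>\<eta>\<close>, then some POVM element \<open>G\<close> satisfies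
  \<open>\<eta> |\<S>\<^sub>m| tr G \<le> \<Sum>\<^sub>S |tr (G \<gamma>\<^sub>S)|\<close>.  For even \<open>m = 2k\<close> the symmetrised moments
  \<open>tr (G {\<gamma>\<^sub>S, \<gamma>\<^sub>T}) / 2\<close> form a positive semidefinite matrix that vanishes when \<open>|S \<inter> T|\<close> is odd, so the
  Lovasz bound \<open>\<Sum>\<^sub>S (tr (G \<gamma>\<^sub>S))\<^sup>2 \<le> (n choose k) (tr G)\<^sup>2\<close> follows from a dual certificate in the Johnson
  scheme \<open>J(2n, 2k)\<close>: a nonnegative combination of the projections onto the odd eigenspaces whose
  entries are \<open>-1\<close> for \<open>|S \<inter> T| = 0, 2, \<dots>, 2k - 2\<close>.  For large \<open>n\<close> the linear system for its
  coefficients is, after rescaling, a perturbation of a bidiagonal one with a positive solution.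

  Conversely, conjugating any states by all products of Majorana operators gives a covariant POVM, so
  \<open>\<eta>\<close> is attained as soon as \<open>\<eta>\<close> bounds the averages of \<open>|tr (\<rho> \<gamma>\<^sub>S)|\<close> from below.  Take
  Gaussian states whose covariance is a rescaled skew conference matrix of order \<open>N\<close> on a random set of
  \<open>N\<close> modes: by Wick's theorem the moments are Pfaffians of \<open>\<plusminus>1\<close> matrices, hence odd integers, times
  \<open>(N - 1) powr (-k/2)\<close>.

  For \<open>m = 2\<close> equality forces a covariance matrix arbitrarily close to a rescaled sign matrix \<open>A\<close>
  with \<open>A A\<^sup>T\<close> nearly diagonal; \<open>A A\<^sup>T\<close> is integral, so \<open>A + 1\<close> is skew-Hadamard.
\<close>

section \<open>Hahn polynomials and the linear system of the dual certificate\<close>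

text \<open>One test family dictates the shape of the certificate: join the 2n modes into n pairs
  and take the \<open>n choose k\<close> unions of k pairs. Their observables commute, so a common
  eigenvector gives each of them squared moment 1 and no bound below \<open>n choose k\<close> is
  possible. Odd kernels fit because they sum to 0 over this family: they are built from products of
  differences x_a - x_b over disjoint edges; gluing the points of each pair turns the edges into
  paths and cycles, an odd number of edges leaves a component with an odd number of them, and
  reversing that component changes the sign. So the off-diagonal values -1 already determine the
  diagonal one, and the obstacle is nonnegativity of the coefficients, for which n is taken large.

  For the lower bound, a conference matrix of order 2n may not exist. Powers of two give the right
  order of magnitude: one of them lies in (n, 2n], and a given 2k-set is inside a fraction of its
  mode sets that is bounded below. Absolute values of moments cost nothing, since the signs of
  states and of conjugations are undone by relabelling outcomes.\<close>

text \<open>Up to a positive factor a Hahn polynomial: the degree \<open>j\<close> zonal kernel of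
  the Johnson scheme at two sets with \<open>p\<close> common points, \<open>q\<close> and
  \<open>r\<close> private points and \<open>s\<close> points outside both. One step picks either a
  common and an outside point (weight 1) or a private point of each set (weight -1); the factor 2
  counts orientations. Real arguments allow the limit in \<open>s\<close>.\<close>

primrec hahn :: "nat \<Rightarrow> real \<Rightarrow> real \<Rightarrow> real \<Rightarrow> real \<Rightarrow> real" where
  "hahn 0 p q r s = 1"
| "hahn (Suc j) p q r s =
     2 * (p * s * hahn j (p - 1) q r (s - 1) - q * r * hahn j p (q - 1) (r - 1) s)"

text \<open>Leading coefficient of \<open>hahn j p q q s\<close> for large \<open>s\<close>, the
  leading power being \<open>s ^ min p j\<close>. Every step on a common point brings one factor
  \<open>s\<close>, so a step on private points keeps the top order only if all common points still
  fit into the remaining steps, that is if \<open>p \<le> j\<close>.\<close>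

primrec hahn_lim :: "nat \<Rightarrow> nat \<Rightarrow> nat \<Rightarrow> real" where
  "hahn_lim 0 p q = 1"
| "hahn_lim (Suc j) p q =
     2 * ((if p = 0 then 0 else real p * hahn_lim j (p - 1) q)
       - (if p \<le> j then (real q)\<^sup>2 * hahn_lim j p (q - 1) else 0))"

text \<open>A top-order term uses private points in exactly \<open>j - p\<close> steps (none if
  \<open>j \<le> p\<close>), each with a minus sign, so all such terms have the same sign and
  nothing cancels. The hypothesis makes sure that enough points exist for one such term.\<close>

lemma hahn_lim_sign:
  assumes "j \<le> p + q"
  shows "(-1) ^ (j - p) * hahn_lim j p q > 0"
  using assms
proof (induction j arbitrary: p q)
  case 0
  then show ?case by simp
next
  case (Suc j)
  show ?case
  proof (cases "p \<le> j")
    case False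
    then have "(-1) ^ (j - (p - 1)) * hahn_lim j (p - 1) q > 0"
      using Suc.prems by (intro Suc.IH) simp
    with False show ?thesis by simp
  next
    case True
    then have "q > 0" using Suc.prems by simp
    then have 1: "(-1) ^ (j - p) * hahn_lim j p (q - 1) > 0"
      using Suc.prems by (intro Suc.IH) simp
    have 2: "(-1) ^ (Suc j - p) * hahn_lim j (p - 1) q > 0" if "p > 0"
    proof -
      have "Suc j - p = j - (p - 1)" using that by simp
      moreover have "(-1) ^ (j - (p - 1)) * hahn_lim j (p - 1) q > 0"
        using Suc.prems by (intro Suc.IH) simp
      ultimately show ?thesis by (simp only:)
    qed
    have e: "(-1) ^ (Suc j - p) * hahn_lim (Suc j) p q =
       2 * ((if p = 0 then 0 else real p * ((-1) ^ (Suc j - p) * hahn_lim j (p - 1) q))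
         + (real q)\<^sup>2 * ((-1) ^ (j - p) * hahn_lim j p (q - 1)))"
      using True by (simp add: Suc_diff_le algebra_simps)
    have "(real q)\<^sup>2 * ((-1) ^ (j - p) * hahn_lim j p (q - 1)) > 0"
      using 1 \<open>q > 0\<close> by (simp only: zero_less_mult_iff) simp
    moreover have "(if p = 0 then 0 else real p * ((-1) ^ (Suc j - p) * hahn_lim j (p - 1) q)) \<ge> 0"
    proof (cases "p = 0")
      case False
      then have "real p * ((-1) ^ (Suc j - p) * hahn_lim j (p - 1) q) \<ge> 0"
        using 2 by (intro mult_nonneg_nonneg less_imp_le) auto
      with False show ?thesis by (simp only: if_False)
    qed simp
    ultimately have "0 < (if p = 0 then 0 else real p * ((-1) ^ (Suc j - p) * hahn_lim j (p - 1) q)) +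
        (real q)\<^sup>2 * ((-1) ^ (j - p) * hahn_lim j p (q - 1))"
      by (rule add_nonneg_pos[rotated])
    then show ?thesis unfolding e by (rule mult_pos_pos[OF zero_less_numeral])
  qed
qed

lemma hahn_tendsto:
  "((\<lambda>s. hahn j (real p) (real q) (real q) s / s ^ min p j) \<longlongrightarrow> hahn_lim j p q) at_top"
proof (induction j arbitrary: p q)
  case 0
  then show ?case by simp
next
  case (Suc j)
  have shift: "filterlim (\<lambda>s::real. s - 1) at_top at_top"
    using filterlim_tendsto_add_at_top[OF tendsto_const[of "-1::real"] filterlim_ident] by simp
  have inv: "((\<lambda>s::real. 1 / s) \<longlongrightarrow> 0) at_top"
    by real_asymp
  have ratio: "((\<lambda>s::real. (s - 1) / s) \<longlongrightarrow> 1) at_top"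
    by real_asymp
  have A: "((\<lambda>s. real p * s * hahn j (real p - 1) (real q) (real q) (s - 1) / s ^ min p (Suc j)) \<longlongrightarrow>
      (if p = 0 then 0 else real p * hahn_lim j (p - 1) q)) at_top"
  proof (cases p)
    case 0
    then show ?thesis by simp
  next
    case (Suc p')
    have "((\<lambda>s. real p * (hahn j (real p') (real q) (real q) (s - 1) / (s - 1) ^ min p' j * ((s - 1) / s) ^ min p' j))
        \<longlongrightarrow> real p * (hahn_lim j p' q * 1 ^ min p' j)) at_top"
      by (intro tendsto_intros ratio filterlim_compose[OF Suc.IH shift])
    then show ?thesis
    proof (rule Lim_transform_eventually[where f = "\<lambda>s. real p * (hahn j (real p') (real q) (real q) (s - 1) / (s - 1) ^ min p' j * ((s - 1) / s) ^ min p' j)", THEN tendsto_eq_rhs])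
      show "\<forall>\<^sub>F s in at_top. real p * (hahn j (real p') (real q) (real q) (s - 1) / (s - 1) ^ min p' j * ((s - 1) / s) ^ min p' j)
         = real p * s * hahn j (real p - 1) (real q) (real q) (s - 1) / s ^ min p (Suc j)"
        using eventually_gt_at_top[of "1::real"]
        by eventually_elim (simp add: Suc power_divide)
    qed (use Suc in simp)
  qed
  have B: "((\<lambda>s. real q * real q * hahn j (real p) (real q - 1) (real q - 1) s / s ^ min p (Suc j)) \<longlongrightarrow>
      (if p \<le> j then (real q)\<^sup>2 * hahn_lim j p (q - 1) else 0)) at_top"
  proof (cases "q = 0")
    case True
    then show ?thesis by simp
  next
    case False
    then have q: "real q - 1 = real (q - 1)" by simp
    note IH = Suc.IH[of p "q - 1", folded q]
    show ?thesis
    proof (cases "p \<le> j")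
      case True
      have "((\<lambda>s. real q * real q * (hahn j (real p) (real q - 1) (real q - 1) s / s ^ min p j)) \<longlongrightarrow>
          real q * real q * hahn_lim j p (q - 1)) at_top"
        by (intro tendsto_intros IH)
      with True show ?thesis by (simp add: power2_eq_square)
    next
      case False
      \<comment> \<open>For \<open>p > j\<close> the normalising power grows by one while the order
        of this term does not, so a spare factor \<open>1 / s\<close> kills it.\<close>
      have "((\<lambda>s. real q * real q * (hahn j (real p) (real q - 1) (real q - 1) s / s ^ min p j * (1 / s))) \<longlongrightarrow>
          real q * real q * (hahn_lim j p (q - 1) * 0)) at_top"
        by (intro tendsto_intros IH inv)
      with False show ?thesis by (simp add: mult.commute)
    qed
  qed
  have "((\<lambda>s. 2 * (real p * s * hahn j (real p - 1) (real q) (real q) (s - 1) / s ^ min p (Suc j)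
      - real q * real q * hahn j (real p) (real q - 1) (real q - 1) s / s ^ min p (Suc j)))
      \<longlongrightarrow> hahn_lim (Suc j) p q) at_top"
    unfolding hahn_lim.simps by (intro tendsto_intros A B)
  then show ?case by (simp add: diff_divide_distrib)
qed

text \<open>Elimination of the last unknown keeps the limit system lower triangular, so the solution of
  a perturbed system converges to the solution of the limit system.\<close>

lemma perturbed_triangular_system:
  fixes B :: "nat \<Rightarrow> nat \<Rightarrow> nat \<Rightarrow> real" and c :: "nat \<Rightarrow> nat \<Rightarrow> real"
  assumes "\<And>i j. i < k \<Longrightarrow> j < k \<Longrightarrow> (\<lambda>n. B n i j) \<longlonglongrightarrow> L i j"
    and "\<And>i. i < k \<Longrightarrow> (\<lambda>n. c n i) \<longlonglongrightarrow> d i"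
    and "\<And>i j. i < j \<Longrightarrow> j < k \<Longrightarrow> L i j = 0"
    and "\<And>i. i < k \<Longrightarrow> L i i \<noteq> 0"
    and "\<And>i. i < k \<Longrightarrow> (\<Sum>j\<le>i. L i j * y j) = d i"
  shows "\<exists>x. (\<forall>j<k. (\<lambda>n. x n j) \<longlonglongrightarrow> y j) \<and>
             (\<forall>\<^sub>F n in sequentially. \<forall>i<k. (\<Sum>j<k. B n i j * x n j) = c n i)"
  using assms
proof (induction k arbitrary: B c)
  case 0
  then show ?case by auto
next
  case (Suc k)
  define B' where "B' n i j = B n i j - B n i k * B n k j / B n k k" for n i j
  define c' where "c' n i = c n i - B n i k * c n k / B n k k" for n i
  have "\<exists>x. (\<forall>j<k. (\<lambda>n. x n j) \<longlonglongrightarrow> y j) \<and>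
             (\<forall>\<^sub>F n in sequentially. \<forall>i<k. (\<Sum>j<k. B' n i j * x n j) = c' n i)"
  proof (rule Suc.IH)
    fix i j assume ij: "i < k" "j < k"
    have "(\<lambda>n. B' n i j) \<longlonglongrightarrow> L i j - L i k * L k j / L k k"
      unfolding B'_def using ij Suc.prems(4)[of k] by (intro tendsto_intros Suc.prems(1)) auto
    with Suc.prems(3)[of i k] ij show "(\<lambda>n. B' n i j) \<longlonglongrightarrow> L i j" by simp
  next
    fix i assume i: "i < k"
    have "(\<lambda>n. c' n i) \<longlonglongrightarrow> d i - L i k * d k / L k k"
      unfolding c'_def using i Suc.prems(4)[of k]
      by (intro tendsto_intros Suc.prems(1) Suc.prems(2)) auto
    with Suc.prems(3)[of i k] i show "(\<lambda>n. c' n i) \<longlonglongrightarrow> d i" by simp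
  qed (use Suc.prems in auto)
  then obtain x where x: "\<And>j. j < k \<Longrightarrow> (\<lambda>n. x n j) \<longlonglongrightarrow> y j"
    and xe: "\<forall>\<^sub>F n in sequentially. \<forall>i<k. (\<Sum>j<k. B' n i j * x n j) = c' n i"
    by auto
  define x' where "x' n j = (if j < k then x n j else (c n k - (\<Sum>j<k. B n k j * x n j)) / B n k k)"
    for n j
  have Lk: "L k k \<noteq> 0" using Suc.prems(4) by simp
  have "(\<lambda>n. x' n j) \<longlonglongrightarrow> y j" if "j < Suc k" for j
  proof (cases "j < k")
    case True
    then show ?thesis using x by (simp add: x'_def)
  next
    case False
    have "(\<lambda>n. (c n k - (\<Sum>j<k. B n k j * x n j)) / B n k k) \<longlonglongrightarrow>
        (d k - (\<Sum>j<k. L k j * y j)) / L k k"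
      using Lk by (intro tendsto_intros Suc.prems(1) Suc.prems(2) x) auto
    also have "(d k - (\<Sum>j<k. L k j * y j)) / L k k = y k"
      using Suc.prems(5)[of k] Lk by (simp add: field_simps flip: lessThan_Suc_atMost)
    finally show ?thesis using False that by (simp add: x'_def less_Suc_eq)
  qed
  moreover have "\<forall>\<^sub>F n in sequentially. \<forall>i<Suc k. (\<Sum>j<Suc k. B n i j * x' n j) = c n i"
  proof -
    have "\<forall>\<^sub>F n in sequentially. B n k k \<noteq> 0"
      using tendsto_imp_eventually_ne[OF Suc.prems(1)[of k k] Lk] by simp
    with xe show ?thesis
    proof eventually_elim
      case (elim n)
      have s: "(\<Sum>j<k. B n i j * x' n j) = (\<Sum>j<k. B n i j * x n j)" for i
        by (simp add: x'_def)
      show ?case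
      proof (intro allI impI)
        fix i assume "i < Suc k"
        show "(\<Sum>j<Suc k. B n i j * x' n j) = c n i"
        proof (cases "i = k")
          case True
          then show ?thesis using elim(2) by (simp add: s, simp add: x'_def)
        next
          case False
          then have "(\<Sum>j<k. B' n i j * x n j) = c' n i" using elim(1) \<open>i < Suc k\<close> by simp
          moreover have "(\<Sum>j<k. B' n i j * x n j) =
            (\<Sum>j<k. B n i j * x n j) - B n i k * (\<Sum>j<k. B n k j * x n j) / B n k k"
            by (simp add: B'_def left_diff_distrib sum_subtractf sum_distrib_left sum_divide_distrib mult.assoc)
          ultimately show ?thesis using elim(2)
            by (simp add: s, simp add: x'_def c'_def field_simps)
        qed
      qed
    qed
  qed
  ultimately show ?case by blast
qed

text \<open>Two 2k-subsets of 2n points with \<open>2 * e\<close> common points have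
  \<open>2 * k - 2 * e\<close> private points each and leave \<open>2 * n - 4 * k + 2 * e\<close>
  points outside; the degree is \<open>2 * b + 1\<close>.\<close>

definition odd_kernel :: "nat \<Rightarrow> nat \<Rightarrow> nat \<Rightarrow> nat \<Rightarrow> real" where
  "odd_kernel n k e b = hahn (2*b+1) (real (2*e)) (real (2*k-2*e)) (real (2*k-2*e)) (2 * real n - 4 * real k + 2 * real e)"

text \<open>The kernel grows like n to the power min(2e, 2b+1). This exponent is at most e + b, with
  equality exactly when 2e and 2b+1 are neighbours, so scaling row e by n^e and column b by n^b
  leaves a lower bidiagonal limit.\<close>

lemma odd_kernel_tendsto:
  "(\<lambda>n. odd_kernel n k e b / real n ^ (e + b)) \<longlonglongrightarrow>
         (if b = e \<or> Suc b = e then 2 ^ (e + b) * hahn_lim (2*b+1) (2*e) (2*k-2*e) else 0)"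
proof -
  define s where "s n = 2 * real n - 4 * real k + 2 * real e" for n
  define h where "h x = hahn (2*b+1) (real (2*e)) (real (2*k-2*e)) (real (2*k-2*e)) x" for x
  define m where "m = min (2*e) (2*b+1)"
  have s: "filterlim s at_top sequentially"
    unfolding s_def by real_asymp
  have 1: "(\<lambda>n. h (s n) / s n ^ m) \<longlonglongrightarrow> hahn_lim (2*b+1) (2*e) (2*k-2*e)"
    unfolding h_def m_def by (rule filterlim_compose[OF hahn_tendsto s])
  have 2: "(\<lambda>n. s n / real n) \<longlonglongrightarrow> 2"
    unfolding s_def by real_asymp
  have le: "m \<le> e + b" unfolding m_def by linarith
  have 3: "(\<lambda>n. 1 / real n ^ (e + b - m)) \<longlonglongrightarrow> (if b = e \<or> Suc b = e then 1 else 0)"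
  proof (cases "b = e \<or> Suc b = e")
    case True
    then have "e + b - m = 0" unfolding m_def by auto
    with True show ?thesis by simp
  next
    case False
    then have "e + b - m > 0" unfolding m_def by linarith
    then have "(\<lambda>n. (1 / real n) ^ (e + b - m)) \<longlonglongrightarrow> 0 ^ (e + b - m)"
      by (intro tendsto_power lim_1_over_n)
    with False \<open>e + b - m > 0\<close> show ?thesis by (simp add: power_one_over zero_power)
  qed
  have "(\<lambda>n. h (s n) / s n ^ m * (s n / real n) ^ m * (1 / real n ^ (e + b - m))) \<longlonglongrightarrow>
      hahn_lim (2*b+1) (2*e) (2*k-2*e) * 2 ^ m * (if b = e \<or> Suc b = e then 1 else 0)"
    by (intro tendsto_intros 1 2 3)
  moreover have "m = e + b" if "b = e \<or> Suc b = e"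
    using that unfolding m_def by auto
  ultimately have lim: "(\<lambda>n. h (s n) / s n ^ m * (s n / real n) ^ m * (1 / real n ^ (e + b - m))) \<longlonglongrightarrow>
      (if b = e \<or> Suc b = e then 2 ^ (e + b) * hahn_lim (2*b+1) (2*e) (2*k-2*e) else 0)"
    by (cases "b = e \<or> Suc b = e") (simp_all add: mult.commute del: hahn_lim.simps)
  have "\<forall>\<^sub>F n in sequentially. s n > 0"
    using s by (simp add: filterlim_at_top_dense)
  then have "\<forall>\<^sub>F n in sequentially. h (s n) / s n ^ m * (s n / real n) ^ m * (1 / real n ^ (e + b - m)) = h (s n) / real n ^ (e + b)"
    using eventually_gt_at_top[of "0::nat"]
  proof eventually_elim
    case (elim n)
    have "real n ^ (e + b) = real n ^ m * real n ^ (e + b - m)"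
      using le by (simp flip: power_add)
    with elim show ?case by (simp add: power_divide)
  qed
  with lim show ?thesis
    unfolding odd_kernel_def h_def s_def by (rule Lim_transform_eventually)
qed

text \<open>After rescaling, the limit system has negative diagonal, positive subdiagonal and
  right-hand side (-1, 0, ..., 0). Forward substitution therefore yields strictly positive unknowns,
  and strict positivity survives a small perturbation.\<close>

lemma dual_weights_exist:
  "\<forall>\<^sub>F n in sequentially. \<exists>w :: nat \<Rightarrow> real. (\<forall>b<k. w b \<ge> 0) \<and>
     (\<forall>e<k. (\<Sum>b<k. w b * odd_kernel n k e b) = -1)"
proof -
  define B where "B n e b = odd_kernel n k e b / real n ^ (e + b)" for n e b
  define L where "L e b = (if b = e \<or> Suc b = e then 2 ^ (e + b) * hahn_lim (2*b+1) (2*e) (2*k-2*e) else 0)"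
    for e b
  define c where "c n e = - ((1 / real n) ^ e)" for n e :: nat
  define d where "d e = (if e = 0 then -1 else 0 :: real)" for e :: nat
  define y where "y = rec_nat (-1 / L 0 0) (\<lambda>e z. - L (Suc e) e * z / L (Suc e) (Suc e))"
  have diag: "L e e < 0" if "e < k" for e
    using hahn_lim_sign[of "2*e+1" "2*e" "2*k-2*e"] that by (auto simp: L_def mult_pos_neg simp del: hahn_lim.simps)
  have sub: "L (Suc e) e > 0" if "Suc e < k" for e
    using hahn_lim_sign[of "2*e+1" "2*Suc e" "2*k-2*Suc e"] that
    by (auto simp: L_def simp del: hahn_lim.simps intro!: mult_pos_pos)
  have y: "y e > 0" if "e < k" for e
    using that
  proof (induction e)
    case 0
    then show ?case using diag[of 0] by (simp add: y_def divide_neg_neg)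
  next
    case (Suc e)
    have "y (Suc e) = - L (Suc e) e * y e / L (Suc e) (Suc e)" by (simp add: y_def)
    also have "\<dots> > 0"
      using sub[of e] diag[of "Suc e"] Suc by (intro divide_neg_neg) (auto simp: mult_neg_pos)
    finally show ?case .
  qed
  have "\<exists>x. (\<forall>j<k. (\<lambda>n. x n j) \<longlonglongrightarrow> y j) \<and>
             (\<forall>\<^sub>F n in sequentially. \<forall>i<k. (\<Sum>j<k. B n i j * x n j) = c n i)"
  proof (rule perturbed_triangular_system)
    show "(\<lambda>n. B n i j) \<longlonglongrightarrow> L i j" for i j
      unfolding B_def L_def by (rule odd_kernel_tendsto)
    show "(\<lambda>n. c n i) \<longlonglongrightarrow> d i" for i
    proof -
      have "(\<lambda>n. - ((1 / real n) ^ i)) \<longlonglongrightarrow> - (0 ^ i)"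
        by (intro tendsto_intros lim_1_over_n)
      then show ?thesis by (cases "i = 0") (auto simp: c_def d_def zero_power)
    qed
    show "L i j = 0" if "i < j" for i j
      using that by (simp add: L_def)
    show "L i i \<noteq> 0" if "i < k" for i
      using diag[OF that] by simp
    show "(\<Sum>j\<le>i. L i j * y j) = d i" if "i < k" for i
    proof (cases i)
      case 0
      then show ?thesis using diag[of 0] that by (simp add: y_def d_def)
    next
      case (Suc e)
      have "(\<Sum>j<e. L i j * y j) = 0"
        using Suc by (intro sum.neutral) (auto simp: L_def)
      then have "(\<Sum>j\<le>i. L i j * y j) = L i e * y e + L i i * y i"
        using Suc by (simp flip: lessThan_Suc_atMost)
      also have "y i = - L i e * y e / L i i" using Suc by (simp add: y_def)
      finally show ?thesis using diag[OF that] Suc by (simp add: d_def)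
    qed
  qed
  then obtain x where x: "\<And>j. j < k \<Longrightarrow> (\<lambda>n. x n j) \<longlonglongrightarrow> y j"
    and xe: "\<forall>\<^sub>F n in sequentially. \<forall>i<k. (\<Sum>j<k. B n i j * x n j) = c n i"
    by auto
  have "\<forall>\<^sub>F n in sequentially. \<forall>j\<in>{..<k}. x n j > 0"
    using x y by (intro eventually_ball_finite ballI order_tendstoD(1)[OF x]) auto
  with xe eventually_gt_at_top[of "0::nat"] show ?thesis
  proof eventually_elim
    case (elim n)
    define w where "w b = x n b / real n ^ b" for b
    have "(\<Sum>b<k. w b * odd_kernel n k e b) = -1" if "e < k" for e
    proof -
      have "(\<Sum>b<k. w b * odd_kernel n k e b) = real n ^ e * (\<Sum>b<k. B n e b * x n b)"
        unfolding sum_distrib_left using elim(2)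
        by (intro sum.cong) (auto simp: w_def B_def power_add field_simps)
      also have "(\<Sum>b<k. B n e b * x n b) = - ((1 / real n) ^ e)"
        using elim(1) that unfolding c_def by blast
      also have "real n ^ e * - ((1 / real n) ^ e) = -1"
        using elim(2) by (simp add: power_divide)
      finally show ?thesis .
    qed
    moreover have "\<forall>b<k. w b \<ge> 0"
      using elim(3) by (auto simp: w_def less_imp_le)
    ultimately show ?case by blast
  qed
qed

section \<open>Odd kernels sum to zero over the unions of pairs of a perfect matching\<close>

text \<open>Counts the terms of the recursion with \<open>l\<close> steps on common points: choose
  these points and place them injectively outside, match \<open>j - l\<close> private points on each
  side, then order the \<open>j\<close> steps and orient each pair.\<close>

lemma hahn_closed_form:
  "hahn j (real p) (real q) (real q) s = 2 ^ j * fact j *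
     (\<Sum>l\<le>j. (-1) ^ (j - l) * real (p choose l) * (real (q choose (j - l)))\<^sup>2 * fact (j - l) * (\<Prod>i<l. s - real i))"
proof (induction j arbitrary: p q s)
  case 0
  then show ?case by simp
next
  case (Suc j)
  define T where "T l l' = (-1) ^ l' * real (p choose l) * (real (q choose l'))\<^sup>2 * fact l' * (\<Prod>i<l. s - real i)"
    for l l'
  have absorb: "real m * real ((m - 1) choose l) = real (Suc l) * real (m choose Suc l)" for m l
    using binomial_absorption[of l m] by (metis of_nat_mult)
  have A: "real p * s * hahn j (real p - 1) (real q) (real q) (s - 1) =
     2 ^ j * fact j * (\<Sum>l\<le>j. real (Suc l) * T (Suc l) (j - l))"
  proof (cases "p = 0")
    case True
    then show ?thesis by (simp add: T_def)
  next
    case False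
    have t: "real p * s * ((-1) ^ (j - l) * real ((p - 1) choose l) * (real (q choose (j - l)))\<^sup>2 * fact (j - l) * (\<Prod>i<l. s - 1 - real i))
       = real (Suc l) * T (Suc l) (j - l)" for l
    proof -
      have "(\<Prod>i<Suc l. s - real i) = s * (\<Prod>i<l. s - 1 - real i)"
        by (simp add: prod.lessThan_Suc_shift algebra_simps del: prod.lessThan_Suc)
      moreover have "real p * s * ((-1) ^ (j - l) * real ((p - 1) choose l) * (real (q choose (j - l)))\<^sup>2 * fact (j - l) * (\<Prod>i<l. s - 1 - real i))
          = (real p * real ((p - 1) choose l)) * ((-1) ^ (j - l) * (real (q choose (j - l)))\<^sup>2 * fact (j - l) * (s * (\<Prod>i<l. s - 1 - real i)))"
        by (simp only: mult_ac)
      ultimately show ?thesis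
        unfolding absorb T_def by (simp only: mult_ac)
    qed
    have "hahn j (real p - 1) (real q) (real q) (s - 1) = hahn j (real (p - 1)) (real q) (real q) (s - 1)"
      using False by simp
    then show ?thesis
      unfolding t[symmetric] Suc.IH sum_distrib_left by (simp add: mult_ac sum_distrib_left)
  qed
  have B: "real q * real q * hahn j (real p) (real q - 1) (real q - 1) s =
     - (2 ^ j * fact j * (\<Sum>l\<le>j. real (Suc (j - l)) * T l (Suc (j - l))))"
  proof (cases "q = 0")
    case True
    then show ?thesis by (simp add: T_def)
  next
    case False
    have t: "real q * real q * ((-1) ^ (j - l) * real (p choose l) * (real ((q - 1) choose (j - l)))\<^sup>2 * fact (j - l) * (\<Prod>i<l. s - real i))
       = - (real (Suc (j - l)) * T l (Suc (j - l)))" for l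
    proof -
      have "real q * real q * (real ((q - 1) choose (j - l)))\<^sup>2 = (real (Suc (j-l)) * real (q choose Suc (j-l)))\<^sup>2"
        unfolding absorb[symmetric] by (simp add: power2_eq_square)
      moreover have "real q * real q * ((-1) ^ (j - l) * real (p choose l) * (real ((q - 1) choose (j - l)))\<^sup>2 * fact (j - l) * (\<Prod>i<l. s - real i))
          = (real q * real q * (real ((q - 1) choose (j - l)))\<^sup>2) * ((-1) ^ (j - l) * real (p choose l) * fact (j - l) * (\<Prod>i<l. s - real i))"
        by (simp only: mult_ac)
      ultimately show ?thesis
        unfolding T_def by (simp add: power_mult_distrib power2_eq_square mult_ac del: binomial_Suc_Suc of_nat_Suc)
    qed
    have "hahn j (real p) (real q - 1) (real q - 1) s = hahn j (real p) (real (q - 1)) (real (q - 1)) s"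
      using False by simp
    then have "real q * real q * hahn j (real p) (real q - 1) (real q - 1) s = 2 ^ j * fact j * (\<Sum>l\<le>j.
       real q * real q * ((-1) ^ (j - l) * real (p choose l) * (real ((q - 1) choose (j - l)))\<^sup>2 * fact (j - l) * (\<Prod>i<l. s - real i)))"
      unfolding Suc.IH sum_distrib_left by (simp add: mult_ac sum_distrib_left)
    then show ?thesis
      unfolding t by (simp add: sum_negf)
  qed
  have "hahn (Suc j) (real p) (real q) (real q) s = 2 ^ Suc j * fact j *
     ((\<Sum>l\<le>j. real (Suc l) * T (Suc l) (j - l)) + (\<Sum>l\<le>j. real (Suc (j - l)) * T l (Suc (j - l))))"
    unfolding hahn.simps A B by (simp add: algebra_simps)
  \<comment> \<open>The term \<open>T l (Suc j - l)\<close> gets weight \<open>l\<close> from the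
    first half of the recursion and \<open>Suc j - l\<close> from the second; together they supply
    the missing factor of \<open>fact (Suc j)\<close>.\<close>
  also have "(\<Sum>l\<le>j. real (Suc l) * T (Suc l) (j - l)) = (\<Sum>l\<le>Suc j. real l * T l (Suc j - l))"
    by (subst sum.atMost_Suc_shift) simp
  also have "(\<Sum>l\<le>j. real (Suc (j - l)) * T l (Suc (j - l))) = (\<Sum>l\<le>Suc j. real (Suc j - l) * T l (Suc j - l))"
    by (auto intro!: sum.cong simp: of_nat_diff Suc_diff_le)
  also have "(\<Sum>l\<le>Suc j. real l * T l (Suc j - l)) + (\<Sum>l\<le>Suc j. real (Suc j - l) * T l (Suc j - l))
     = real (Suc j) * (\<Sum>l\<le>Suc j. T l (Suc j - l))"
    unfolding sum.distrib[symmetric] sum_distrib_left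
    by (intro sum.cong) (auto simp: of_nat_diff algebra_simps)
  finally show ?case
    unfolding T_def by (simp add: algebra_simps del: sum.atMost_Suc)
qed

text \<open>The upper indices are those that occur as \<open>k\<close>, \<open>2 * e\<close> or
  \<open>2 * k - 2 * e\<close> with k up to 5. The lower index one is spelled \<open>Suc 0\<close>
  because that is its simplifier normal form.\<close>

lemma small_binomials:
  "(2::nat) choose Suc 0 = 2"
  "(2::nat) choose 2 = 1"
  "(3::nat) choose Suc 0 = 3"
  "(3::nat) choose 2 = 3"
  "(3::nat) choose 3 = 1"
  "(4::nat) choose Suc 0 = 4"
  "(4::nat) choose 2 = 6"
  "(4::nat) choose 3 = 4"
  "(4::nat) choose 4 = 1"
  "(5::nat) choose Suc 0 = 5"
  "(5::nat) choose 2 = 10"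
  "(5::nat) choose 3 = 10"
  "(5::nat) choose 4 = 5"
  "(5::nat) choose 5 = 1"
  "(6::nat) choose Suc 0 = 6"
  "(6::nat) choose 2 = 15"
  "(6::nat) choose 3 = 20"
  "(6::nat) choose 4 = 15"
  "(6::nat) choose 5 = 6"
  "(6::nat) choose 6 = 1"
  "(8::nat) choose Suc 0 = 8"
  "(8::nat) choose 2 = 28"
  "(8::nat) choose 3 = 56"
  "(8::nat) choose 4 = 70"
  "(8::nat) choose 5 = 56"
  "(8::nat) choose 6 = 28"
  "(8::nat) choose 7 = 8"
  "(8::nat) choose 8 = 1"
  "(10::nat) choose Suc 0 = 10"
  "(10::nat) choose 2 = 45"
  "(10::nat) choose 3 = 120"
  "(10::nat) choose 4 = 210"
  "(10::nat) choose 5 = 252"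
  "(10::nat) choose 6 = 210"
  "(10::nat) choose 7 = 120"
  "(10::nat) choose 8 = 45"
  "(10::nat) choose 9 = 10"
  "(10::nat) choose 10 = 1"
  by (simp_all add: eval_nat_numeral)

text \<open>Here x stands for n - k, and multiplication by \<open>fact k\<close> has removed the
  denominators of the binomials. For each of the fifteen pairs (k, b) the closed form gives an
  explicit polynomial in x, whose vanishing is checked by ring normalisation; this is where the
  bound 5 on k enters.\<close>

lemma hahn_orthogonal_matching_poly:
  assumes "1 \<le> k" "k \<le> 5" "b < k"
  shows "(\<Sum>e\<le>k. real (k choose e) * (fact k / fact (k - e) * (\<Prod>i<k - e. x - real i)) *
     hahn (2*b+1) (real (2*e)) (real (2*k-2*e)) (real (2*k-2*e)) (2 * x - 2 * real k + 2 * real e)) = 0"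
proof -
  have "k = 1 \<or> k = 2 \<or> k = 3 \<or> k = 4 \<or> k = 5"
    using assms by linarith
  moreover have "b = 0 \<or> b = 1 \<or> b = 2 \<or> b = 3 \<or> b = 4"
    using assms by linarith
  ultimately have "(k, b) \<in> {(1, 0), (2, 0), (2, 1), (3, 0), (3, 1), (3, 2), (4, 0), (4, 1), (4, 2), (4, 3), (5, 0), (5, 1), (5, 2), (5, 3), (5, 4)}"
    using assms(3) by (elim disjE) simp_all
  moreover define P where "P k b \<longleftrightarrow> (\<Sum>e\<le>k. real (k choose e) * (fact k / fact (k - e) * (\<Prod>i<k - e. x - real i)) *
     hahn (2*b+1) (real (2*e)) (real (2*k-2*e)) (real (2*k-2*e)) (2 * x - 2 * real k + 2 * real e)) = 0"
    for k b
  have "P 1 0" "P 2 0" "P 2 1" "P 3 0" "P 3 1" "P 3 2" "P 4 0" "P 4 1" "P 4 2" "P 4 3" "P 5 0" "P 5 1" "P 5 2" "P 5 3" "P 5 4"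
    unfolding P_def hahn_closed_form
    by (simp add: binomial_eq_0 small_binomials atMost_nat_numeral lessThan_nat_numeral fact_numeral; Groebner_Basis.algebra?)+
  ultimately have "P k b"
    by (elim insertE emptyE Pair_inject) (simp_all only:)
  then show ?thesis by (simp only: P_def)
qed

text \<open>Fix a perfect matching of the 2n points and a union S of k of its edges. Exactly
  \<open>(k choose e) * ((n - k) choose (k - e))\<close> unions T of k edges meet S in 2e points, so
  this is the sum of the kernel over all such T.\<close>

lemma hahn_orthogonal_matching:
  assumes "1 \<le> k" "k \<le> 5" "b < k" "k \<le> n"
  shows "(\<Sum>e\<le>k. real (k choose e) * real ((n - k) choose (k - e)) *
     odd_kernel n k e b) = 0"
    (is "sum ?f _ = 0")
proof -
  have b: "real ((n - k) choose j) = (\<Prod>i<j. real (n - k) - real i) / fact j" for j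
    by (simp add: binomial_gbinomial gbinomial_prod_rev atLeast0LessThan)
  have "fact k * (\<Sum>e\<le>k. ?f e) = 0"
    using hahn_orthogonal_matching_poly[OF assms(1-3), of "real (n - k)"] assms(4)
    unfolding sum_distrib_left b odd_kernel_def
    by (simp add: of_nat_diff algebra_simps del: hahn.simps)
  then show ?thesis by simp
qed

text \<open>Feasible dual solution of the theta bound with value \<open>n choose k\<close>. Odd
  intersection sizes carry no condition because the moment matrix vanishes there; the index
  \<open>e = k\<close> is the diagonal.\<close>

definition dual_certificate :: "nat \<Rightarrow> nat \<Rightarrow> (nat \<Rightarrow> real) \<Rightarrow> bool" where
  "dual_certificate n k w \<longleftrightarrow> (\<forall>b<k. w b \<ge> 0) \<and>
     (\<forall>e<k. (\<Sum>b<k. w b * odd_kernel n k e b) = -1) \<and>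
     (\<Sum>b<k. w b * odd_kernel n k k b) = real (n choose k) - 1"

text \<open>The diagonal value comes for free: the row sum over the matched family is 0, the family
  has \<open>n choose k\<close> members by Vandermonde, and all of them but S itself contribute
  -1.\<close>

lemma dual_certificate_exists:
  assumes "1 \<le> k" "k \<le> 5"
  shows "\<forall>\<^sub>F n in sequentially. \<exists>w. dual_certificate n k w"
  using dual_weights_exist[of k] eventually_ge_at_top[of k]
proof eventually_elim
  case (elim n)
  define N where "N e = real (k choose e) * real ((n - k) choose (k - e))" for e
  from elim(1) obtain w where w: "\<forall>b<k. w b \<ge> 0" "\<And>e. e < k \<Longrightarrow> (\<Sum>b<k. w b * odd_kernel n k e b) = -1"
    by blast
  have "(\<Sum>e\<le>k. N e * (\<Sum>b<k. w b * odd_kernel n k e b)) = (\<Sum>b<k. w b * (\<Sum>e\<le>k. N e * odd_kernel n k e b))"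
    unfolding sum_distrib_left by (subst sum.swap) (simp add: mult_ac)
  also have "\<dots> = 0"
    using hahn_orthogonal_matching[OF assms _ elim(2)] by (simp add: N_def)
  finally have 0: "(\<Sum>e\<le>k. N e * (\<Sum>b<k. w b * odd_kernel n k e b)) = 0" .
  have "(\<Sum>e\<le>k. N e) = real (n choose k)"
    unfolding N_def using vandermonde[of k "n - k" k] elim(2) by (simp flip: of_nat_mult of_nat_sum)
  moreover have "N k = 1" by (simp add: N_def)
  ultimately have "(\<Sum>b<k. w b * odd_kernel n k k b) = real (n choose k) - 1"
    using 0 w(2) by (simp add: sum_negf flip: lessThan_Suc_atMost)
  then show ?case using w unfolding dual_certificate_def by blast
qed

section \<open>Positive semidefinite kernels of the Johnson scheme\<close>

definition sep :: "'a set \<Rightarrow> 'a \<Rightarrow> 'a \<Rightarrow> real" where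
  "sep S a b = of_bool (a \<in> S) - of_bool (b \<in> S)"

text \<open>Unfolded, a sum over j-tuples of disjoint ordered pairs (a, b) of the products of
  \<open>sep S a b * sep T a b\<close>. The functions sending S to the product of its
  \<open>sep S a b\<close> span the j-th eigenspace of the Johnson scheme, so on sets of one size
  this is a nonnegative multiple of the projection onto it.\<close>

primrec pair_kernel :: "nat \<Rightarrow> 'a set \<Rightarrow> 'a set \<Rightarrow> 'a set \<Rightarrow> real" where
  "pair_kernel 0 V S T = 1"
| "pair_kernel (Suc j) V S T =
     (\<Sum>a\<in>V. \<Sum>b\<in>V. sep S a b * sep T a b * pair_kernel j (V - {a, b}) S T)"

text \<open>The kernel is an explicit Gram matrix, so its entrywise product with P has a form that
  is a sum of forms of P: each step absorbs \<open>sep S a b\<close> into the coefficient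
  \<open>y S\<close>.\<close>

lemma pair_kernel_psd:
  assumes "\<And>y :: 'a set \<Rightarrow> real. (\<Sum>S\<in>F. \<Sum>T\<in>F. y S * y T * P S T) \<ge> 0"
  shows "(\<Sum>S\<in>F. \<Sum>T\<in>F. y S * y T * (pair_kernel j V S T * P S T)) \<ge> 0"
proof (induction j arbitrary: V y)
  case 0
  then show ?case using assms by simp
next
  case (Suc j)
  let ?t = "\<lambda>S T a b. (y S * sep S a b) * (y T * sep T a b) * (pair_kernel j (V - {a, b}) S T * P S T)"
  have "(\<Sum>S\<in>F. \<Sum>T\<in>F. y S * y T * (pair_kernel (Suc j) V S T * P S T)) =
    (\<Sum>S\<in>F. \<Sum>T\<in>F. \<Sum>a\<in>V. \<Sum>b\<in>V. ?t S T a b)"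
    by (simp add: sum_distrib_left sum_distrib_right mult_ac)
  also have "\<dots> = (\<Sum>S\<in>F. \<Sum>a\<in>V. \<Sum>T\<in>F. \<Sum>b\<in>V. ?t S T a b)"
    by (intro sum.cong refl, rule sum.swap)
  also have "\<dots> = (\<Sum>a\<in>V. \<Sum>S\<in>F. \<Sum>T\<in>F. \<Sum>b\<in>V. ?t S T a b)"
    by (rule sum.swap)
  also have "\<dots> = (\<Sum>a\<in>V. \<Sum>S\<in>F. \<Sum>b\<in>V. \<Sum>T\<in>F. ?t S T a b)"
    by (intro sum.cong refl, rule sum.swap)
  also have "\<dots> = (\<Sum>a\<in>V. \<Sum>b\<in>V. \<Sum>S\<in>F. \<Sum>T\<in>F. ?t S T a b)"
    by (intro sum.cong refl, rule sum.swap)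
  also have "\<dots> \<ge> 0"
    by (intro sum_nonneg Suc.IH)
  finally show ?case .
qed

text \<open>S and T cut V into four cells. The weight \<open>sep S a b * sep T a b\<close> is 1
  between the common and the outer cell, -1 between the two private cells, and 0 for all other
  choices of a and b.\<close>

lemma pair_kernel_eq_hahn:
  assumes "finite V"
  shows "pair_kernel j V S T = hahn j (real (card (V \<inter> S \<inter> T))) (real (card (V \<inter> S - T)))
     (real (card (V \<inter> T - S))) (real (card (V - S - T)))"
  using assms
proof (induction j arbitrary: V)
  case 0
  then show ?case by simp
next
  case (Suc j)
  define A where "A = V \<inter> S \<inter> T"
  define B where "B = V \<inter> S - T"
  define C where "C = V \<inter> T - S"
  define D where "D = V - S - T"
  note defs = A_def B_def C_def D_def
  have fin: "finite A" "finite B" "finite C" "finite D"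
    using Suc.prems by (auto simp: defs)
  define f where "f a b = sep S a b * sep T a b * pair_kernel j (V - {a, b}) S T" for a b
  define h where "h p q r s = hahn j (real p) (real q) (real r) (real s)" for p q r s :: nat
  have k: "pair_kernel j (V - {a, b}) S T = h (card (A - {a,b})) (card (B - {a,b})) (card (C - {a,b})) (card (D - {a,b}))"
    for a b
  proof -
    have "(V - {a,b}) \<inter> S \<inter> T = A - {a,b}" "(V - {a,b}) \<inter> S - T = B - {a,b}"
      "(V - {a,b}) \<inter> T - S = C - {a,b}" "V - {a,b} - S - T = D - {a,b}"
      by (auto simp: defs)
    with Suc show ?thesis by (simp add: h_def)
  qed
  have split: "(\<Sum>x\<in>V. g x) = (\<Sum>x\<in>A. g x) + (\<Sum>x\<in>B. g x) + (\<Sum>x\<in>C. g x) + (\<Sum>x\<in>D. g x)" for g :: "'a \<Rightarrow> real"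
  proof -
    have "V = A \<union> B \<union> C \<union> D" by (auto simp: defs)
    moreover have "A \<inter> B = {}" "(A \<union> B) \<inter> C = {}" "(A \<union> B \<union> C) \<inter> D = {}" by (auto simp: defs)
    ultimately show ?thesis using fin by (simp add: sum.union_disjoint)
  qed
  have sumA: "(\<Sum>b\<in>V. f a b) = real (card D) * h (card A - 1) (card B) (card C) (card D - 1)" if "a \<in> A" for a
  proof -
    have z: "f a b = 0" if "b \<in> A \<union> B \<union> C" for b
      using that \<open>a \<in> A\<close> by (auto simp: f_def sep_def defs)
    have d: "f a b = h (card A - 1) (card B) (card C) (card D - 1)" if "b \<in> D" for b
    proof -
      have "A - {a,b} = A - {a}" "B - {a,b} = B" "C - {a,b} = C" "D - {a,b} = D - {b}"
        using that \<open>a \<in> A\<close> by (auto simp: defs)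
      with that \<open>a \<in> A\<close> fin show ?thesis
        unfolding f_def k by (simp add: sep_def) (auto simp: defs)
    qed
    show ?thesis unfolding split by (simp add: z d)
  qed
  have sumD: "(\<Sum>b\<in>V. f a b) = real (card A) * h (card A - 1) (card B) (card C) (card D - 1)" if "a \<in> D" for a
  proof -
    have z: "f a b = 0" if "b \<in> B \<union> C \<union> D" for b
      using that \<open>a \<in> D\<close> by (auto simp: f_def sep_def defs)
    have d: "f a b = h (card A - 1) (card B) (card C) (card D - 1)" if "b \<in> A" for b
    proof -
      have "A - {a,b} = A - {b}" "B - {a,b} = B" "C - {a,b} = C" "D - {a,b} = D - {a}"
        using that \<open>a \<in> D\<close> by (auto simp: defs)
      with that \<open>a \<in> D\<close> fin show ?thesis
        unfolding f_def k by (simp add: sep_def) (auto simp: defs)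
    qed
    show ?thesis unfolding split by (simp add: z d)
  qed
  have sumB: "(\<Sum>b\<in>V. f a b) = - (real (card C) * h (card A) (card B - 1) (card C - 1) (card D))" if "a \<in> B" for a
  proof -
    have z: "f a b = 0" if "b \<in> A \<union> B \<union> D" for b
      using that \<open>a \<in> B\<close> by (auto simp: f_def sep_def defs)
    have d: "f a b = - h (card A) (card B - 1) (card C - 1) (card D)" if "b \<in> C" for b
    proof -
      have "A - {a,b} = A" "B - {a,b} = B - {a}" "C - {a,b} = C - {b}" "D - {a,b} = D"
        using that \<open>a \<in> B\<close> by (auto simp: defs)
      with that \<open>a \<in> B\<close> fin show ?thesis
        unfolding f_def k by (simp add: sep_def) (auto simp: defs)
    qed
    show ?thesis unfolding split by (simp add: z d)
  qed
  have sumC: "(\<Sum>b\<in>V. f a b) = - (real (card B) * h (card A) (card B - 1) (card C - 1) (card D))" if "a \<in> C" for a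
  proof -
    have z: "f a b = 0" if "b \<in> A \<union> C \<union> D" for b
      using that \<open>a \<in> C\<close> by (auto simp: f_def sep_def defs)
    have d: "f a b = - h (card A) (card B - 1) (card C - 1) (card D)" if "b \<in> B" for b
    proof -
      have "A - {a,b} = A" "B - {a,b} = B - {b}" "C - {a,b} = C - {a}" "D - {a,b} = D"
        using that \<open>a \<in> C\<close> by (auto simp: defs)
      with that \<open>a \<in> C\<close> fin show ?thesis
        unfolding f_def k by (simp add: sep_def) (auto simp: defs)
    qed
    show ?thesis unfolding split by (simp add: z d)
  qed
  have pred: "real m * g (real m - 1) = real m * g (real (m - 1))" for m :: nat and g :: "real \<Rightarrow> real"
    by (cases m) auto
  have "pair_kernel (Suc j) V S T = (\<Sum>a\<in>V. \<Sum>b\<in>V. f a b)"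
    by (simp add: f_def)
  also have "\<dots> = 2 * (real (card A) * real (card D) * h (card A - 1) (card B) (card C) (card D - 1)
      - real (card B) * real (card C) * h (card A) (card B - 1) (card C - 1) (card D))"
    unfolding split[of "\<lambda>a. \<Sum>b\<in>V. f a b"] by (simp add: sumA sumB sumC sumD)
  also have "\<dots> = hahn (Suc j) (real (card A)) (real (card B)) (real (card C)) (real (card D))"
    \<comment> \<open>Truncated and real predecessors differ only for an empty cell, and there the
      prefactor is 0.\<close>
    unfolding h_def hahn.simps
    by (cases "card A = 0"; cases "card B = 0"; cases "card C = 0"; cases "card D = 0") auto
  finally show ?case unfolding defs .
qed

text \<open>The entrywise product of the certificate with P is \<open>(n choose k) * \<tau>\<close>
  times the identity minus P, since P vanishes wherever the certificate is unconstrained. Its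
  positivity at x bounds the form of P from above, while \<open>cs\<close>, the Schur complement of
  the moment matrix bordered by the identity operator, bounds it from below.\<close>

lemma certified_gram_bound:
  fixes x :: "nat set \<Rightarrow> real" and P :: "nat set \<Rightarrow> nat set \<Rightarrow> real" and n k :: nat
  assumes F_def: "F = {S. S \<subseteq> {0..<2*n} \<and> card S = 2 * k}"
    and psd: "\<And>y :: nat set \<Rightarrow> real. (\<Sum>S\<in>F. \<Sum>T\<in>F. y S * y T * P S T) \<ge> 0"
    and diag: "\<And>S. S \<in> F \<Longrightarrow> P S S = \<tau>"
    and odd0: "\<And>S T. S \<in> F \<Longrightarrow> T \<in> F \<Longrightarrow> odd (card (S \<inter> T)) \<Longrightarrow> P S T = 0"
    and cs: "(\<Sum>S\<in>F. (x S)\<^sup>2)\<^sup>2 \<le> \<tau> * (\<Sum>S\<in>F. \<Sum>T\<in>F. x S * x T * P S T)"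
    and \<tau>: "\<tau> \<ge> 0"
    and w: "dual_certificate n k w"
  shows "(\<Sum>S\<in>F. (x S)\<^sup>2) \<le> real (n choose k) * \<tau>\<^sup>2"
proof -
  define V where "V = {0..<2*n}"
  define Q where "Q S T = (\<Sum>b<k. w b * pair_kernel (2*b+1) V S T)" for S T
  have finV: "finite V" unfolding V_def by simp
  have finF: "finite F" unfolding F_def by simp
  have FD: "S \<subseteq> V" "card S = 2 * k" "finite S" if "S \<in> F" for S
    using that finite_subset[of S "{0..<2*n}"] by (auto simp: F_def V_def)
  have kernel: "pair_kernel j V S T = hahn j (real (card (S \<inter> T))) (real (2 * k - card (S \<inter> T)))
      (real (2 * k - card (S \<inter> T))) (2 * real n - 4 * real k + real (card (S \<inter> T)))"
    if "S \<in> F" "T \<in> F" for S T j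
  proof -
    have 1: "V \<inter> S \<inter> T = S \<inter> T" "V \<inter> S - T = S - T" "V \<inter> T - S = T - S" "V - S - T = V - (S \<union> T)"
      using FD[OF that(1)] FD[OF that(2)] by auto
    have 2: "card (S - T) = 2 * k - card (S \<inter> T)" "card (T - S) = 2 * k - card (S \<inter> T)"
      using FD[OF that(1)] FD[OF that(2)] by (simp_all add: card_Diff_subset_Int Int_commute)
    have "card (S \<union> T) + card (S \<inter> T) = 4 * k"
      using FD[OF that(1)] FD[OF that(2)] card_Un_Int[of S T] by simp
    moreover have "card (V - (S \<union> T)) + card (S \<union> T) = 2 * n"
      using FD[OF that(1)] FD[OF that(2)] card_mono[of V "S \<union> T"]
      by (subst card_Diff_subset) (auto simp: V_def)
    ultimately have "card (V - (S \<union> T)) + 4 * k = 2 * n + card (S \<inter> T)" by simp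
    from arg_cong[OF this, of real]
    have 3: "real (card (V - (S \<union> T))) = 2 * real n - 4 * real k + real (card (S \<inter> T))" by simp
    show ?thesis
      unfolding pair_kernel_eq_hahn[OF finV] 1 2 3 ..
  qed
  have Q: "Q S T * P S T = (if S = T then real (n choose k) * \<tau> else 0) - P S T"
    if ST: "S \<in> F" "T \<in> F" for S T
  proof (cases "S = T")
    case True
    then have "Q S T = real (n choose k) - 1"
      using w FD(2)[OF ST(1)] unfolding Q_def kernel[OF ST] dual_certificate_def odd_kernel_def
      by (simp del: hahn.simps)
    with True diag[OF ST(1)] show ?thesis by (simp add: left_diff_distrib)
  next
    case False
    show ?thesis
    proof (cases "odd (card (S \<inter> T))")
      case True
      with odd0[OF ST] False show ?thesis by simp
    next
      case even: False
      then obtain e where e: "card (S \<inter> T) = 2 * e" by blast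
      have "card (S \<inter> T) < 2 * k"
        using False FD[OF ST(1)] FD[OF ST(2)]
        by (metis Int_lower1 Int_lower2 card_subset_eq card_mono le_neq_implies_less)
      then have "e < k" using e by simp
      then have "Q S T = -1"
        using w \<open>e < k\<close> unfolding Q_def kernel[OF ST] e dual_certificate_def odd_kernel_def
        by (simp only: of_nat_mult of_nat_numeral)
      with False show ?thesis by simp
    qed
  qed
  define X where "X = (\<Sum>S\<in>F. (x S)\<^sup>2)"
  let ?t = "\<lambda>b S T. x S * x T * (w b * pair_kernel (2*b+1) V S T * P S T)"
  have "0 \<le> (\<Sum>b<k. w b * (\<Sum>S\<in>F. \<Sum>T\<in>F. x S * x T * (pair_kernel (2*b+1) V S T * P S T)))"
  proof (rule sum_nonneg, rule mult_nonneg_nonneg)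
    show "0 \<le> w b" if "b \<in> {..<k}" for b using w that by (simp add: dual_certificate_def)
    show "0 \<le> (\<Sum>S\<in>F. \<Sum>T\<in>F. x S * x T * (pair_kernel (2*b+1) V S T * P S T))" for b
      using pair_kernel_psd[where F = F and P = P, OF psd] .
  qed
  also have "\<dots> = (\<Sum>b<k. \<Sum>S\<in>F. \<Sum>T\<in>F. ?t b S T)"
    by (simp add: sum_distrib_left mult_ac del: pair_kernel.simps)
  also have "\<dots> = (\<Sum>S\<in>F. \<Sum>b<k. \<Sum>T\<in>F. ?t b S T)"
    by (rule sum.swap)
  also have "\<dots> = (\<Sum>S\<in>F. \<Sum>T\<in>F. \<Sum>b<k. ?t b S T)"
    by (intro sum.cong refl, rule sum.swap)
  also have "\<dots> = (\<Sum>S\<in>F. \<Sum>T\<in>F. x S * x T * (Q S T * P S T))"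
    unfolding Q_def sum_distrib_right sum_distrib_left by (rule refl)
  also have "\<dots> = (\<Sum>S\<in>F. \<Sum>T\<in>F. (if S = T then (x S)\<^sup>2 * (real (n choose k) * \<tau>) else 0) - x S * x T * P S T)"
    by (intro sum.cong refl) (simp add: Q right_diff_distrib power2_eq_square)
  also have "\<dots> = real (n choose k) * \<tau> * X - (\<Sum>S\<in>F. \<Sum>T\<in>F. x S * x T * P S T)"
    using finF by (simp add: sum_subtractf X_def sum_distrib_left mult_ac)
  finally have le: "(\<Sum>S\<in>F. \<Sum>T\<in>F. x S * x T * P S T) \<le> real (n choose k) * \<tau> * X" by simp
  have "X\<^sup>2 \<le> \<tau> * (real (n choose k) * \<tau> * X)"
    unfolding X_def by (rule order_trans[OF cs mult_left_mono[OF le[unfolded X_def] \<tau>]])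
  then have *: "X * X \<le> (real (n choose k) * \<tau>\<^sup>2) * X"
    by (simp add: power2_eq_square mult_ac)
  have "X \<ge> 0" unfolding X_def by (intro sum_nonneg) simp
  have "X \<le> real (n choose k) * \<tau>\<^sup>2"
  proof (cases "X = 0")
    case True
    then show ?thesis using \<tau> by simp
  next
    case False
    with \<open>X \<ge> 0\<close> have "X > 0" by simp
    with * show ?thesis by (rule mult_right_le_imp_le)
  qed
  then show ?thesis by (simp only: X_def)
qed

section \<open>The Majorana algebra\<close>

definition dag :: "complex mat \<Rightarrow> complex mat" where
  "dag A = mat (dim_col A) (dim_row A) (\<lambda>(i, j). cnj (A $$ (j, i)))"

definition tr :: "complex mat \<Rightarrow> complex" where
  "tr A = (\<Sum>i<dim_row A. A $$ (i, i))"

lemma dag_carrier [simp]: "A \<in> carrier_mat m k \<Longrightarrow> dag A \<in> carrier_mat k m"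
  by (auto simp: dag_def)

lemma mult_entry:
  assumes "A \<in> carrier_mat m k" "B \<in> carrier_mat k l" "i < m" "j < l"
  shows "(A * B) $$ (i, j) = (\<Sum>r<k. A $$ (i, r) * B $$ (r, j))"
  using assms by (auto simp: scalar_prod_def atLeast0LessThan intro!: sum.cong)

lemma dag_entry: "A \<in> carrier_mat m k \<Longrightarrow> i < k \<Longrightarrow> j < m \<Longrightarrow> dag A $$ (i, j) = cnj (A $$ (j, i))"
  by (auto simp: dag_def)

lemma dag_mult:
  assumes "A \<in> carrier_mat d d" "B \<in> carrier_mat d d"
  shows "dag (A * B) = dag B * dag A"
proof (rule eq_matI)
  fix i j assume "i < dim_row (dag B * dag A)" "j < dim_col (dag B * dag A)"
  then have ij: "i < d" "j < d" using assms by (auto simp: dag_def)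
  then show "dag (A * B) $$ (i, j) = (dag B * dag A) $$ (i, j)"
    using assms by (simp add: dag_entry[OF mult_carrier_mat[OF assms]] mult_entry[OF assms]
        mult_entry[OF dag_carrier[OF assms(2)] dag_carrier[OF assms(1)]] dag_entry[OF assms(1)] dag_entry[OF assms(2)] mult.commute
        del: index_mult_mat)
qed (use assms in \<open>auto simp: dag_def\<close>)

lemma dag_smult: "A \<in> carrier_mat d d \<Longrightarrow> dag (c \<cdot>\<^sub>m A) = cnj c \<cdot>\<^sub>m dag A"
  by (rule eq_matI) (auto simp: dag_def)

lemma dag_one [simp]: "dag (1\<^sub>m d) = 1\<^sub>m d"
  by (rule eq_matI) (auto simp: dag_def)

lemma dag_dag: "A \<in> carrier_mat d d \<Longrightarrow> dag (dag A) = A"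
  by (rule eq_matI) (auto simp: dag_def)

lemma tr_mult:
  assumes "A \<in> carrier_mat d d" "B \<in> carrier_mat d d"
  shows "tr (A * B) = (\<Sum>a<d. \<Sum>b<d. A $$ (a, b) * B $$ (b, a))"
  using assms by (auto simp: tr_def mult_entry[OF assms] simp del: index_mult_mat(1))

lemma tr_commute:
  assumes "A \<in> carrier_mat d d" "B \<in> carrier_mat d d"
  shows "tr (A * B) = tr (B * A)"
  unfolding tr_mult[OF assms] tr_mult[OF assms(2,1)] by (subst sum.swap) (simp add: mult.commute)

lemma tr_smult: "A \<in> carrier_mat d d \<Longrightarrow> tr (c \<cdot>\<^sub>m A) = c * tr A"
  by (auto simp: tr_def sum_distrib_left)

lemma tr_add: "A \<in> carrier_mat d d \<Longrightarrow> B \<in> carrier_mat d d \<Longrightarrow> tr (A + B) = tr A + tr B"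
  by (auto simp: tr_def sum.distrib)

lemma tr_one [simp]: "tr (1\<^sub>m d) = of_nat d"
  by (simp add: tr_def)

lemma smult_one_mat [simp]: "(1 :: complex) \<cdot>\<^sub>m A = A"
  by (rule eq_matI) auto

lemma smult_smult_mat: "(a :: complex) \<cdot>\<^sub>m (b \<cdot>\<^sub>m A) = (a * b) \<cdot>\<^sub>m A"
  by (rule eq_matI) (auto simp: mult.assoc)

lemma choose_two_rec: "(0::nat) choose 2 = 0" "1 choose 2 = 0" "Suc m choose 2 = m + (m choose 2)"
  by (simp_all add: numeral_2_eq_2)

locale majorana_system =
  fixes n :: nat and \<gamma> :: "nat \<Rightarrow> complex mat"
  assumes majorana: "majorana n \<gamma>"
begin

abbreviation d :: nat where "d \<equiv> 2 ^ n"
abbreviation C :: "complex mat set" where "C \<equiv> carrier_mat d d"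

lemma assoc: "A \<in> C \<Longrightarrow> B \<in> C \<Longrightarrow> D \<in> C \<Longrightarrow> A * B * D = A * (B * D)"
  by (rule assoc_mult_mat)

lemma smult_left: "A \<in> C \<Longrightarrow> B \<in> C \<Longrightarrow> (c \<cdot>\<^sub>m A) * B = c \<cdot>\<^sub>m (A * B)"
  by (rule mult_smult_assoc_mat)

lemma smult_right: "A \<in> C \<Longrightarrow> B \<in> C \<Longrightarrow> A * (c \<cdot>\<^sub>m B) = c \<cdot>\<^sub>m (A * B)"
  by (rule mult_smult_distrib)

lemma one_left: "A \<in> C \<Longrightarrow> 1\<^sub>m d * A = A"
  by (rule left_mult_one_mat)

lemma one_right: "A \<in> C \<Longrightarrow> A * 1\<^sub>m d = A"
  by (rule right_mult_one_mat)

lemma mult_C [simp]: "A \<in> C \<Longrightarrow> B \<in> C \<Longrightarrow> A * B \<in> C"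
  by simp

lemmas mat_simps = assoc smult_left smult_right one_left one_right

lemma gen_C [simp]: "j < 2 * n \<Longrightarrow> \<gamma> j \<in> C"
  using majorana unfolding majorana_def is_herm_def by blast

lemma gen_dag: assumes j: "j < 2 * n" shows "dag (\<gamma> j) = \<gamma> j"
proof -
  have "cnj (\<gamma> j $$ (b, a)) = \<gamma> j $$ (a, b)" if "a < d" "b < d" for a b
    using majorana j that unfolding majorana_def is_herm_def by metis
  with gen_C[OF j] show ?thesis by (intro eq_matI) (auto simp: dag_def)
qed

lemma gen_acomm: "j < 2 * n \<Longrightarrow> k < 2 * n \<Longrightarrow>
    \<gamma> j * \<gamma> k + \<gamma> k * \<gamma> j = (if j = k then 2 else 0) \<cdot>\<^sub>m 1\<^sub>m d"
  using majorana unfolding majorana_def by blast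

lemma gen_sq: assumes j: "j < 2 * n" shows "\<gamma> j * \<gamma> j = 1\<^sub>m d"
proof (rule eq_matI)
  fix a b assume ab: "a < dim_row (1\<^sub>m d :: complex mat)" "b < dim_col (1\<^sub>m d :: complex mat)"
  have "(\<gamma> j * \<gamma> j + \<gamma> j * \<gamma> j) $$ (a, b) = (2 \<cdot>\<^sub>m 1\<^sub>m d) $$ (a, b)"
    by (subst gen_acomm[OF j j]) simp
  then show "(\<gamma> j * \<gamma> j) $$ (a, b) = 1\<^sub>m d $$ (a, b)"
    using ab gen_C[OF j] by (simp split: if_splits)
qed (use gen_C[OF j] in auto)

lemma gen_anti: assumes jk: "j < 2 * n" "k < 2 * n" "j \<noteq> k" shows "\<gamma> j * \<gamma> k = (-1) \<cdot>\<^sub>m (\<gamma> k * \<gamma> j)"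
proof (rule eq_matI)
  fix a b assume ab: "a < dim_row ((-1) \<cdot>\<^sub>m (\<gamma> k * \<gamma> j))" "b < dim_col ((-1) \<cdot>\<^sub>m (\<gamma> k * \<gamma> j))"
  then have ab': "a < d" "b < d" using gen_C[OF jk(1)] gen_C[OF jk(2)] by auto
  have "(\<gamma> j * \<gamma> k + \<gamma> k * \<gamma> j) $$ (a, b) = (0 \<cdot>\<^sub>m 1\<^sub>m d) $$ (a, b)"
    using gen_acomm[OF jk(1,2)] jk(3) by simp
  moreover have "\<gamma> j * \<gamma> k \<in> C" "\<gamma> k * \<gamma> j \<in> C" using jk by auto
  ultimately have "(\<gamma> j * \<gamma> k) $$ (a, b) + (\<gamma> k * \<gamma> j) $$ (a, b) = 0"
    using ab' by (simp del: index_mult_mat)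
  then show "(\<gamma> j * \<gamma> k) $$ (a, b) = ((-1) \<cdot>\<^sub>m (\<gamma> k * \<gamma> j)) $$ (a, b)"
    using ab' \<open>\<gamma> k * \<gamma> j \<in> C\<close> by (simp add: add_eq_0_iff del: index_mult_mat)
qed (use gen_C[OF jk(1)] gen_C[OF jk(2)] in auto)

definition word :: "nat list \<Rightarrow> complex mat" where
  "word xs = foldr (\<lambda>j M. \<gamma> j * M) xs (1\<^sub>m d)"

lemma word_Nil [simp]: "word [] = 1\<^sub>m d"
  by (simp add: word_def)

lemma word_Cons [simp]: "word (x # xs) = \<gamma> x * word xs"
  by (simp add: word_def)

lemma word_C [simp]: "set xs \<subseteq> {0..<2*n} \<Longrightarrow> word xs \<in> C"
  by (induction xs) auto

lemma word_append:
  "set xs \<subseteq> {0..<2*n} \<Longrightarrow> set ys \<subseteq> {0..<2*n} \<Longrightarrow> word (xs @ ys) = word xs * word ys"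
  by (induction xs) (auto simp: mat_simps)

lemma gen_word_swap:
  assumes "j < 2 * n" "set xs \<subseteq> {0..<2*n}" "j \<notin> set xs"
  shows "\<gamma> j * word xs = (-1) ^ length xs \<cdot>\<^sub>m (word xs * \<gamma> j)"
  using assms(2,3)
proof (induction xs)
  case Nil
  then show ?case using assms(1) by (simp add: mat_simps)
next
  case (Cons x xs)
  then have x: "x < 2 * n" "x \<noteq> j" and xs: "set xs \<subseteq> {0..<2*n}" "j \<notin> set xs" by auto
  have C: "\<gamma> x \<in> C" "\<gamma> j \<in> C" "word xs \<in> C" using x xs assms(1) by auto
  have "\<gamma> j * word (x # xs) = (\<gamma> j * \<gamma> x) * word xs" using C by (simp add: mat_simps)
  also have "\<dots> = (-1) \<cdot>\<^sub>m (\<gamma> x * (\<gamma> j * word xs))"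
    using C gen_anti[OF assms(1) x(1)] x(2) by (simp add: mat_simps)
  also have "\<dots> = (-1) ^ length (x # xs) \<cdot>\<^sub>m (word (x # xs) * \<gamma> j)"
    unfolding Cons.IH[OF xs] using C by (simp add: mat_simps smult_smult_mat)
  finally show ?case .
qed

lemma gen_cancel_left:
  assumes "j < 2 * n" "set (us @ vs) \<subseteq> {0..<2*n}" "j \<notin> set us"
  shows "\<gamma> j * word (us @ j # vs) = (-1) ^ length us \<cdot>\<^sub>m word (us @ vs)"
proof -
  have C: "\<gamma> j \<in> C" "word us \<in> C" "word vs \<in> C" using assms by auto
  have "\<gamma> j * word (us @ j # vs) = (\<gamma> j * word us) * (\<gamma> j * word vs)"
    using assms C by (simp add: word_append mat_simps)
  also have "\<dots> = (-1) ^ length us \<cdot>\<^sub>m (word us * ((\<gamma> j * \<gamma> j) * word vs))"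
    using C assms by (subst gen_word_swap) (auto simp: mat_simps)
  also have "\<dots> = (-1) ^ length us \<cdot>\<^sub>m word (us @ vs)"
    using C assms by (simp add: gen_sq word_append mat_simps)
  finally show ?thesis .
qed

lemma gen_cancel_right:
  assumes "j < 2 * n" "set (us @ vs) \<subseteq> {0..<2*n}" "j \<notin> set vs"
  shows "word (us @ j # vs) * \<gamma> j = (-1) ^ length vs \<cdot>\<^sub>m word (us @ vs)"
proof -
  have C: "\<gamma> j \<in> C" "word us \<in> C" "word vs \<in> C" using assms by auto
  have sw: "word vs * \<gamma> j = (-1) ^ length vs \<cdot>\<^sub>m (\<gamma> j * word vs)"
    using gen_word_swap[of j vs] assms C by (simp add: smult_smult_mat flip: power_mult_distrib)
  have "word (us @ j # vs) * \<gamma> j = word us * (\<gamma> j * (word vs * \<gamma> j))"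
    using assms C by (simp add: word_append mat_simps)
  also have "\<dots> = (-1) ^ length vs \<cdot>\<^sub>m (word us * ((\<gamma> j * \<gamma> j) * word vs))"
    unfolding sw using C by (simp add: mat_simps)
  also have "\<dots> = (-1) ^ length vs \<cdot>\<^sub>m word (us @ vs)"
    using C assms by (simp add: gen_sq word_append mat_simps)
  finally show ?thesis .
qed

text \<open>A generator commutes with its own copy inside the word, which saves one of the
  \<open>length xs\<close> signs.\<close>

lemma gen_word_commute:
  assumes "j < 2 * n" "set xs \<subseteq> {0..<2*n}" "distinct xs"
  shows "\<gamma> j * word xs = (-1) ^ (length xs + (if j \<in> set xs then 1 else 0)) \<cdot>\<^sub>m (word xs * \<gamma> j)"
proof (cases "j \<in> set xs")
  case False
  then show ?thesis using gen_word_swap[OF assms(1,2)] by simp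
next
  case True
  then obtain us vs where xs: "xs = us @ j # vs" by (meson split_list)
  have "\<gamma> j * word xs = (-1) ^ length us \<cdot>\<^sub>m word (us @ vs)"
    unfolding xs using assms xs by (intro gen_cancel_left) auto
  moreover have "word xs * \<gamma> j = (-1) ^ length vs \<cdot>\<^sub>m word (us @ vs)"
    unfolding xs using assms xs by (intro gen_cancel_right) auto
  moreover have "(-1 :: complex) ^ length us = (-1) ^ (length xs + 1) * (-1) ^ length vs"
    unfolding xs by (simp add: power_add mult_ac flip: power_mult_distrib)
  ultimately show ?thesis using True by (simp add: smult_smult_mat)
qed

lemma word_commute:
  assumes "set ys \<subseteq> {0..<2*n}" "set xs \<subseteq> {0..<2*n}" "distinct xs"
  shows "word ys * word xs =
    (-1) ^ (length ys * length xs + length (filter (\<lambda>y. y \<in> set xs) ys)) \<cdot>\<^sub>m (word xs * word ys)"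
  using assms(1)
proof (induction ys)
  case Nil
  then show ?case using assms by (simp add: mat_simps)
next
  case (Cons y ys)
  then have y: "y < 2 * n" and ys: "set ys \<subseteq> {0..<2*n}" by auto
  have C: "\<gamma> y \<in> C" "word ys \<in> C" "word xs \<in> C" using y ys assms by auto
  have "word (y # ys) * word xs = \<gamma> y * (word ys * word xs)" using C by (simp add: mat_simps)
  also have "\<dots> = (-1) ^ (length ys * length xs + length (filter (\<lambda>y. y \<in> set xs) ys)) \<cdot>\<^sub>m
      ((\<gamma> y * word xs) * word ys)"
    unfolding Cons.IH[OF ys] using C by (simp add: mat_simps)
  also have "\<gamma> y * word xs = (-1) ^ (length xs + (if y \<in> set xs then 1 else 0)) \<cdot>\<^sub>m (word xs * \<gamma> y)"
    by (rule gen_word_commute[OF y assms(2,3)])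
  finally show ?case
    using C by (simp add: mat_simps smult_smult_mat power_add mult_ac)
qed

lemma dag_word: "set xs \<subseteq> {0..<2*n} \<Longrightarrow> dag (word xs) = word (rev xs)"
proof (induction xs)
  case (Cons x xs)
  have C: "\<gamma> x \<in> C" "word xs \<in> C" using Cons.prems by auto
  have "dag (word (x # xs)) = word (rev xs) * \<gamma> x"
    using Cons C by (simp add: dag_mult[OF C] gen_dag)
  also have "\<dots> = word (rev (x # xs))"
    using Cons.prems by (simp add: word_append mat_simps)
  finally show ?case .
qed simp

lemma word_rev_mult: "set xs \<subseteq> {0..<2*n} \<Longrightarrow> word (rev xs) * word xs = 1\<^sub>m d"
proof (induction xs)
  case (Cons x xs)
  have C: "\<gamma> x \<in> C" "word xs \<in> C" "word (rev xs) \<in> C" using Cons.prems by auto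
  have "word (rev (x # xs)) * word (x # xs) = word (rev xs) * ((\<gamma> x * \<gamma> x) * word xs)"
    using Cons.prems C by (simp add: word_append mat_simps)
  also have "\<dots> = 1\<^sub>m d"
    using Cons C by (simp add: gen_sq mat_simps)
  finally show ?case .
qed (simp add: mat_simps)

lemma word_rev:
  "set xs \<subseteq> {0..<2*n} \<Longrightarrow> distinct xs \<Longrightarrow> word (rev xs) = (-1) ^ (length xs choose 2) \<cdot>\<^sub>m word xs"
proof (induction xs)
  case (Cons x xs)
  have C: "\<gamma> x \<in> C" "word xs \<in> C" using Cons.prems by auto
  have "word (rev (x # xs)) = word (rev xs) * \<gamma> x"
    using Cons.prems C by (simp add: word_append mat_simps)
  also have "\<dots> = (-1) ^ (length xs choose 2) \<cdot>\<^sub>m (word xs * \<gamma> x)"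
    using Cons C by (simp add: mat_simps)
  also have "word xs * \<gamma> x = (-1) ^ length xs \<cdot>\<^sub>m (\<gamma> x * word xs)"
    using Cons.prems C gen_word_swap[of x xs] by (simp add: smult_smult_mat flip: power_mult_distrib)
  finally show ?case
    using C by (simp add: smult_smult_mat choose_two_rec power_add mult_ac)
qed (simp add: choose_two_rec)

abbreviation g :: "nat set \<Rightarrow> complex mat" where "g \<equiv> gamma_S n \<gamma>"
abbreviation modes :: "nat set" where "modes \<equiv> {0..<2*n}"

lemma g_word: "g S = \<i> ^ (card S choose 2) \<cdot>\<^sub>m word (sorted_list_of_set S)"
  by (simp add: gamma_S_def word_def)

lemma fin_modes: "S \<subseteq> modes \<Longrightarrow> finite S"
  using finite_subset by blast

lemma g_C [simp]: "S \<subseteq> modes \<Longrightarrow> g S \<in> C"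
  using fin_modes[of S] by (simp add: g_word)

lemma g_empty: "g {} = 1\<^sub>m d"
  by (simp add: g_word choose_two_rec)

lemma g_single: "j < 2 * n \<Longrightarrow> g {j} = \<gamma> j"
  by (simp add: g_word mat_simps choose_two_rec del: One_nat_def)

text \<open>The adjoint reverses the word at the cost of (-1) to the power
  \<open>card S choose 2\<close>; the phase in the definition is the one whose conjugation pays for
  exactly this sign.\<close>

lemma g_dag: assumes S: "S \<subseteq> modes" shows "dag (g S) = g S"
proof -
  have s: "set (sorted_list_of_set S) \<subseteq> modes" using S fin_modes[OF S] by simp
  have "cnj \<i> ^ m * (-1) ^ m = \<i> ^ m" for m :: nat
    by (simp flip: power_mult_distrib)
  then show ?thesis
    using s fin_modes[OF S]
    by (simp add: g_word dag_smult[OF word_C[OF s]] dag_word[OF s] word_rev[OF s] smult_smult_mat)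
qed

lemma g_sq: assumes S: "S \<subseteq> modes" shows "g S * g S = 1\<^sub>m d"
proof -
  have s: "set (sorted_list_of_set S) \<subseteq> modes" using S fin_modes[OF S] by simp
  have "g S * g S = dag (g S) * g S" by (simp add: g_dag[OF S])
  also have "\<dots> = cnj (\<i> ^ (card S choose 2)) * \<i> ^ (card S choose 2) \<cdot>\<^sub>m 1\<^sub>m d"
    using s by (simp add: g_word dag_smult[OF word_C[OF s]] dag_word[OF s] mat_simps
        word_rev_mult[OF s] smult_smult_mat mult.commute)
  also have "cnj (\<i> ^ m) * \<i> ^ m = 1" for m :: nat
    by (simp flip: power_mult_distrib)
  finally show ?thesis by simp
qed

lemma g_commute: assumes R: "R \<subseteq> modes" and S: "S \<subseteq> modes"
  shows "g R * g S = (-1) ^ (card R * card S + card (R \<inter> S)) \<cdot>\<^sub>m (g S * g R)"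
proof -
  have r: "set (sorted_list_of_set R) \<subseteq> modes" using R fin_modes[OF R] by simp
  have s: "set (sorted_list_of_set S) \<subseteq> modes" using S fin_modes[OF S] by simp
  have "length (filter (\<lambda>y. y \<in> S) (sorted_list_of_set R)) = card (R \<inter> S)"
    using fin_modes[OF R]
    by (subst distinct_card[symmetric]) (auto intro: arg_cong[where f = card])
  then show ?thesis
    using word_commute[OF r s] fin_modes[OF R] fin_modes[OF S] r s
    by (simp add: g_word mat_simps smult_smult_mat mult_ac)
qed

text \<open>Some generator anticommutes with the product; conjugation by it preserves the trace and
  also negates it.\<close>

lemma g_trace: assumes R: "R \<subseteq> modes" and S: "S \<subseteq> modes" and "R \<noteq> S"
  shows "tr (g R * g S) = 0"
proof -
  define D where "D = (R - S) \<union> (S - R)"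
  have fin: "finite R" "finite S" using R S fin_modes by auto
  have Dcard: "card D + 2 * card (R \<inter> S) = card R + card S"
  proof -
    have "card D = card (R - S) + card (S - R)"
      unfolding D_def using fin by (intro card_Un_disjoint) auto
    moreover have "card R = card (R - S) + card (R \<inter> S)" "card S = card (S - R) + card (R \<inter> S)"
      using fin by (subst card_Un_disjoint[symmetric]; auto intro!: arg_cong[where f = card])+
    ultimately show ?thesis by simp
  qed
  \<comment> \<open>If the two sizes have equal parity, any j in the symmetric difference D works.
    Otherwise D has odd size, so it cannot exhaust the 2n modes, and any j outside D works.\<close>
  obtain j where j: "j < 2 * n" and odd: "odd (card R + card S + of_bool (j \<in> R) + of_bool (j \<in> S))"
  proof (cases "even (card R + card S)")
    case True
    obtain j where "j \<in> D" using assms(3) unfolding D_def by auto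
    with True R S show ?thesis by (intro that[of j]) (auto simp: D_def)
  next
    case False
    then have "odd (card D)" using Dcard by presburger
    then have "D \<noteq> modes" by auto
    moreover have "D \<subseteq> modes" using R S unfolding D_def by auto
    ultimately obtain j where "j \<in> modes" "j \<notin> D" by blast
    then have "j < 2 * n" by simp
    with False \<open>j \<notin> D\<close> show ?thesis by (intro that[of j]) (auto simp: D_def)
  qed
  have C: "\<gamma> j \<in> C" "g R \<in> C" "g S \<in> C" using j R S by auto
  have sub: "{j} \<subseteq> modes" using j by simp
  have comm: "\<gamma> j * g T = (-1) ^ (card T + of_bool (j \<in> T)) \<cdot>\<^sub>m (g T * \<gamma> j)" if "T \<subseteq> modes" for T
    using g_commute[OF sub that] by (auto simp: g_single[OF j] Int_insert_left split: if_splits)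
  have "\<gamma> j * (g R * g S) = (\<gamma> j * g R) * g S" using C by (simp add: mat_simps)
  also have "\<dots> = (-1) ^ (card R + of_bool (j \<in> R)) \<cdot>\<^sub>m (g R * (\<gamma> j * g S))"
    unfolding comm[OF R] using C by (simp add: mat_simps)
  also have "\<dots> = ((-1) ^ (card R + of_bool (j \<in> R)) * (-1) ^ (card S + of_bool (j \<in> S))) \<cdot>\<^sub>m ((g R * g S) * \<gamma> j)"
    unfolding comm[OF S] using C by (simp add: mat_simps smult_smult_mat)
  also have "(-1) ^ (card R + of_bool (j \<in> R)) * (-1) ^ (card S + of_bool (j \<in> S)) = (-1 :: complex)"
    using odd by (simp flip: power_add add: add_ac)
  finally have anti: "\<gamma> j * (g R * g S) = (-1) \<cdot>\<^sub>m ((g R * g S) * \<gamma> j)" .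
  have "g R * g S = \<gamma> j * (\<gamma> j * (g R * g S))"
    using C by (simp add: assoc[symmetric] gen_sq[OF j] one_left del: assoc_mult_mat)
  then have "tr (g R * g S) = tr (\<gamma> j * (\<gamma> j * (g R * g S)))" by simp
  also have "\<dots> = - tr (\<gamma> j * ((g R * g S) * \<gamma> j))"
    unfolding anti using C by (simp add: smult_right tr_smult[of _ d] del: assoc_mult_mat)
  also have "tr (\<gamma> j * ((g R * g S) * \<gamma> j)) = tr (((g R * g S) * \<gamma> j) * \<gamma> j)"
    using C by (intro tr_commute[of _ d]) auto
  also have "((g R * g S) * \<gamma> j) * \<gamma> j = g R * g S"
    using C by (simp add: assoc gen_sq[OF j] one_right)
  finally show ?thesis by simp
qed

end

section \<open>Twirling and moment matrices\<close>

lemma sum_div_mod: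
  fixes f :: "nat \<Rightarrow> nat \<Rightarrow> 'a :: comm_monoid_add"
  shows "(\<Sum>c<d * d. f (c div d) (c mod d)) = (\<Sum>a<d. \<Sum>b<d. f a b)"
proof -
  have "(\<Sum>c<d * d. f (c div d) (c mod d)) = (\<Sum>(a, b)\<in>{..<d} \<times> {..<d}. f a b)"
  proof (rule sum.reindex_bij_witness[of _ "\<lambda>(a, b). a * d + b" "\<lambda>c. (c div d, c mod d)"])
    fix c assume c: "c \<in> {..<d * d}"
    then have "d > 0" by (cases d) auto
    with c show "(c div d, c mod d) \<in> {..<d} \<times> {..<d}"
      by (simp add: less_mult_imp_div_less)
    show "(case (c div d, c mod d) of (a, b) \<Rightarrow> a * d + b) = c" by simp
    show "(case (c div d, c mod d) of (a, b) \<Rightarrow> f a b) = f (c div d) (c mod d)" by simp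
  next
    fix p assume "p \<in> {..<d} \<times> {..<d}"
    then obtain a b where p: "p = (a, b)" "a < d" "b < d" by auto
    have "a * d + b < (a + 1) * d" using p by simp
    also have "\<dots> \<le> d * d" using p by (intro mult_right_mono) auto
    finally show "(case p of (a, b) \<Rightarrow> a * d + b) \<in> {..<d * d}" using p by simp
    show "((case p of (a, b) \<Rightarrow> a * d + b) div d, (case p of (a, b) \<Rightarrow> a * d + b) mod d) = p"
      using p by simp
  qed
  then show ?thesis by (simp add: sum.cartesian_product)
qed

lemma tr_dag: "A \<in> carrier_mat d d \<Longrightarrow> tr (dag A) = cnj (tr A)"
  by (auto simp: tr_def dag_def)

lemma triple_mult_entry:
  fixes A X B :: "complex mat"
  assumes "A \<in> carrier_mat d d" "X \<in> carrier_mat d d" "B \<in> carrier_mat d d" "a < d" "e < d"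
  shows "(A * X * B) $$ (a, e) = (\<Sum>b<d. \<Sum>c<d. X $$ (b, c) * (A $$ (a, b) * B $$ (c, e)))"
proof -
  have "(A * X * B) $$ (a, e) = (\<Sum>c<d. (\<Sum>b<d. A $$ (a, b) * X $$ (b, c)) * B $$ (c, e))"
    using assms by (simp add: mult_entry[OF mult_carrier_mat[OF assms(1,2)] assms(3)] mult_entry[OF assms(1,2)]
        del: index_mult_mat assoc_mult_mat)
  also have "\<dots> = (\<Sum>b<d. \<Sum>c<d. A $$ (a, b) * X $$ (b, c) * B $$ (c, e))"
    unfolding sum_distrib_right by (rule sum.swap)
  also have "\<dots> = (\<Sum>b<d. \<Sum>c<d. X $$ (b, c) * (A $$ (a, b) * B $$ (c, e)))"
    by (intro sum.cong refl) (simp only: mult_ac)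
  finally show ?thesis .
qed

lemma psd_mult_dag:
  assumes A: "A \<in> carrier_mat d d" and "r \<ge> 0"
  shows "is_psd d (complex_of_real r \<cdot>\<^sub>m (A * dag A))"
proof -
  have "(\<Sum>a<d. \<Sum>b<d. cnj (v a) * (complex_of_real r \<cdot>\<^sub>m (A * dag A)) $$ (a, b) * v b)
      = complex_of_real (r * (\<Sum>k<d. (cmod (\<Sum>b<d. cnj (A $$ (b, k)) * v b))\<^sup>2))" for v :: "nat \<Rightarrow> complex"
  proof -
    have e: "(complex_of_real r \<cdot>\<^sub>m (A * dag A)) $$ (a, b) = r * (\<Sum>k<d. A $$ (a, k) * cnj (A $$ (b, k)))"
      if "a < d" "b < d" for a b
      using that A mult_entry[OF A dag_carrier[OF A], of a b] dag_entry[OF A]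
        carrier_matD[OF mult_carrier_mat[OF A dag_carrier[OF A]]]
      by (simp del: index_mult_mat)
    have "(\<Sum>a<d. \<Sum>b<d. cnj (v a) * (complex_of_real r \<cdot>\<^sub>m (A * dag A)) $$ (a, b) * v b)
        = (\<Sum>a<d. \<Sum>b<d. \<Sum>k<d. r * ((A $$ (a, k) * cnj (v a)) * (cnj (A $$ (b, k)) * v b)))"
      by (intro sum.cong refl) (simp add: e sum_distrib_left sum_distrib_right mult_ac)
    also have "\<dots> = (\<Sum>a<d. \<Sum>k<d. \<Sum>b<d. r * ((A $$ (a, k) * cnj (v a)) * (cnj (A $$ (b, k)) * v b)))"
      by (rule sum.cong[OF refl], rule sum.swap)
    also have "\<dots> = (\<Sum>k<d. \<Sum>a<d. \<Sum>b<d. r * ((A $$ (a, k) * cnj (v a)) * (cnj (A $$ (b, k)) * v b)))"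
      by (rule sum.swap)
    also have "\<dots> = (\<Sum>k<d. r * ((\<Sum>a<d. A $$ (a, k) * cnj (v a)) * (\<Sum>b<d. cnj (A $$ (b, k)) * v b)))"
      by (simp only: sum_distrib_left[symmetric] sum_distrib_right[symmetric])
    also have "\<dots> = (\<Sum>k<d. r * (cnj (\<Sum>b<d. cnj (A $$ (b, k)) * v b) * (\<Sum>b<d. cnj (A $$ (b, k)) * v b)))"
      by simp
    also have "\<dots> = (\<Sum>k<d. complex_of_real (r * (cmod (\<Sum>b<d. cnj (A $$ (b, k)) * v b))\<^sup>2))"
      by (simp only: of_real_mult complex_norm_square mult.commute)
    finally show ?thesis by (simp add: sum_distrib_left)
  qed
  moreover have "r * (\<Sum>k<d. (cmod (\<Sum>b<d. cnj (A $$ (b, k)) * v b))\<^sup>2) \<ge> 0" for v :: "nat \<Rightarrow> complex"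
    using assms(2) by (intro mult_nonneg_nonneg sum_nonneg) auto
  ultimately show ?thesis
    using A unfolding is_psd_def Let_def by auto
qed

text \<open>With the real part, the moments of \<open>dag (X i) * X j\<close> in a positive G form a
  real symmetric matrix, so real coefficient vectors suffice even for non-Hermitian
  products.\<close>

definition expval :: "complex mat \<Rightarrow> complex mat \<Rightarrow> real" where
  "expval G X = Re (tr (G * X))"

lemma expval_add:
  "G \<in> carrier_mat d d \<Longrightarrow> A \<in> carrier_mat d d \<Longrightarrow> B \<in> carrier_mat d d \<Longrightarrow>
    expval G (A + B) = expval G A + expval G B"
  by (simp add: expval_def mult_add_distrib_mat[of G d d] tr_add[of _ d])

lemma expval_smult:
  "G \<in> carrier_mat d d \<Longrightarrow> A \<in> carrier_mat d d \<Longrightarrow>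
    expval G (complex_of_real c \<cdot>\<^sub>m A) = c * expval G A"
  by (simp add: expval_def mult_smult_distrib[of G d d] tr_smult[of _ d])

text \<open>This is the trace of G against the square \<open>dag Y * Y\<close> of the real
  combination Y of the X i. It splits into values of the form of G at the conjugated rows of Y,
  which are the vectors \<open>Z r\<close> of the proof.\<close>

lemma psd_gram:
  fixes c :: "'i \<Rightarrow> real"
  assumes G: "is_psd d G" and X: "\<And>i. i \<in> I \<Longrightarrow> X i \<in> carrier_mat d d"
  shows "(\<Sum>i\<in>I. \<Sum>j\<in>I. c i * c j * expval G (dag (X i) * X j)) \<ge> 0"
proof -
  have GC: "G \<in> carrier_mat d d" using G by (simp add: is_psd_def)
  have e: "tr (G * (dag (X i) * X j)) = (\<Sum>r<d. \<Sum>a<d. \<Sum>b<d. X j $$ (r, a) * G $$ (a, b) * cnj (X i $$ (r, b)))"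
    if ij: "i \<in> I" "j \<in> I" for i j
  proof -
    note XC = X[OF ij(1)] X[OF ij(2)]
    have "tr (G * (dag (X i) * X j)) = (\<Sum>a<d. \<Sum>b<d. \<Sum>r<d. X j $$ (r, a) * G $$ (a, b) * cnj (X i $$ (r, b)))"
      using XC by (simp add: tr_mult[OF GC mult_carrier_mat[OF dag_carrier[OF XC(1)] XC(2)]]
          mult_entry[OF dag_carrier[OF XC(1)] XC(2)] dag_entry[OF XC(1)] sum_distrib_left mult_ac
          del: index_mult_mat)
    also have "\<dots> = (\<Sum>a<d. \<Sum>r<d. \<Sum>b<d. X j $$ (r, a) * G $$ (a, b) * cnj (X i $$ (r, b)))"
      by (rule sum.cong[OF refl], rule sum.swap)
    also have "\<dots> = (\<Sum>r<d. \<Sum>a<d. \<Sum>b<d. X j $$ (r, a) * G $$ (a, b) * cnj (X i $$ (r, b)))"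
      by (rule sum.swap)
    finally show ?thesis .
  qed
  define Z where "Z r a = (\<Sum>i\<in>I. complex_of_real (c i) * cnj (X i $$ (r, a)))" for r a
  have cZ: "cnj (Z r a) = (\<Sum>i\<in>I. complex_of_real (c i) * X i $$ (r, a))" for r a
    by (simp add: Z_def)
  let ?t = "\<lambda>i j r a b. (c j * X j $$ (r, a)) * G $$ (a, b) * (c i * cnj (X i $$ (r, b)))"
  have "(\<Sum>i\<in>I. \<Sum>j\<in>I. complex_of_real (c i * c j) * tr (G * (dag (X i) * X j)))
     = (\<Sum>i\<in>I. \<Sum>j\<in>I. \<Sum>r<d. \<Sum>a<d. \<Sum>b<d. ?t i j r a b)"
    by (intro sum.cong refl) (simp add: e sum_distrib_left mult_ac)
  also have "\<dots> = (\<Sum>i\<in>I. \<Sum>r<d. \<Sum>j\<in>I. \<Sum>a<d. \<Sum>b<d. ?t i j r a b)"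
    by (intro sum.cong refl, rule sum.swap)
  also have "\<dots> = (\<Sum>r<d. \<Sum>i\<in>I. \<Sum>j\<in>I. \<Sum>a<d. \<Sum>b<d. ?t i j r a b)"
    by (rule sum.swap)
  also have "\<dots> = (\<Sum>r<d. \<Sum>i\<in>I. \<Sum>a<d. \<Sum>j\<in>I. \<Sum>b<d. ?t i j r a b)"
    by (intro sum.cong refl, rule sum.swap)
  also have "\<dots> = (\<Sum>r<d. \<Sum>a<d. \<Sum>i\<in>I. \<Sum>j\<in>I. \<Sum>b<d. ?t i j r a b)"
    by (intro sum.cong refl, rule sum.swap)
  also have "\<dots> = (\<Sum>r<d. \<Sum>a<d. \<Sum>i\<in>I. \<Sum>b<d. \<Sum>j\<in>I. ?t i j r a b)"
    by (intro sum.cong refl, rule sum.swap)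
  also have "\<dots> = (\<Sum>r<d. \<Sum>a<d. \<Sum>b<d. \<Sum>i\<in>I. \<Sum>j\<in>I. ?t i j r a b)"
    by (intro sum.cong refl, rule sum.swap)
  also have "\<dots> = (\<Sum>r<d. \<Sum>a<d. \<Sum>b<d. cnj (Z r a) * G $$ (a, b) * Z r b)"
  proof (intro sum.cong refl)
    fix r a b
    have "cnj (Z r a) * G $$ (a, b) * Z r b = (Z r b * cnj (Z r a)) * G $$ (a, b)"
      by (simp only: mult_ac)
    also have "\<dots> = (\<Sum>i\<in>I. \<Sum>j\<in>I. (c i * cnj (X i $$ (r, b))) * (c j * X j $$ (r, a)) * G $$ (a, b))"
      unfolding cZ unfolding Z_def unfolding sum_product unfolding sum_distrib_right ..
    finally show "(\<Sum>i\<in>I. \<Sum>j\<in>I. ?t i j r a b) =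
        cnj (Z r a) * G $$ (a, b) * Z r b"
      by (simp only: mult_ac)
  qed
  finally have eq: "(\<Sum>i\<in>I. \<Sum>j\<in>I. complex_of_real (c i * c j) * tr (G * (dag (X i) * X j)))
     = (\<Sum>r<d. \<Sum>a<d. \<Sum>b<d. cnj (Z r a) * G $$ (a, b) * Z r b)" .
  have "(\<Sum>i\<in>I. \<Sum>j\<in>I. c i * c j * expval G (dag (X i) * X j)) =
      Re (\<Sum>i\<in>I. \<Sum>j\<in>I. complex_of_real (c i * c j) * tr (G * (dag (X i) * X j)))"
    by (simp add: expval_def)
  also have "\<dots> = (\<Sum>r<d. Re (\<Sum>a<d. \<Sum>b<d. cnj (Z r a) * G $$ (a, b) * Z r b))"
    unfolding eq by simp
  also have "\<dots> \<ge> 0"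
    using G unfolding is_psd_def Let_def by (intro sum_nonneg) blast
  finally show ?thesis .
qed

context majorana_system
begin

text \<open>Flattened, the 4^n operators are the rows of a square matrix U, and trace orthogonality
  provides a right inverse V. For square matrices it is also a left inverse, and
  \<open>V * U = 1\<close> read entrywise is the completeness relation.\<close>

lemma g_completeness:
  assumes "a < d" "b < d" "c < d" "e < d"
  shows "(\<Sum>R\<in>Pow modes. g R $$ (a, b) * g R $$ (c, e)) = (if a = e \<and> b = c then of_nat d else 0)"
proof -
  define M where "M = d * d"
  have "card (Pow modes) = M" by (simp add: M_def card_Pow power_mult flip: power_mult_distrib)
  then obtain f where f: "bij_betw f {0..<M} (Pow modes)"
    using ex_bij_betw_nat_finite[of "Pow modes"] by auto
  have fm: "f r \<subseteq> modes" if "r < M" for r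
    using bij_betwE[OF f] that by auto
  define U where "U = mat M M (\<lambda>(r, c). g (f r) $$ (c div d, c mod d))"
  define V where "V = mat M M (\<lambda>(c, r). g (f r) $$ (c mod d, c div d) / of_nat d)"
  have UV: "U \<in> carrier_mat M M" "V \<in> carrier_mat M M" by (auto simp: U_def V_def)
  have "U * V = 1\<^sub>m M"
  proof (rule eq_matI)
    fix r s assume "r < dim_row (1\<^sub>m M :: complex mat)" "s < dim_col (1\<^sub>m M :: complex mat)"
    then have rs: "r < M" "s < M" by auto
    have "(U * V) $$ (r, s) = (\<Sum>c<M. g (f r) $$ (c div d, c mod d) * (g (f s) $$ (c mod d, c div d) / of_nat d))"
      using mult_entry[OF UV rs] rs by (simp add: U_def V_def del: index_mult_mat)
    also have "\<dots> = (\<Sum>a<d. \<Sum>b<d. g (f r) $$ (a, b) * (g (f s) $$ (b, a) / of_nat d))"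
      unfolding M_def by (rule sum_div_mod)
    also have "\<dots> = tr (g (f r) * g (f s)) / of_nat d"
      using tr_mult[OF g_C[OF fm[OF rs(1)]] g_C[OF fm[OF rs(2)]]] by (simp add: sum_divide_distrib)
    also have "\<dots> = (1\<^sub>m M) $$ (r, s)"
    proof (cases "r = s")
      case True
      then show ?thesis using rs g_sq[OF fm[OF rs(1)]] by simp
    next
      case False
      then have "f r \<noteq> f s"
        using f rs by (auto simp: bij_betw_def inj_on_def)
      then show ?thesis using g_trace[OF fm[OF rs(1)] fm[OF rs(2)]] rs False by simp
    qed
    finally show "(U * V) $$ (r, s) = (1\<^sub>m M) $$ (r, s)" .
  qed (use UV in auto)
  then have VU: "V * U = 1\<^sub>m M"
    by (rule mat_mult_left_right_inverse[OF UV])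
  have idx: "y * d + x < M \<and> (y * d + x) mod d = x \<and> (y * d + x) div d = y" if "x < d" "y < d" for x y
  proof -
    have "y * d + x < (y + 1) * d" using that by simp
    also have "\<dots> \<le> M" unfolding M_def using that by (intro mult_right_mono) auto
    finally show ?thesis using that by simp
  qed
  note i = idx[OF assms(1,2)] and j = idx[OF assms(4,3)]
  have "(V * U) $$ (b * d + a, c * d + e) = (\<Sum>r<M. g (f r) $$ (a, b) / of_nat d * g (f r) $$ (c, e))"
    using mult_entry[OF UV(2,1)] i j by (simp add: U_def V_def del: index_mult_mat)
  also have "\<dots> = (\<Sum>r\<in>{0..<M}. g (f r) $$ (a, b) * g (f r) $$ (c, e)) / of_nat d"
    by (simp add: sum_divide_distrib atLeast0LessThan)
  also have "\<dots> = (\<Sum>R\<in>Pow modes. g R $$ (a, b) * g R $$ (c, e)) / of_nat d"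
    using sum.reindex_bij_betw[OF f, of "\<lambda>R. g R $$ (a, b) * g R $$ (c, e)"] by simp
  finally have "(\<Sum>R\<in>Pow modes. g R $$ (a, b) * g R $$ (c, e)) / of_nat d = (if b * d + a = c * d + e then 1 else 0)"
    unfolding VU using i j by simp
  moreover have "b * d + a = c * d + e \<longleftrightarrow> a = e \<and> b = c"
    using i j by metis
  ultimately show ?thesis by (simp add: field_simps split: if_splits)
qed

lemma twirl:
  assumes X: "X \<in> C" and ae: "a < d" "e < d"
  shows "(\<Sum>R\<in>Pow modes. (g R * X * g R) $$ (a, e)) = (if a = e then of_nat d * tr X else 0)"
proof -
  have "(\<Sum>R\<in>Pow modes. (g R * X * g R) $$ (a, e)) =
     (\<Sum>R\<in>Pow modes. \<Sum>b<d. \<Sum>c<d. X $$ (b, c) * (g R $$ (a, b) * g R $$ (c, e)))"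
    by (intro sum.cong refl triple_mult_entry) (use X ae in auto)
  also have "\<dots> = (\<Sum>b<d. \<Sum>c<d. \<Sum>R\<in>Pow modes. X $$ (b, c) * (g R $$ (a, b) * g R $$ (c, e)))"
    by (subst sum.swap, intro sum.cong refl, rule sum.swap)
  also have "\<dots> = (\<Sum>b<d. \<Sum>c<d. X $$ (b, c) * (if a = e \<and> b = c then of_nat d else 0))"
    unfolding sum_distrib_left[symmetric]
    by (intro sum.cong refl arg_cong2[where f = "(*)"] g_completeness) (use ae in auto)
  also have "\<dots> = (if a = e then of_nat d * tr X else 0)"
    using X by (auto simp: tr_def sum_distrib_left mult.commute if_distrib cong: if_cong)
  finally show ?thesis .
qed

text \<open>The sign is the one for moving \<open>g R\<close> past \<open>g S\<close>, so the signed
  summand equals \<open>g S * (g R * (g S * X) * g R)\<close> and the plain twirl applies to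
  \<open>g S * X\<close>.\<close>

lemma signed_twirl:
  assumes X: "X \<in> C" and S: "S \<subseteq> modes" and ae: "a < d" "e < d"
  shows "(\<Sum>R\<in>Pow modes. (-1) ^ (card R * card S + card (R \<inter> S)) * (g R * X * g R) $$ (a, e)) =
     of_nat d * tr (g S * X) * g S $$ (a, e)"
proof -
  have s: "(-1) ^ (card R * card S + card (R \<inter> S)) \<cdot>\<^sub>m (g R * X * g R) = g S * (g R * (g S * X) * g R)"
    if "R \<subseteq> modes" for R
  proof -
    have C: "g R \<in> C" "g S \<in> C" using that S by auto
    have "g S * (g R * (g S * X) * g R) = g S * ((g R * g S) * (X * g R))"
      using C X by (simp add: mat_simps)
    also have "\<dots> = (-1) ^ (card R * card S + card (R \<inter> S)) \<cdot>\<^sub>m ((g S * g S) * (g R * X * g R))"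
      unfolding g_commute[OF that S] using C X by (simp add: mat_simps)
    finally show ?thesis using C X by (simp add: g_sq[OF S] mat_simps)
  qed
  have "(\<Sum>R\<in>Pow modes. (-1) ^ (card R * card S + card (R \<inter> S)) * (g R * X * g R) $$ (a, e)) =
     (\<Sum>R\<in>Pow modes. (g S * (g R * (g S * X) * g R)) $$ (a, e))"
  proof (rule sum.cong)
    fix R assume "R \<in> Pow modes"
    then have R: "R \<subseteq> modes" by simp
    then have "g R * X * g R \<in> C" using X by simp
    then show "(-1) ^ (card R * card S + card (R \<inter> S)) * (g R * X * g R) $$ (a, e) =
        (g S * (g R * (g S * X) * g R)) $$ (a, e)"
      unfolding s[OF R, symmetric] using ae by (simp del: index_mult_mat)
  qed simp
  also have "\<dots> = (\<Sum>R\<in>Pow modes. \<Sum>b<d. g S $$ (a, b) * (g R * (g S * X) * g R) $$ (b, e))"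
    by (intro sum.cong refl mult_entry) (use X S ae in auto)
  also have "\<dots> = (\<Sum>b<d. g S $$ (a, b) * (\<Sum>R\<in>Pow modes. (g R * (g S * X) * g R) $$ (b, e)))"
    by (subst sum.swap) (simp add: sum_distrib_left)
  also have "\<dots> = (\<Sum>b<d. g S $$ (a, b) * (if b = e then of_nat d * tr (g S * X) else 0))"
    by (intro sum.cong refl arg_cong2[where f = "(*)"] twirl) (use X S ae in auto)
  also have "\<dots> = of_nat d * tr (g S * X) * g S $$ (a, e)"
    using ae by (simp add: mult.commute if_distrib cong: if_cong)
  finally show ?thesis .
qed

end

section \<open>Joint measurability\<close>

lemma tr_conv_sum: "A \<in> carrier_mat d d \<Longrightarrow> tr A = (\<Sum>a<d. A $$ (a, a))"
  by (auto simp: tr_def)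

lemma povm_trace:
  assumes "is_povm d \<Lambda> G"
  shows "(\<Sum>l\<in>\<Lambda>. tr (G l)) = of_nat d"
proof -
  have GC: "G l \<in> carrier_mat d d" if "l \<in> \<Lambda>" for l
    using assms that by (auto simp: is_povm_def is_psd_def)
  have "(\<Sum>l\<in>\<Lambda>. tr (G l)) = (\<Sum>l\<in>\<Lambda>. \<Sum>a<d. G l $$ (a, a))"
    using GC by (intro sum.cong refl tr_conv_sum)
  also have "\<dots> = (\<Sum>a<d. \<Sum>l\<in>\<Lambda>. G l $$ (a, a))" by (rule sum.swap)
  also have "\<dots> = of_nat d" using assms by (simp add: is_povm_def)
  finally show ?thesis .
qed

context majorana_system
begin

lemma subsets_m_iff: "S \<in> subsets_m n m \<longleftrightarrow> S \<subseteq> modes \<and> card S = m"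
  by (simp add: subsets_m_def)

lemma finite_subsets_m [simp]: "finite (subsets_m n m)"
  by (rule finite_subset[of _ "Pow modes"]) (auto simp: subsets_m_def)

lemma card_subsets_m: "card (subsets_m n m) = (2 * n) choose m"
  unfolding subsets_m_def by (subst n_subsets) auto

lemma noisy_obs_entry:
  assumes "S \<subseteq> modes" "a < d" "b < d"
  shows "noisy_obs n \<gamma> \<eta> S e $$ (a, b) =
    ((if a = b then 1 else 0) + (if e then \<eta> else - \<eta>) * g S $$ (a, b)) / 2"
  using assms(2,3) carrier_matD[OF g_C[OF assms(1)]] by (simp add: noisy_obs_def)

text \<open>The two effects of an observable differ by \<open>\<eta>\<close> times
  \<open>g S\<close>, and the response functions by some u in [-1, 1]. Pairing with
  \<open>g S\<close>, whose square has trace d, isolates \<open>\<eta>\<close>; bounding u by 1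
  gives the absolute values.\<close>

lemma jointly_measurable_upper:
  assumes jm: "jointly_measurable d (subsets_m n m) (\<lambda>_. UNIV) (\<lambda>S e. noisy_obs n \<gamma> \<eta> S e)"
  obtains \<Lambda> :: "nat set" and G where "is_povm d \<Lambda> G"
    and "\<eta> * real (card (subsets_m n m)) * real d \<le> (\<Sum>l\<in>\<Lambda>. \<Sum>S\<in>subsets_m n m. \<bar>expval (G l) (g S)\<bar>)"
proof -
  from jm obtain \<Lambda> :: "nat set" and G D where povm: "is_povm d \<Lambda> G"
    and D0: "\<And>S l e. S \<in> subsets_m n m \<Longrightarrow> l \<in> \<Lambda> \<Longrightarrow> D S e l \<ge> 0"
    and D1: "\<And>S l. S \<in> subsets_m n m \<Longrightarrow> l \<in> \<Lambda> \<Longrightarrow> (\<Sum>e\<in>UNIV. D S e l) = 1"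
    and DM: "\<And>S e a b. S \<in> subsets_m n m \<Longrightarrow> a < d \<Longrightarrow> b < d \<Longrightarrow>
        noisy_obs n \<gamma> \<eta> S e $$ (a, b) = (\<Sum>l\<in>\<Lambda>. complex_of_real (D S e l) * G l $$ (a, b))"
    unfolding jointly_measurable_def by (auto; blast)
  have GC: "G l \<in> C" if "l \<in> \<Lambda>" for l
    using povm that by (auto simp: is_povm_def is_psd_def)
  define u where "u S l = D S True l - D S False l" for S l
  have u: "\<bar>u S l\<bar> \<le> 1" if "S \<in> subsets_m n m" "l \<in> \<Lambda>" for S l
    using D0[OF that, of True] D0[OF that, of False] D1[OF that] by (simp add: u_def UNIV_bool)
  have main: "\<eta> * real d = (\<Sum>l\<in>\<Lambda>. u S l * expval (G l) (g S))" if S: "S \<in> subsets_m n m" for S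
  proof -
    have Sm: "S \<subseteq> modes" using S by (simp add: subsets_m_iff)
    have e: "\<eta> * g S $$ (a, b) = (\<Sum>l\<in>\<Lambda>. u S l * G l $$ (a, b))" if "a < d" "b < d" for a b
    proof -
      have "\<eta> * g S $$ (a, b) = noisy_obs n \<gamma> \<eta> S True $$ (a, b) - noisy_obs n \<gamma> \<eta> S False $$ (a, b)"
        using that by (simp add: noisy_obs_entry[OF Sm that] field_simps)
      also have "\<dots> = (\<Sum>l\<in>\<Lambda>. u S l * G l $$ (a, b))"
        unfolding DM[OF S that] by (simp add: u_def left_diff_distrib sum_subtractf)
      finally show ?thesis .
    qed
    have "complex_of_real (\<eta> * real d) = \<eta> * tr (g S * g S)"
      by (simp add: g_sq[OF Sm])
    also have "\<dots> = (\<Sum>a<d. \<Sum>b<d. (\<eta> * g S $$ (a, b)) * g S $$ (b, a))"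
      unfolding tr_mult[OF g_C[OF Sm] g_C[OF Sm]] by (simp add: sum_distrib_left mult.assoc)
    also have "\<dots> = (\<Sum>a<d. \<Sum>b<d. \<Sum>l\<in>\<Lambda>. u S l * (G l $$ (a, b) * g S $$ (b, a)))"
      by (intro sum.cong refl) (simp add: e sum_distrib_right mult.assoc)
    also have "\<dots> = (\<Sum>a<d. \<Sum>l\<in>\<Lambda>. \<Sum>b<d. u S l * (G l $$ (a, b) * g S $$ (b, a)))"
      by (rule sum.cong[OF refl], rule sum.swap)
    also have "\<dots> = (\<Sum>l\<in>\<Lambda>. \<Sum>a<d. \<Sum>b<d. u S l * (G l $$ (a, b) * g S $$ (b, a)))"
      by (rule sum.swap)
    also have "\<dots> = (\<Sum>l\<in>\<Lambda>. u S l * tr (G l * g S))"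
      by (intro sum.cong refl) (simp add: tr_mult[OF GC g_C[OF Sm]] sum_distrib_left)
    finally have "Re (complex_of_real (\<eta> * real d)) = Re (\<Sum>l\<in>\<Lambda>. u S l * tr (G l * g S))" by (rule arg_cong)
    then show ?thesis by (simp add: expval_def)
  qed
  have "\<eta> * real (card (subsets_m n m)) * real d = (\<Sum>S\<in>subsets_m n m. \<eta> * real d)" by simp
  also have "\<dots> = (\<Sum>S\<in>subsets_m n m. \<Sum>l\<in>\<Lambda>. u S l * expval (G l) (g S))"
    by (intro sum.cong refl main)
  also have "\<dots> \<le> (\<Sum>S\<in>subsets_m n m. \<Sum>l\<in>\<Lambda>. \<bar>expval (G l) (g S)\<bar>)"
  proof (intro sum_mono)
    fix S l assume "S \<in> subsets_m n m" "l \<in> \<Lambda>"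
    then have "\<bar>u S l * expval (G l) (g S)\<bar> \<le> 1 * \<bar>expval (G l) (g S)\<bar>"
      unfolding abs_mult by (intro mult_right_mono u) auto
    then show "u S l * expval (G l) (g S) \<le> \<bar>expval (G l) (g S)\<bar>" by simp
  qed
  also have "\<dots> = (\<Sum>l\<in>\<Lambda>. \<Sum>S\<in>subsets_m n m. \<bar>expval (G l) (g S)\<bar>)" by (rule sum.swap)
  finally show ?thesis by (rule that[OF povm])
qed

lemma expval_state_real:
  assumes S: "S \<subseteq> modes" and K: "K \<in> C"
  shows "complex_of_real (expval (g S) (K * dag K)) = tr (g S * (K * dag K))"
proof -
  have r: "dag (K * dag K) = K * dag K" using K by (simp add: dag_mult[of _ d] dag_dag[of _ d])
  have "cnj (tr (g S * (K * dag K))) = tr (dag (g S * (K * dag K)))"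
    using S K by (simp add: tr_dag[of _ d])
  also have "\<dots> = tr ((K * dag K) * g S)"
    using S K by (simp add: dag_mult[of _ d "K * dag K"] g_dag r)
  also have "\<dots> = tr (g S * (K * dag K))"
    using S K by (intro tr_commute[of _ d]) auto
  finally have "Im (tr (g S * (K * dag K))) = 0" by (simp add: complex_eq_iff)
  then show ?thesis by (simp add: expval_def complex_eq_iff)
qed

text \<open>The parent POVM consists of the states conjugated by all \<open>g R\<close>. Its outcome
  reveals R and t, hence the sign of the moment of \<open>g S\<close> in the conjugated state, and
  reporting that sign yields at least the noise level \<open>\<eta>\<close>; damping by
  \<open>c S\<close> makes it exact for every S.\<close>

lemma jointly_measurable_lower:
  fixes K :: "'t \<Rightarrow> complex mat"
  assumes T: "finite T" "T \<noteq> {}" and K: "\<And>t. t \<in> T \<Longrightarrow> K t \<in> C"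
    and norm: "\<And>t. t \<in> T \<Longrightarrow> tr (K t * dag (K t)) = 1"
    and \<eta>: "0 \<le> \<eta>"
    and le: "\<And>S. S \<in> subsets_m n m \<Longrightarrow>
        \<eta> * real (card T) \<le> (\<Sum>t\<in>T. \<bar>expval (g S) (K t * dag (K t))\<bar>)"
  shows "jointly_measurable d (subsets_m n m) (\<lambda>_. UNIV) (\<lambda>S e. noisy_obs n \<gamma> \<eta> S e)"
proof -
  define I where "I = Pow modes \<times> T"
  have finI: "finite I" using T by (simp add: I_def)
  obtain h where h: "bij_betw h {0..<card I} I" using ex_bij_betw_nat_finite[OF finI] by auto
  define \<rho> where "\<rho> t = K t * dag (K t)" for t
  have \<rho>C: "\<rho> t \<in> C" if "t \<in> T" for t using K[OF that] by (simp add: \<rho>_def)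
  define q where "q = 1 / (real d * real (card T))"
  have qpos: "q \<ge> 0" and cT: "real (card T) > 0" using T by (auto simp: q_def card_gt_0_iff)
  define P where "P R t = complex_of_real q \<cdot>\<^sub>m (g R * \<rho> t * g R)" for R t
  define s where "s S t = expval (g S) (\<rho> t)" for S t
  define \<Sigma> where "\<Sigma> S = (\<Sum>t\<in>T. \<bar>s S t\<bar>)" for S
  \<comment> \<open>If \<open>\<Sigma> S = 0\<close>, the hypothesis forces
    \<open>\<eta> = 0\<close>, and the default value 0 of the quotient is then the right
    damping.\<close>
  define c where "c S = \<eta> * real (card T) / \<Sigma> S" for S
  \<comment> \<open>The power of -1 undoes the sign that \<open>g S\<close> picks up under
    conjugation by \<open>g R\<close>; the signum aligns the moment of the state t.\<close>
  define u where "u S R t = (-1) ^ (card R * card S + card (R \<inter> S)) * (c S * sgn (s S t))" for S R t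
  have \<Sigma>0: "\<Sigma> S \<ge> 0" for S unfolding \<Sigma>_def by (intro sum_nonneg) auto
  have le': "\<eta> * real (card T) \<le> \<Sigma> S" if "S \<in> subsets_m n m" for S
    using le[OF that] by (simp add: \<Sigma>_def s_def \<rho>_def)
  have c01: "0 \<le> c S \<and> c S \<le> 1" if "S \<in> subsets_m n m" for S
    using le'[OF that] \<Sigma>0[of S] \<eta> by (cases "\<Sigma> S = 0") (auto simp: c_def field_simps)
  have cS: "c S * \<Sigma> S = \<eta> * real (card T)" if "S \<in> subsets_m n m" for S
    using le'[OF that] \<eta> cT by (cases "\<Sigma> S = 0") (auto simp: c_def mult_le_0_iff)
  have u1: "\<bar>u S R t\<bar> \<le> 1" if "S \<in> subsets_m n m" for S R t
    using c01[OF that] by (simp add: u_def abs_mult power_abs abs_sgn_eq)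
  have PC: "P R t \<in> C" if "R \<subseteq> modes" "t \<in> T" for R t
    using \<rho>C[OF that(2)] that(1) by (simp add: P_def)
  have Pe: "P R t $$ (a, b) = q * (g R * \<rho> t * g R) $$ (a, b)" if "R \<subseteq> modes" "t \<in> T" "a < d" "b < d" for R t a b
  proof -
    have "g R * \<rho> t * g R \<in> C" using \<rho>C[OF that(2)] that(1) by simp
    then show ?thesis using that by (simp add: P_def del: index_mult_mat assoc_mult_mat)
  qed
  have Ppsd: "is_psd d (P R t)" if "R \<subseteq> modes" "t \<in> T" for R t
  proof -
    have KC: "K t \<in> C" "g R \<in> C" using K that by auto
    have "g R * \<rho> t * g R = (g R * K t) * dag (g R * K t)"
      using KC by (simp add: \<rho>_def dag_mult[OF KC(2,1)] g_dag[OF that(1)] assoc)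
    then show ?thesis
      unfolding P_def using psd_mult_dag[OF _ qpos, of "g R * K t" d] KC by simp
  qed
  have herm: "complex_of_real (s S t) = tr (g S * \<rho> t)" if S: "S \<subseteq> modes" and t: "t \<in> T" for S t
    using expval_state_real[OF S K[OF t]] by (simp add: s_def \<rho>_def)
  have reindex: "(\<Sum>l\<in>{0..<card I}. F (h l)) = (\<Sum>R\<in>Pow modes. \<Sum>t\<in>T. F (R, t))" for F :: "nat set \<times> 't \<Rightarrow> complex"
    using sum.reindex_bij_betw[OF h, of F] by (simp add: I_def sum.cartesian_product split_def)
  have hI: "fst (h l) \<subseteq> modes \<and> snd (h l) \<in> T" if "l \<in> {0..<card I}" for l
    using bij_betwE[OF h] that by (auto simp: I_def mem_Times_iff)
  define G where "G l = P (fst (h l)) (snd (h l))" for l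
  define D where "D S e l = (1 + (if e then 1 else -1) * u S (fst (h l)) (snd (h l))) / 2" for S e l
  have sumP: "(\<Sum>R\<in>Pow modes. \<Sum>t\<in>T. P R t $$ (a, b)) = (if a = b then 1 else 0)" if ab: "a < d" "b < d" for a b
  proof -
    have "(\<Sum>R\<in>Pow modes. \<Sum>t\<in>T. P R t $$ (a, b)) = (\<Sum>t\<in>T. \<Sum>R\<in>Pow modes. q * (g R * \<rho> t * g R) $$ (a, b))"
      by (subst sum.swap, intro sum.cong refl Pe) (use ab in auto)
    also have "\<dots> = (\<Sum>t\<in>T. q * (if a = b then of_nat d * tr (\<rho> t) else 0))"
      unfolding sum_distrib_left[symmetric]
      by (intro sum.cong refl arg_cong2[where f = "(*)"] twirl \<rho>C ab)
    also have "\<dots> = (if a = b then 1 else 0)"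
      using norm cT by (simp add: \<rho>_def q_def)
    finally show ?thesis .
  qed
  have sumuP: "(\<Sum>R\<in>Pow modes. \<Sum>t\<in>T. u S R t * P R t $$ (a, b)) = \<eta> * g S $$ (a, b)"
    if ab: "a < d" "b < d" and S: "S \<in> subsets_m n m" for a b S
  proof -
    have Sm: "S \<subseteq> modes" using S by (simp add: subsets_m_iff)
    have "(\<Sum>R\<in>Pow modes. \<Sum>t\<in>T. u S R t * P R t $$ (a, b)) =
       (\<Sum>t\<in>T. \<Sum>R\<in>Pow modes. (c S * sgn (s S t) * q) * ((-1) ^ (card R * card S + card (R \<inter> S)) * (g R * \<rho> t * g R) $$ (a, b)))"
      by (subst sum.swap, intro sum.cong refl) (use ab in \<open>auto simp: Pe u_def simp del: index_mult_mat assoc_mult_mat\<close>)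
    also have "\<dots> = (\<Sum>t\<in>T. (c S * sgn (s S t) * q) * (of_nat d * tr (g S * \<rho> t) * g S $$ (a, b)))"
      unfolding sum_distrib_left[symmetric]
      by (intro sum.cong refl arg_cong2[where f = "(*)"] signed_twirl \<rho>C ab Sm)
    also have "\<dots> = (\<Sum>t\<in>T. (c S * q * d) * complex_of_real \<bar>s S t\<bar> * g S $$ (a, b))"
    proof (intro sum.cong refl)
      fix t assume t: "t \<in> T"
      have "complex_of_real \<bar>s S t\<bar> = complex_of_real (sgn (s S t)) * complex_of_real (s S t)"
        by (simp add: abs_sgn mult.commute flip: of_real_mult)
      then show "(c S * sgn (s S t) * q) * (of_nat d * tr (g S * \<rho> t) * g S $$ (a, b)) =
          (c S * q * d) * complex_of_real \<bar>s S t\<bar> * g S $$ (a, b)"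
        unfolding herm[OF Sm t, symmetric] by simp
    qed
    also have "\<dots> = complex_of_real (c S * \<Sigma> S * (q * d)) * g S $$ (a, b)"
      by (simp add: \<Sigma>_def sum_distrib_left sum_distrib_right mult_ac)
    also have "c S * \<Sigma> S * (q * d) = \<eta>"
      unfolding cS[OF S] using cT by (simp add: q_def)
    finally show ?thesis .
  qed
  show ?thesis
    unfolding jointly_measurable_def
  proof (intro exI[of _ "{0..<card I}"] exI[of _ G] exI[of _ D] conjI ballI allI impI)
    show "is_povm d {0..<card I} G"
      unfolding is_povm_def
    proof (intro conjI ballI allI impI)
      show "is_psd d (G l)" if "l \<in> {0..<card I}" for l
        using Ppsd hI[OF that] by (simp add: G_def)
      show "(\<Sum>l\<in>{0..<card I}. G l $$ (a, b)) = (if a = b then 1 else 0)" if "a < d" "b < d" for a b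
        using reindex[of "\<lambda>(R, t). P R t $$ (a, b)"] sumP[OF that] by (simp add: G_def split_def)
    qed simp
    show "0 \<le> D S e l" if "S \<in> subsets_m n m" for S e l
      using u1[OF that, of "fst (h l)" "snd (h l)"] by (auto simp: D_def abs_le_iff)
    show "(\<Sum>e\<in>UNIV. D S e l) = 1" for S l
      by (simp add: D_def UNIV_bool field_simps)
    show "noisy_obs n \<gamma> \<eta> S e \<in> carrier_mat d d" if "S \<in> subsets_m n m" for S e
      using that by (auto simp: noisy_obs_def subsets_m_iff)
    fix S e a b assume S: "S \<in> subsets_m n m" and ab: "a < d" "b < d"
    have Sm: "S \<subseteq> modes" using S by (simp add: subsets_m_iff)
    have "(\<Sum>l\<in>{0..<card I}. complex_of_real (D S e l) * G l $$ (a, b)) =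
        (\<Sum>R\<in>Pow modes. \<Sum>t\<in>T. complex_of_real ((1 + (if e then 1 else -1) * u S R t) / 2) * P R t $$ (a, b))"
      using reindex[of "\<lambda>(R, t). complex_of_real ((1 + (if e then 1 else -1) * u S R t) / 2) * P R t $$ (a, b)"]
      by (simp add: G_def D_def split_def)
    also have "\<dots> = (\<Sum>R\<in>Pow modes. \<Sum>t\<in>T. P R t $$ (a, b) / 2 + (if e then 1 else -1) / 2 * (u S R t * P R t $$ (a, b)))"
      by (intro sum.cong refl) (auto simp: field_simps)
    also have "\<dots> = (\<Sum>R\<in>Pow modes. \<Sum>t\<in>T. P R t $$ (a, b)) / 2
        + (if e then 1 else -1) / 2 * (\<Sum>R\<in>Pow modes. \<Sum>t\<in>T. u S R t * P R t $$ (a, b))"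
      by (simp only: sum.distrib sum_divide_distrib[symmetric] sum_distrib_left[symmetric])
    also have "\<dots> = noisy_obs n \<gamma> \<eta> S e $$ (a, b)"
      unfolding sumP[OF ab] sumuP[OF ab S] noisy_obs_entry[OF Sm ab] by (simp add: field_simps)
    finally show "noisy_obs n \<gamma> \<eta> S e $$ (a, b) =
        (\<Sum>l\<in>{0..<card I}. complex_of_real (D S e l) * G l $$ (a, b))" by simp
  qed
qed

end

section \<open>Bounds on the robustness as a supremum\<close>

context majorana_system
begin

abbreviation compatible :: "nat \<Rightarrow> real \<Rightarrow> bool" where
  "compatible m \<eta> \<equiv> jointly_measurable d (subsets_m n m) (\<lambda>_. UNIV) (\<lambda>S e. noisy_obs n \<gamma> \<eta> S e)"

text \<open>Makes the set under the supremum in \<open>eta_star\<close> nonempty; the maximally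
  mixed state serves as witness.\<close>

lemma compatible_zero: "compatible m 0"
proof -
  define r where "r = complex_of_real (1 / sqrt d)"
  have "1 / sqrt d * (1 / sqrt d) = 1 / real d" by simp
  then have rr: "r * r = complex_of_real (1 / real d)"
    unfolding r_def of_real_mult[symmetric] by (rule arg_cong)
  have "cnj r = r" by (simp add: r_def)
  then have "tr (r \<cdot>\<^sub>m 1\<^sub>m d * dag (r \<cdot>\<^sub>m 1\<^sub>m d)) = r * r * tr (1\<^sub>m d)"
    by (simp add: dag_smult[of _ d] smult_left smult_right one_left smult_smult_mat tr_smult[of _ d])
  also have "\<dots> = 1"
    unfolding rr by simp
  finally have "tr (r \<cdot>\<^sub>m 1\<^sub>m d * dag (r \<cdot>\<^sub>m 1\<^sub>m d)) = 1" .
  then show ?thesis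
    by (intro jointly_measurable_lower[where T = "{()}" and K = "\<lambda>_. r \<cdot>\<^sub>m 1\<^sub>m d"]) auto
qed

lemma eta_star_ge: "0 \<le> \<eta> \<Longrightarrow> \<eta> \<le> 1 \<Longrightarrow> compatible m \<eta> \<Longrightarrow> \<eta> \<le> eta_star n \<gamma> m"
  unfolding eta_star_def by (rule cSup_upper) (auto intro!: bdd_aboveI[of _ 1])

lemma eta_star_nonneg: "0 \<le> eta_star n \<gamma> m"
  by (rule eta_star_ge) (auto simp: compatible_zero)

lemma less_eta_star:
  assumes "x < eta_star n \<gamma> m"
  obtains \<eta> where "x < \<eta>" "compatible m \<eta>"
proof -
  have "\<exists>\<eta>\<in>{\<eta> \<in> {0..1}. compatible m \<eta>}. x < \<eta>"
    using assms unfolding eta_star_def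
    by (subst (asm) less_cSup_iff) (auto intro!: bdd_aboveI[of _ 1] exI[of _ 0] simp: compatible_zero)
  then show ?thesis using that by auto
qed

lemma eta_star_le:
  assumes B: "\<And>G. is_psd d G \<Longrightarrow>
      (\<Sum>S\<in>subsets_m n m. \<bar>expval G (g S)\<bar>) \<le> B * real (card (subsets_m n m)) * Re (tr G)"
    and m: "m \<le> 2 * n"
  shows "eta_star n \<gamma> m \<le> B"
proof -
  have c: "real (card (subsets_m n m)) > 0" using m by (simp add: card_subsets_m zero_less_binomial)
  have "\<eta> \<le> B" if comp: "compatible m \<eta>" for \<eta>
  proof -
    obtain \<Lambda> :: "nat set" and G where povm: "is_povm d \<Lambda> G"
      and le: "\<eta> * real (card (subsets_m n m)) * real d \<le> (\<Sum>l\<in>\<Lambda>. \<Sum>S\<in>subsets_m n m. \<bar>expval (G l) (g S)\<bar>)"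
      using jointly_measurable_upper[OF comp] .
    from le have "\<eta> * real (card (subsets_m n m)) * real d \<le> (\<Sum>l\<in>\<Lambda>. \<Sum>S\<in>subsets_m n m. \<bar>expval (G l) (g S)\<bar>)" .
    also have "(\<Sum>l\<in>\<Lambda>. \<Sum>S\<in>subsets_m n m. \<bar>expval (G l) (g S)\<bar>) \<le>
        (\<Sum>l\<in>\<Lambda>. B * real (card (subsets_m n m)) * Re (tr (G l)))"
      using povm by (intro sum_mono B) (auto simp: is_povm_def)
    also have "\<dots> = B * real (card (subsets_m n m)) * Re (\<Sum>l\<in>\<Lambda>. tr (G l))"
      by (simp add: sum_distrib_left)
    also have "\<dots> = B * real (card (subsets_m n m)) * real d"
      unfolding povm_trace[OF povm] by simp
    finally have "\<eta> * (real (card (subsets_m n m)) * real d) \<le> B * (real (card (subsets_m n m)) * real d)"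
      by (simp only: mult.assoc)
    with c show ?thesis by (simp add: mult_le_cancel_right)
  qed
  then show ?thesis
    unfolding eta_star_def using compatible_zero[of m]
    by (intro cSup_least) (auto intro!: exI[of _ 0])
qed

lemma expval_one: "is_psd d G \<Longrightarrow> expval G (1\<^sub>m d) = Re (tr G)"
  by (simp add: expval_def is_psd_def one_right)

lemma expval_commute_sign:
  assumes "G \<in> C" "R \<subseteq> modes" "S \<subseteq> modes"
  shows "expval G (g R * g S) = (-1) ^ (card R * card S + card (R \<inter> S)) * expval G (g S * g R)"
proof -
  have "g R * g S = complex_of_real ((-1) ^ (card R * card S + card (R \<inter> S))) \<cdot>\<^sub>m (g S * g R)"
    using g_commute[OF assms(2,3)] by simp
  then show ?thesis
    using assms by (simp only: expval_smult[OF assms(1) mult_C] g_C)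
qed

text \<open>The moment matrix of the observables together with the identity operator is positive.
  Its block on the observables is the P of the certificate bound, and its border carries the moments
  x.\<close>

lemma sum_sq_expval_le:
  assumes G: "is_psd d G" and k: "k \<ge> 1"
    and w: "dual_certificate n k w"
  shows "(\<Sum>S\<in>subsets_m n (2*k). (expval G (g S))\<^sup>2) \<le> real (n choose k) * (Re (tr G))\<^sup>2"
proof -
  define F where "F = subsets_m n (2*k)"
  have GC: "G \<in> C" using G by (simp add: is_psd_def)
  have Fm: "S \<subseteq> modes" "card S = 2 * k" if "S \<in> F" for S
    using that by (auto simp: F_def subsets_m_iff)
  have finF: "finite F" by (simp add: F_def)
  define x where "x S = expval G (g S)" for S
  \<comment> \<open>Symmetrising leaves the quadratic form unchanged and makes the entry of an
    anticommuting pair zero; for sets of even size that means odd intersection.\<close>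
  define P where "P S T = (expval G (g S * g T) + expval G (g T * g S)) / 2" for S T
  define \<tau> where "\<tau> = Re (tr G)"
  have gram: "(\<Sum>S\<in>I. \<Sum>T\<in>I. c S * c T * expval G (g S * g T)) \<ge> 0"
    if "I \<subseteq> Pow modes" for I and c :: "nat set \<Rightarrow> real"
  proof -
    have "(\<Sum>S\<in>I. \<Sum>T\<in>I. c S * c T * expval G (g S * g T)) = (\<Sum>S\<in>I. \<Sum>T\<in>I. c S * c T * expval G (dag (g S) * g T))"
      using that by (intro sum.cong refl) (auto simp: g_dag)
    also have "\<dots> \<ge> 0"
      using that by (intro psd_gram[OF G]) auto
    finally show ?thesis .
  qed
  have symm: "(\<Sum>S\<in>F. \<Sum>T\<in>F. y S * y T * P S T) = (\<Sum>S\<in>F. \<Sum>T\<in>F. y S * y T * expval G (g S * g T))" for y :: "nat set \<Rightarrow> real"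
  proof -
    have "(\<Sum>S\<in>F. \<Sum>T\<in>F. y S * y T * P S T) = ((\<Sum>S\<in>F. \<Sum>T\<in>F. y S * y T * expval G (g S * g T))
        + (\<Sum>S\<in>F. \<Sum>T\<in>F. y S * y T * expval G (g T * g S))) / 2"
      by (simp add: P_def sum.distrib[symmetric] sum_divide_distrib distrib_left add_divide_distrib)
    also have "(\<Sum>S\<in>F. \<Sum>T\<in>F. y S * y T * expval G (g T * g S)) = (\<Sum>S\<in>F. \<Sum>T\<in>F. y S * y T * expval G (g S * g T))"
      by (subst sum.swap) (simp add: mult.commute mult.left_commute)
    finally show ?thesis by simp
  qed
  have "(\<Sum>S\<in>F. (x S)\<^sup>2) \<le> real (n choose k) * \<tau>\<^sup>2"
  proof (rule certified_gram_bound[where P = P and w = w])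
    show "F = {S. S \<subseteq> {0..<2 * n} \<and> card S = 2 * k}" by (simp add: F_def subsets_m_def)
    show "0 \<le> (\<Sum>S\<in>F. \<Sum>T\<in>F. y S * y T * P S T)" for y
      unfolding symm by (rule gram) (use Fm in auto)
    show "P S S = \<tau>" if "S \<in> F" for S
      using Fm[OF that] by (simp add: P_def g_sq expval_one[OF G] \<tau>_def)
    show "P S T = 0" if "S \<in> F" "T \<in> F" "odd (card (S \<inter> T))" for S T
      using expval_commute_sign[OF GC Fm(1)[OF that(1)] Fm(1)[OF that(2)]] that Fm by (simp add: P_def)
    have "\<tau> \<ge> 0"
      using gram[of "{{}}" "\<lambda>_. 1"] by (simp add: g_empty one_left expval_one[OF G] \<tau>_def)
    then show "0 \<le> \<tau>" .
    define X where "X = (\<Sum>S\<in>F. (x S)\<^sup>2)"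
    define Y where "Y = (\<Sum>S\<in>F. \<Sum>T\<in>F. x S * x T * P S T)"
    \<comment> \<open>Positivity at the vector with entry \<open>\<alpha>\<close> at the empty set,
      where \<open>g {}\<close> is the identity, and \<open>\<beta> * x S\<close> at S.\<close>
    have quad: "0 \<le> \<alpha>\<^sup>2 * \<tau> + 2 * \<alpha> * \<beta> * X + \<beta>\<^sup>2 * Y" for \<alpha> \<beta> :: real
    proof -
      define c where "c S = (if S = {} then \<alpha> else \<beta> * x S)" for S
      have ne: "{} \<notin> F" using Fm(2)[of "{}"] k by auto
      then have cF: "c S = \<beta> * x S" if "S \<in> F" for S using that by (auto simp: c_def)
      have "(\<Sum>S\<in>insert {} F. \<Sum>T\<in>insert {} F. c S * c T * expval G (g S * g T))
        = \<alpha>\<^sup>2 * \<tau> + (\<Sum>T\<in>F. \<alpha> * (\<beta> * x T) * x T) + (\<Sum>S\<in>F. (\<beta> * x S) * \<alpha> * x S)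
          + (\<Sum>S\<in>F. \<Sum>T\<in>F. (\<beta> * x S) * (\<beta> * x T) * expval G (g S * g T))"
      proof -
        have c0: "c {} = \<alpha>" by (simp add: c_def)
        have e: "g {} * g S = g S" "g S * g {} = g S" if "S \<subseteq> modes" for S
          using that by (simp_all add: g_empty one_left one_right)
        have t0: "expval G (g {}) = \<tau>" by (simp add: g_empty expval_one[OF G] \<tau>_def)
        have row: "(\<Sum>T\<in>insert {} F. c S * c T * expval G (g S * g T)) =
            c S * \<alpha> * expval G (g S) + (\<Sum>T\<in>F. c S * (\<beta> * x T) * expval G (g S * g T))" if "S \<subseteq> modes" for S
          using finF ne by (simp add: c0 e[OF that] cF)
        have "(\<Sum>S\<in>insert {} F. \<Sum>T\<in>insert {} F. c S * c T * expval G (g S * g T)) =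
          (\<Sum>S\<in>insert {} F. c S * \<alpha> * expval G (g S) + (\<Sum>T\<in>F. c S * (\<beta> * x T) * expval G (g S * g T)))"
          using Fm by (intro sum.cong refl row) auto
        also have "\<dots> = \<alpha> * \<alpha> * \<tau> + (\<Sum>T\<in>F. \<alpha> * (\<beta> * x T) * x T) + ((\<Sum>S\<in>F. (\<beta> * x S) * \<alpha> * x S)
          + (\<Sum>S\<in>F. \<Sum>T\<in>F. (\<beta> * x S) * (\<beta> * x T) * expval G (g S * g T)))"
          using finF ne Fm by (simp add: c0 t0 e cF sum.distrib x_def)
        finally show ?thesis by (simp add: power2_eq_square)
      qed
      moreover have "\<dots> = \<alpha>\<^sup>2 * \<tau> + 2 * \<alpha> * \<beta> * X + \<beta>\<^sup>2 * Y"
        unfolding X_def Y_def symm by (simp add: sum_distrib_left power2_eq_square mult_ac flip: sum.distrib)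
      moreover have "(\<Sum>S\<in>insert {} F. \<Sum>T\<in>insert {} F. c S * c T * expval G (g S * g T)) \<ge> 0"
        using Fm by (intro gram) auto
      ultimately show ?thesis by simp
    qed
    have "X\<^sup>2 \<le> \<tau> * Y"
    proof (cases "\<tau> = 0")
      case True
      have "X = 0"
      proof (rule ccontr)
        assume "X \<noteq> 0"
        \<comment> \<open>For \<open>\<tau> = 0\<close> the form is linear in
          \<open>\<alpha>\<close>; this choice gives it the value -1.\<close>
        with quad[of "- (Y + 1) / (2 * X)" 1] True show False by (simp add: field_simps)
      qed
      with True show ?thesis by simp
    next
      case False
      with \<open>\<tau> \<ge> 0\<close> have "\<tau> > 0" by simp
      \<comment> \<open>The choice \<open>\<alpha> = - X\<close>, \<open>\<beta> = \<tau>\<close> is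
        the minimiser up to scale, so the form becomes the determinant condition.\<close>
      have "0 \<le> \<tau> * (\<tau> * Y - X\<^sup>2)"
        using quad[of "- X" \<tau>] by (simp add: power2_eq_square algebra_simps)
      with \<open>\<tau> > 0\<close> show ?thesis by (simp add: zero_le_mult_iff)
    qed
    then show "(\<Sum>S\<in>F. (x S)\<^sup>2)\<^sup>2 \<le> \<tau> * (\<Sum>S\<in>F. \<Sum>T\<in>F. x S * x T * P S T)"
      by (simp add: X_def Y_def)
  qed (rule w)
  then show ?thesis by (simp add: x_def F_def \<tau>_def)
qed

lemma psd_trace_nonneg: "is_psd d G \<Longrightarrow> Re (tr G) \<ge> 0"
  using psd_gram[of d G "{()}" "\<lambda>_. 1\<^sub>m d" "\<lambda>_. 1"] by (simp add: expval_one one_left)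

text \<open>Cauchy-Schwarz over all 2k-sets passes from the sum of squared moments to the sum of
  their absolute values.\<close>

lemma eta_star_even_le:
  assumes k: "k \<ge> 1" "k \<le> n"
    and w: "dual_certificate n k w"
  shows "eta_star n \<gamma> (2 * k) \<le> sqrt (real (n choose k) / real ((2 * n) choose (2 * k)))"
proof (rule eta_star_le)
  fix G assume G: "is_psd d G"
  define F where "F = subsets_m n (2*k)"
  define c where "c = real (card F)"
  have c: "c > 0" using k(2) by (simp add: c_def F_def card_subsets_m zero_less_binomial)
  have "(\<Sum>S\<in>F. \<bar>expval G (g S)\<bar>)\<^sup>2 = (\<Sum>S\<in>F. 1 * \<bar>expval G (g S)\<bar>)\<^sup>2" by simp
  also have "\<dots> \<le> (\<Sum>S\<in>F. 1\<^sup>2) * (\<Sum>S\<in>F. \<bar>expval G (g S)\<bar>\<^sup>2)"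
    by (rule Cauchy_Schwarz_ineq_sum)
  also have "\<dots> \<le> c * (real (n choose k) * (Re (tr G))\<^sup>2)"
    using sum_sq_expval_le[OF G k(1) w] c by (simp add: c_def F_def)
  also have "\<dots> = (sqrt (real (n choose k) / c) * c * Re (tr G))\<^sup>2"
    using c by (simp add: power_mult_distrib power2_eq_square[of c])
  finally have "(\<Sum>S\<in>F. \<bar>expval G (g S)\<bar>) \<le> sqrt (real (n choose k) / c) * c * Re (tr G)"
    by (rule power2_le_imp_le) (use c psd_trace_nonneg[OF G] in auto)
  then show "(\<Sum>S\<in>subsets_m n (2 * k). \<bar>expval G (g S)\<bar>)
    \<le> sqrt (real (n choose k) / real ((2 * n) choose (2 * k))) * real (card (subsets_m n (2 * k))) * Re (tr G)"
    by (simp add: F_def c_def card_subsets_m)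
qed (use k in simp)

end

lemma eta_star_even_upper:
  assumes "1 \<le> k" "k \<le> 5"
  shows "\<exists>N. \<forall>n\<ge>N. \<forall>\<gamma>. majorana n \<gamma> \<longrightarrow>
     eta_star n \<gamma> (2 * k) \<le> sqrt (real (n choose k) / real ((2 * n) choose (2 * k)))"
proof -
  obtain N where N: "\<And>n. n \<ge> N \<Longrightarrow> \<exists>w. dual_certificate n k w"
    using dual_certificate_exists[OF assms] unfolding eventually_sequentially by blast
  show ?thesis
  proof (intro exI[of _ "max N k"] allI impI)
    fix n \<gamma> assume n: "max N k \<le> n" and m: "majorana n \<gamma>"
    from N[of n] n obtain w where w: "dual_certificate n k w" by auto
    interpret majorana_system n \<gamma> by unfold_locales (rule m)
    show "eta_star n \<gamma> (2 * k) \<le> sqrt (real (n choose k) / real ((2 * n) choose (2 * k)))"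
      using assms n by (intro eta_star_even_le[OF _ _ w]) auto
  qed
qed

section \<open>Skew conference matrices\<close>

definition skew_conference :: "nat \<Rightarrow> (nat \<Rightarrow> nat \<Rightarrow> int) \<Rightarrow> bool" where
  "skew_conference N A \<longleftrightarrow> (\<forall>a<N. \<forall>b<N. A a b = - A b a) \<and>
     (\<forall>a<N. \<forall>b<N. a \<noteq> b \<longrightarrow> A a b = 1 \<or> A a b = -1) \<and>
     (\<forall>a<N. \<forall>b<N. (\<Sum>c<N. A a c * A b c) = (if a = b then int N - 1 else 0))"

lemma sum_lessThan_double: "(\<Sum>c<N + M. f c) = (\<Sum>c<N. f c) + (\<Sum>c<M. f (N + c))"
  for f :: "nat \<Rightarrow> 'a :: comm_monoid_add"
  by (induction M) (auto simp: add.assoc)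

text \<open>The block matrix with rows (A, A + 1) and (A - 1, -A). Skewness of A makes A - 1 equal
  to minus the transpose of A + 1, the form used below, and makes the rows of A + 1 orthogonal of
  squared norm N.\<close>

lemma skew_conference_double:
  assumes A: "skew_conference N A"
  shows "\<exists>A'. skew_conference (N + N) A'"
proof -
  define D where "D a b = (of_bool (a = b) :: int)" for a b :: nat
  define A' where "A' a b = (if a < N then (if b < N then A a b else A a (b - N) + D a (b - N))
      else (if b < N then - (A b (a - N) + D b (a - N)) else - A (a - N) (b - N)))" for a b
  have anti: "A a b = - A b a" and pm: "a \<noteq> b \<Longrightarrow> A a b = 1 \<or> A a b = -1"
    and orth: "(\<Sum>c<N. A a c * A b c) = (if a = b then int N - 1 else 0)" if "a < N" "b < N" for a b
    using A that unfolding skew_conference_def by blast+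
  have diag: "A a a = 0" if "a < N" for a using anti[OF that that] by simp
  have DD: "(\<Sum>c<N. D a c * f c) = f a" "(\<Sum>c<N. f c * D a c) = f a" if "a < N" for a and f :: "nat \<Rightarrow> int"
    using that by (simp_all add: D_def)
  have Dsym: "D a b = D b a" for a b by (simp add: D_def eq_commute)
  have sq: "(\<Sum>c<N. (A a c + D a c) * (A b c + D b c)) = (if a = b then int N else 0)"
    if "a < N" "b < N" for a b
  proof -
    have "(\<Sum>c<N. (A a c + D a c) * (A b c + D b c)) =
        (\<Sum>c<N. A a c * A b c) + (\<Sum>c<N. A a c * D b c) + (\<Sum>c<N. D a c * A b c) + (\<Sum>c<N. D a c * D b c)"
      by (simp add: sum.distrib algebra_simps)
    also have "\<dots> = (if a = b then int N - 1 else 0) + A a b + A b a + D b a"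
      unfolding orth[OF that] DD(1)[OF that(1)] DD(2)[OF that(2)] ..
    finally show ?thesis using anti[OF that] by (simp add: D_def)
  qed
  have sq': "(\<Sum>c<N. (A c a + D c a) * (A c b + D c b)) = (if a = b then int N else 0)"
    if "a < N" "b < N" for a b
  proof -
    have "(\<Sum>c<N. (A c a + D c a) * (A c b + D c b)) = (\<Sum>c<N. (- A a c + D a c) * (- A b c + D b c))"
    proof (intro sum.cong refl)
      fix c assume "c \<in> {..<N}"
      then show "(A c a + D c a) * (A c b + D c b) = (- A a c + D a c) * (- A b c + D b c)"
        using anti[of c a] anti[of c b] that Dsym[of c a] Dsym[of c b] by simp
    qed
    also have "\<dots> = (\<Sum>c<N. A a c * A b c) - (\<Sum>c<N. A a c * D b c) - (\<Sum>c<N. D a c * A b c) + (\<Sum>c<N. D a c * D b c)"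
      by (simp add: sum.distrib sum_subtractf algebra_simps)
    also have "\<dots> = (if a = b then int N - 1 else 0) - A a b - A b a + D b a"
      unfolding orth[OF that] DD(1)[OF that(1)] DD(2)[OF that(2)] ..
    finally show ?thesis using anti[OF that] by (simp add: D_def)
  qed
  have mixed: "(\<Sum>c<N. A a c * - (A c b + D c b)) + (\<Sum>c<N. (A a c + D a c) * - A b c) = 0"
    if "a < N" "b < N" for a b
  proof -
    have "(\<Sum>c<N. A a c * - (A c b + D c b)) = (\<Sum>c<N. A a c * A b c) - (\<Sum>c<N. A a c * D b c)"
      unfolding sum_subtractf[symmetric]
    proof (intro sum.cong refl)
      fix c assume "c \<in> {..<N}"
      then show "A a c * - (A c b + D c b) = A a c * A b c - A a c * D b c"
        using anti[of c b] that Dsym[of c b] by (simp add: algebra_simps)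
    qed
    moreover have "(\<Sum>c<N. (A a c + D a c) * - A b c) = - (\<Sum>c<N. A a c * A b c) - (\<Sum>c<N. D a c * A b c)"
    proof -
      have "(\<Sum>c<N. (A a c + D a c) * - A b c) = (\<Sum>c<N. - (A a c * A b c) - D a c * A b c)"
        by (rule sum.cong[OF refl]) (simp add: algebra_simps)
      then show ?thesis by (simp only: sum_subtractf sum_negf)
    qed
    ultimately show ?thesis
      unfolding DD(1)[OF that(1)] DD(2)[OF that(2)] using anti[OF that] by linarith
  qed
  have "skew_conference (N + N) A'"
    unfolding skew_conference_def
  proof (intro conjI allI impI)
    fix a b assume ab: "a < N + N" "b < N + N"
    show "A' a b = - A' b a"
      using ab anti[of a b] anti[of "a - N" "b - N"] by (auto simp: A'_def)
    show "A' a b = 1 \<or> A' a b = -1" if "a \<noteq> b"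
    proof -
      have off: "A x y + D x y = 1 \<or> A x y + D x y = -1" if "x < N" "y < N" for x y
        using pm[OF that] diag[OF that(1)] by (cases "x = y") (auto simp: D_def)
      consider "a < N" "b < N" | "a < N" "b \<ge> N" | "a \<ge> N" "b < N" | "a \<ge> N" "b \<ge> N" by linarith
      then show ?thesis
      proof cases
        case 1
        then show ?thesis using pm[of a b] that by (simp add: A'_def)
      next
        case 2
        then show ?thesis using off[of a "b - N"] ab by (simp add: A'_def)
      next
        case 3
        then have "a - N < N" using ab by linarith
        from off[OF 3(2) this] show ?thesis using 3 by (simp add: A'_def) linarith
      next
        case 4
        then show ?thesis using pm[of "a - N" "b - N"] that ab by (auto simp: A'_def)
      qed
    qed
    have s: "(\<Sum>c<N + N. A' a c * A' b c) = (\<Sum>c<N. A' a c * A' b c) + (\<Sum>c<N. A' a (N + c) * A' b (N + c))"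
      by (rule sum_lessThan_double)
    consider "a < N" "b < N" | "a < N" "b \<ge> N" | "a \<ge> N" "b < N" | "a \<ge> N" "b \<ge> N" by linarith
    then show "(\<Sum>c<N + N. A' a c * A' b c) = (if a = b then int (N + N) - 1 else 0)"
    proof cases
      case 1
      then show ?thesis
        unfolding s by (simp add: A'_def orth sq)
    next
      case 2
      then have "b - N < N" "a \<noteq> b" using ab by auto
      with 2 show ?thesis
        unfolding s using mixed[of a "b - N"] by (simp add: A'_def)
    next
      case 3
      then have "a - N < N" "a \<noteq> b" using ab by auto
      with 3 show ?thesis
        unfolding s using mixed[of b "a - N"] by (simp add: A'_def mult.commute)
    next
      case 4
      then have "a - N < N" "b - N < N" "a - N = b - N \<longleftrightarrow> a = b" using ab by auto
      moreover have "(\<Sum>c<N. (- A c x - D c x) * (- A c y - D c y)) = (\<Sum>c<N. (A c x + D c x) * (A c y + D c y))" for x y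
        by (intro sum.cong refl) (simp add: algebra_simps)
      ultimately show ?thesis
        using 4 sq'[of "a - N" "b - N"] orth[of "a - N" "b - N"]
        unfolding s by (simp add: A'_def)
    qed
  qed
  then show ?thesis by blast
qed

lemma skew_conference_power_two: "\<exists>A. skew_conference (2 ^ t) A"
proof (induction t)
  case 0
  have "skew_conference 1 (\<lambda>_ _. 0)" by (simp add: skew_conference_def)
  then show ?case by auto
next
  case (Suc t)
  then show ?case using skew_conference_double[of "2 ^ t"] by (auto simp: mult_2)
qed

section \<open>Complex linear combinations of Majorana operators\<close>

context majorana_system
begin

definition lincomb :: "nat set \<Rightarrow> (nat \<Rightarrow> complex) \<Rightarrow> complex mat" where
  "lincomb B c = mat d d (\<lambda>(x, y). \<Sum>b\<in>B. c b * \<gamma> b $$ (x, y))"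

lemma lincomb_C [simp]: "lincomb B c \<in> C"
  by (simp add: lincomb_def)

lemma lincomb_entry: "x < d \<Longrightarrow> y < d \<Longrightarrow> lincomb B c $$ (x, y) = (\<Sum>b\<in>B. c b * \<gamma> b $$ (x, y))"
  by (simp add: lincomb_def)

lemma dag_lincomb: "B \<subseteq> modes \<Longrightarrow> dag (lincomb B c) = lincomb B (\<lambda>b. cnj (c b))"
proof (rule eq_matI)
  fix i j assume B: "B \<subseteq> modes" and "i < dim_row (lincomb B (\<lambda>b. cnj (c b)))" "j < dim_col (lincomb B (\<lambda>b. cnj (c b)))"
  then have ij: "i < d" "j < d" by (auto simp: lincomb_def)
  have "cnj (\<gamma> b $$ (j, i)) = \<gamma> b $$ (i, j)" if "b \<in> B" for b
  proof -
    have "b < 2 * n" using that B by auto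
    then show ?thesis
      using dag_entry[OF gen_C ij, of b] gen_dag[of b] by simp
  qed
  then show "dag (lincomb B c) $$ (i, j) = lincomb B (\<lambda>b. cnj (c b)) $$ (i, j)"
    unfolding dag_entry[OF lincomb_C ij] lincomb_entry[OF ij] lincomb_entry[OF ij(2,1)] by simp
qed (auto simp: lincomb_def dag_def)

lemma tr_lincomb:
  assumes B: "B \<subseteq> modes" and Y: "Y \<in> C"
  shows "tr (lincomb B c * Y) = (\<Sum>b\<in>B. c b * tr (\<gamma> b * Y))"
proof -
  let ?t = "\<lambda>b x y. c b * (\<gamma> b $$ (x, y) * Y $$ (y, x))"
  have "tr (lincomb B c * Y) = (\<Sum>x<d. \<Sum>y<d. \<Sum>b\<in>B. ?t b x y)"
    unfolding tr_mult[OF lincomb_C Y] by (intro sum.cong refl) (simp add: lincomb_entry sum_distrib_right mult.assoc)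
  also have "\<dots> = (\<Sum>x<d. \<Sum>b\<in>B. \<Sum>y<d. ?t b x y)"
    by (rule sum.cong[OF refl], rule sum.swap)
  also have "\<dots> = (\<Sum>b\<in>B. \<Sum>x<d. \<Sum>y<d. ?t b x y)"
    by (rule sum.swap)
  also have "\<dots> = (\<Sum>b\<in>B. c b * tr (\<gamma> b * Y))"
  proof (rule sum.cong[OF refl])
    fix b assume "b \<in> B"
    then have "\<gamma> b \<in> C" using B by auto
    then show "(\<Sum>x<d. \<Sum>y<d. ?t b x y) = c b * tr (\<gamma> b * Y)"
      by (simp add: tr_mult[OF _ Y] sum_distrib_left)
  qed
  finally show ?thesis .
qed

text \<open>The Clifford relation extends bilinearly, with no conjugation on the right, so complex
  isotropic coefficient vectors produce operators of square zero.\<close>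

lemma lincomb_anticommute:
  assumes B: "B \<subseteq> modes" and x: "x < d" and z: "z < d"
  shows "(lincomb B u * lincomb B v) $$ (x, z) + (lincomb B v * lincomb B u) $$ (x, z) =
     (if x = z then 2 * (\<Sum>b\<in>B. u b * v b) else 0)"
proof -
  have finB: "finite B" using fin_modes[OF B] .
  have prod: "(lincomb B u * lincomb B v) $$ (x, z) = (\<Sum>p\<in>B. \<Sum>q\<in>B. u p * v q * (\<gamma> p * \<gamma> q) $$ (x, z))"
    for u v
  proof -
    let ?t = "\<lambda>p q y. u p * v q * (\<gamma> p $$ (x, y) * \<gamma> q $$ (y, z))"
    have "(lincomb B u * lincomb B v) $$ (x, z) =
        (\<Sum>y<d. \<Sum>p\<in>B. \<Sum>q\<in>B. ?t p q y)"
      unfolding mult_entry[OF lincomb_C lincomb_C x z]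
      by (intro sum.cong refl) (simp add: lincomb_entry x z sum_product mult_ac)
    also have "\<dots> = (\<Sum>p\<in>B. \<Sum>y<d. \<Sum>q\<in>B. ?t p q y)"
      by (rule sum.swap)
    also have "\<dots> = (\<Sum>p\<in>B. \<Sum>q\<in>B. \<Sum>y<d. ?t p q y)"
      by (rule sum.cong[OF refl], rule sum.swap)
    also have "\<dots> = (\<Sum>p\<in>B. \<Sum>q\<in>B. u p * v q * (\<gamma> p * \<gamma> q) $$ (x, z))"
    proof (intro sum.cong refl)
      fix p q assume "p \<in> B" "q \<in> B"
      then have "\<gamma> p \<in> C" "\<gamma> q \<in> C" using B by auto
      then show "(\<Sum>y<d. ?t p q y) = u p * v q * (\<gamma> p * \<gamma> q) $$ (x, z)"
        by (simp add: mult_entry[OF _ _ x z] sum_distrib_left del: index_mult_mat)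
    qed
    finally show ?thesis .
  qed
  have "(lincomb B v * lincomb B u) $$ (x, z) = (\<Sum>p\<in>B. \<Sum>q\<in>B. u p * v q * (\<gamma> q * \<gamma> p) $$ (x, z))"
    unfolding prod by (subst sum.swap) (simp add: mult_ac del: index_mult_mat)
  then have "(lincomb B u * lincomb B v) $$ (x, z) + (lincomb B v * lincomb B u) $$ (x, z) =
      (\<Sum>p\<in>B. \<Sum>q\<in>B. u p * v q * ((\<gamma> p * \<gamma> q) $$ (x, z) + (\<gamma> q * \<gamma> p) $$ (x, z)))"
    unfolding prod[of u v] by (simp add: sum.distrib distrib_left del: index_mult_mat)
  also have "\<dots> = (\<Sum>p\<in>B. \<Sum>q\<in>B. if p = q then (if x = z then 2 * (u p * v q) else 0) else 0)"
  proof (intro sum.cong refl)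
    fix p q assume "p \<in> B" "q \<in> B"
    then have pq: "p < 2 * n" "q < 2 * n" using B by auto
    then have C: "\<gamma> p * \<gamma> q \<in> C" "\<gamma> q * \<gamma> p \<in> C" by auto
    have "(\<gamma> p * \<gamma> q) $$ (x, z) + (\<gamma> q * \<gamma> p) $$ (x, z) = (\<gamma> p * \<gamma> q + \<gamma> q * \<gamma> p) $$ (x, z)"
      using C x z by (simp del: index_mult_mat)
    also have "\<dots> = ((if p = q then 2 else 0) \<cdot>\<^sub>m 1\<^sub>m d) $$ (x, z)" unfolding gen_acomm[OF pq] ..
    finally show "u p * v q * ((\<gamma> p * \<gamma> q) $$ (x, z) + (\<gamma> q * \<gamma> p) $$ (x, z)) =
        (if p = q then (if x = z then 2 * (u p * v q) else 0) else 0)"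
      using x z by (simp del: index_mult_mat)
  qed
  also have "\<dots> = (if x = z then 2 * (\<Sum>b\<in>B. u b * v b) else 0)"
    using finB by (simp add: sum_distrib_left)
  finally show ?thesis .
qed

end

section \<open>Gaussian states and Wick's theorem\<close>

lemma sum_of_bool_mult:
  fixes f :: "'a \<Rightarrow> 'b :: semiring_1"
  assumes "finite B" "a \<in> B"
  shows "(\<Sum>b\<in>B. of_bool (a = b) * f b) = f a"
proof -
  have "(\<Sum>b\<in>B. of_bool (a = b) * f b) = (\<Sum>b\<in>B. if a = b then f b else 0)"
    by (rule sum.cong) auto
  with assms show ?thesis by simp
qed

lemma smult_zero_mat: "(c :: complex) \<cdot>\<^sub>m 0\<^sub>m m k = 0\<^sub>m m k"
  by (rule eq_matI) auto

context majorana_system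
begin

lemma dag_mult_self_nonzero:
  assumes K: "K \<in> C" and "K \<noteq> 0\<^sub>m d d"
  shows "\<exists>r>0. tr (K * dag K) = complex_of_real r"
proof -
  obtain x y where xy: "x < d" "y < d" "K $$ (x, y) \<noteq> 0"
  proof (rule ccontr)
    assume "\<not> thesis"
    with that have "K $$ (x, y) = 0" if "x < d" "y < d" for x y using that by blast
    with K have "K = 0\<^sub>m d d" by (intro eq_matI) auto
    with assms(2) show False by simp
  qed
  have "tr (K * dag K) = (\<Sum>a<d. \<Sum>b<d. complex_of_real ((cmod (K $$ (a, b)))\<^sup>2))"
    unfolding tr_mult[OF K dag_carrier[OF K]]
    by (intro sum.cong refl) (simp add: dag_entry[OF K] complex_norm_square del: of_real_power)
  also have "\<dots> = complex_of_real (\<Sum>a<d. \<Sum>b<d. (cmod (K $$ (a, b)))\<^sup>2)" by simp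
  finally have "tr (K * dag K) = complex_of_real (\<Sum>a<d. \<Sum>b<d. (cmod (K $$ (a, b)))\<^sup>2)" .
  moreover have "(\<Sum>a<d. \<Sum>b<d. (cmod (K $$ (a, b)))\<^sup>2) > 0"
  proof (rule sum_pos2[of _ x])
    show "0 < (\<Sum>b<d. (cmod (K $$ (x, b)))\<^sup>2)"
      using xy by (intro sum_pos2[of _ y]) auto
  qed (use xy in \<open>auto intro: sum_nonneg\<close>)
  ultimately show ?thesis by blast
qed

end

text \<open>The scaling by r makes the matrix orthogonal, hence, being skew, a complex structure on
  the span of B. Odd entries are what later keeps the Pfaffians away from 0.\<close>

locale conference_state = majorana_system +
  fixes B :: "nat set" and A :: "nat \<Rightarrow> nat \<Rightarrow> int" and r :: real
  assumes B: "B \<subseteq> modes" and r: "r > 0"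
    and anti: "\<And>a b. a \<in> B \<Longrightarrow> b \<in> B \<Longrightarrow> A a b = - A b a"
    and odd_A: "\<And>a b. a \<in> B \<Longrightarrow> b \<in> B \<Longrightarrow> a \<noteq> b \<Longrightarrow> odd (A a b)"
    and orth: "\<And>a b. a \<in> B \<Longrightarrow> b \<in> B \<Longrightarrow> (\<Sum>c\<in>B. (r * A a c) * (r * A b c)) = (if a = b then 1 else 0)"
begin

definition J :: "nat \<Rightarrow> nat \<Rightarrow> real" where "J a b = r * A a b"

text \<open>The coefficients of an annihilation operator of the complex structure \<open>J\<close>: the rows of
  \<open>1 - \<i> J\<close> span an isotropic subspace because \<open>J J\<^sup>T = 1\<close> and \<open>J\<close> is skew.\<close>

definition coeff :: "nat \<Rightarrow> nat \<Rightarrow> complex" where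
  "coeff a b = of_bool (a = b) - \<i> * J a b"

definition annih :: "nat \<Rightarrow> complex mat" where "annih a = lincomb B (coeff a)"

lemma annih_C [simp]: "annih a \<in> C" by (simp add: annih_def)

lemma annih_dim [simp]: "dim_row (annih a) = d" "dim_col (annih a) = d"
  using carrier_matD[OF annih_C] by auto

lemma finB: "finite B" using fin_modes[OF B] .

lemma coeff_isotropic:
  assumes "a \<in> B" "b \<in> B"
  shows "(\<Sum>c\<in>B. coeff a c * coeff b c) = 0"
proof -
  have "(\<Sum>c\<in>B. coeff a c * coeff b c) =
     (\<Sum>c\<in>B. of_bool (a = c) * of_bool (b = c)) - \<i> * (\<Sum>c\<in>B. of_bool (a = c) * complex_of_real (J b c))
       - \<i> * (\<Sum>c\<in>B. of_bool (b = c) * complex_of_real (J a c)) - complex_of_real (\<Sum>c\<in>B. J a c * J b c)"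
    by (simp add: coeff_def sum.distrib sum_subtractf sum_distrib_left algebra_simps)
  also have "(\<Sum>c\<in>B. of_bool (a = c) * complex_of_real (J b c)) = J b a"
    using assms by (intro sum_of_bool_mult finB)
  also have "(\<Sum>c\<in>B. of_bool (b = c) * complex_of_real (J a c)) = J a b"
    using assms by (intro sum_of_bool_mult finB)
  also have "(\<Sum>c\<in>B. of_bool (a = c) * of_bool (b = c)) = (of_bool (a = b) :: complex)"
    using sum_of_bool_mult[OF finB assms(1), of "\<lambda>c. of_bool (b = c)"] by (simp add: eq_commute)
  also have "(\<Sum>c\<in>B. J a c * J b c) = (if a = b then 1 else 0)"
    unfolding J_def by (rule orth[OF assms])
  also have "J b a = - J a b" using anti[OF assms] by (simp add: J_def)
  finally show ?thesis by simp
qed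

lemma annih_anticommute:
  assumes "a \<in> B" "b \<in> B"
  shows "annih a * annih b = (-1) \<cdot>\<^sub>m (annih b * annih a)"
proof (rule eq_matI)
  fix x z assume "x < dim_row ((-1) \<cdot>\<^sub>m (annih b * annih a))" "z < dim_col ((-1) \<cdot>\<^sub>m (annih b * annih a))"
  then have xz: "x < d" "z < d" using annih_C[of a] annih_C[of b] by auto
  have C: "annih b * annih a \<in> C" by simp
  have "(annih a * annih b) $$ (x, z) + (annih b * annih a) $$ (x, z) = 0"
    unfolding annih_def lincomb_anticommute[OF B xz] coeff_isotropic[OF assms] by simp
  then show "(annih a * annih b) $$ (x, z) = ((-1) \<cdot>\<^sub>m (annih b * annih a)) $$ (x, z)"
    using carrier_matD[OF C] xz by (simp add: add_eq_0_iff2 del: index_mult_mat)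
qed auto

lemma annih_square: assumes "a \<in> B" shows "annih a * annih a = 0\<^sub>m d d"
proof (rule eq_matI)
  fix x z assume "x < dim_row (0\<^sub>m d d :: complex mat)" "z < dim_col (0\<^sub>m d d :: complex mat)"
  then have xz: "x < d" "z < d" by auto
  have "(annih a * annih a) $$ (x, z) + (annih a * annih a) $$ (x, z) = 0"
    unfolding annih_def lincomb_anticommute[OF B xz] coeff_isotropic[OF assms assms] by simp
  then show "(annih a * annih a) $$ (x, z) = 0\<^sub>m d d $$ (x, z)" using xz by (simp del: index_mult_mat)
qed auto

text \<open>Start from the identity and multiply on the left by each annihilator that does not yet
  kill K. The product is nonzero by that very case distinction, is killed by the new annihilator
  because its square is 0, and stays killed by the old ones because they anticommute.\<close>

lemma vacuum_exists:
  assumes "set as \<subseteq> B"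
  shows "\<exists>K\<in>C. K \<noteq> 0\<^sub>m d d \<and> (\<forall>a\<in>set as. annih a * K = 0\<^sub>m d d)"
  using assms
proof (induction as)
  case Nil
  have "(1\<^sub>m d :: complex mat) $$ (0, 0) \<noteq> 0\<^sub>m d d $$ (0, 0)" by simp
  then have "(1\<^sub>m d :: complex mat) \<noteq> 0\<^sub>m d d" by metis
  then show ?case by (intro bexI[of _ "1\<^sub>m d"]) auto
next
  case (Cons a as)
  then obtain K where K: "K \<in> C" "K \<noteq> 0\<^sub>m d d" and ann: "\<And>b. b \<in> set as \<Longrightarrow> annih b * K = 0\<^sub>m d d"
    by auto
  show ?case
  proof (cases "annih a * K = 0\<^sub>m d d")
    case True
    with K ann show ?thesis by (intro bexI[of _ K]) auto
  next
    case False
    have "annih b * (annih a * K) = 0\<^sub>m d d" if "b \<in> set (a # as)" for b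
    proof (cases "b = a")
      case True
      have "annih a * (annih a * K) = (annih a * annih a) * K" using K by (simp add: assoc)
      also have "\<dots> = 0\<^sub>m d d" using Cons.prems K by (simp add: annih_square)
      finally show ?thesis using True by simp
    next
      case False
      have "annih b * (annih a * K) = (annih b * annih a) * K" using K by (simp add: assoc)
      also have "annih b * annih a = (-1) \<cdot>\<^sub>m (annih a * annih b)"
        using Cons.prems that by (intro annih_anticommute) auto
      also have "(-1) \<cdot>\<^sub>m (annih a * annih b) * K = (-1) \<cdot>\<^sub>m (annih a * (annih b * K))"
        using K by (simp add: mat_simps)
      also have "\<dots> = 0\<^sub>m d d"
        using ann[of b] that False by (simp add: right_mult_zero_mat[OF annih_C] smult_zero_mat)
      finally show ?thesis .
    qed
    with K False show ?thesis by (intro bexI[of _ "annih a * K"]) auto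
  qed
qed

text \<open>A matrix instead of a vector: its columns are joint null vectors of the annihilators,
  and \<open>vac * dag vac\<close> is an unnormalised, possibly mixed state.\<close>

definition vac :: "complex mat" where
  "vac = (SOME K. K \<in> C \<and> K \<noteq> 0\<^sub>m d d \<and> (\<forall>a\<in>B. annih a * K = 0\<^sub>m d d))"

lemma vac: "vac \<in> C" "vac \<noteq> 0\<^sub>m d d" "a \<in> B \<Longrightarrow> annih a * vac = 0\<^sub>m d d"
proof -
  have "\<exists>K. K \<in> C \<and> K \<noteq> 0\<^sub>m d d \<and> (\<forall>a\<in>B. annih a * K = 0\<^sub>m d d)"
    using vacuum_exists[of "sorted_list_of_set B"] finB by auto
  from someI_ex[OF this] show "vac \<in> C" "vac \<noteq> 0\<^sub>m d d" "a \<in> B \<Longrightarrow> annih a * vac = 0\<^sub>m d d"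
    unfolding vac_def by auto
qed

definition omega :: "complex mat \<Rightarrow> complex" where
  "omega X = tr (X * (vac * dag vac))"

lemma omega_smult: "X \<in> C \<Longrightarrow> omega (c \<cdot>\<^sub>m X) = c * omega X"
  using vac(1) by (simp add: omega_def smult_left tr_smult[of _ d])

text \<open>The annihilator acts on the left of the state and reaches the right end of X by
  cyclicity of the trace.\<close>

lemma omega_right:
  assumes X: "X \<in> C" and a: "a \<in> B"
  shows "omega (X * \<gamma> a) = \<i> * (\<Sum>b\<in>B. J a b * omega (X * \<gamma> b))"
proof -
  define \<rho> where "\<rho> = vac * dag vac"
  have \<rho>: "\<rho> \<in> C" using vac(1) by (simp add: \<rho>_def)
  have "annih a * (\<rho> * X) = (annih a * vac) * (dag vac * X)"
    using vac(1) X by (simp add: \<rho>_def assoc)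
  then have "tr (annih a * (\<rho> * X)) = 0"
    using vac(3)[OF a] vac(1) X left_mult_zero_mat[OF mult_C[OF dag_carrier[OF vac(1)] X], of d] by (simp add: tr_def)
  then have "0 = (\<Sum>b\<in>B. coeff a b * tr (\<gamma> b * (\<rho> * X)))"
    unfolding annih_def using tr_lincomb[OF B, of "\<rho> * X" "coeff a"] \<rho> X by simp
  also have "\<dots> = (\<Sum>b\<in>B. coeff a b * omega (X * \<gamma> b))"
  proof (intro sum.cong refl arg_cong2[where f = "(*)"])
    fix b assume "b \<in> B"
    then have g: "\<gamma> b \<in> C" using B by auto
    have "tr (\<gamma> b * (\<rho> * X)) = tr ((\<gamma> b * \<rho>) * X)" using g \<rho> X by (simp add: assoc)
    also have "\<dots> = tr (X * (\<gamma> b * \<rho>))" using g \<rho> X by (intro tr_commute[of _ d]) auto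
    also have "\<dots> = omega (X * \<gamma> b)" using g \<rho> X by (simp add: omega_def assoc \<rho>_def[symmetric])
    finally show "tr (\<gamma> b * (\<rho> * X)) = omega (X * \<gamma> b)" .
  qed
  also have "\<dots> = (\<Sum>b\<in>B. of_bool (a = b) * omega (X * \<gamma> b)) - \<i> * (\<Sum>b\<in>B. J a b * omega (X * \<gamma> b))"
    by (simp add: coeff_def left_diff_distrib sum_subtractf sum_distrib_left mult.assoc)
  also have "(\<Sum>b\<in>B. of_bool (a = b) * omega (X * \<gamma> b)) = omega (X * \<gamma> a)"
    by (rule sum_of_bool_mult[OF finB a])
  finally show ?thesis by simp
qed

text \<open>The adjoint relation, with the annihilator on the right of the state. Conjugated
  coefficients reverse the sign of the J term relative to \<open>omega_right\<close>, which makes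
  the two relations independent.\<close>

lemma omega_left:
  assumes X: "X \<in> C" and a: "a \<in> B"
  shows "omega (\<gamma> a * X) = - \<i> * (\<Sum>b\<in>B. J a b * omega (\<gamma> b * X))"
proof -
  define \<rho> where "\<rho> = vac * dag vac"
  have \<rho>: "\<rho> \<in> C" using vac(1) by (simp add: \<rho>_def)
  define ad where "ad = lincomb B (\<lambda>b. cnj (coeff a b))"
  have ad: "ad = dag (annih a)" unfolding ad_def annih_def dag_lincomb[OF B] ..
  have "dag vac * ad = dag (annih a * vac)" unfolding ad using vac(1) by (simp add: dag_mult[of _ d])
  also have "\<dots> = 0\<^sub>m d d" unfolding vac(3)[OF a] by (intro eq_matI) (auto simp: dag_def)
  finally have z: "dag vac * ad = 0\<^sub>m d d" .
  have adC: "ad \<in> C" by (simp add: ad_def)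
  have "tr (ad * (X * \<rho>)) = tr ((X * \<rho>) * ad)"
    using adC X \<rho> by (intro tr_commute[of _ d]) auto
  also have "(X * \<rho>) * ad = X * vac * (dag vac * ad)"
    using vac(1) X adC by (simp add: \<rho>_def assoc)
  also have "\<dots> = 0\<^sub>m d d" unfolding z using X vac(1) by simp
  finally have "tr (ad * (X * \<rho>)) = 0" by (simp add: tr_def)
  then have "0 = (\<Sum>b\<in>B. cnj (coeff a b) * tr (\<gamma> b * (X * \<rho>)))"
    unfolding ad_def using tr_lincomb[OF B, of "X * \<rho>"] \<rho> X by simp
  also have "\<dots> = (\<Sum>b\<in>B. cnj (coeff a b) * omega (\<gamma> b * X))"
  proof (intro sum.cong refl arg_cong2[where f = "(*)"])
    fix b assume "b \<in> B"
    then have g: "\<gamma> b \<in> C" using B by auto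
    show "tr (\<gamma> b * (X * \<rho>)) = omega (\<gamma> b * X)" using g \<rho> X by (simp add: omega_def assoc \<rho>_def[symmetric])
  qed
  also have "\<dots> = (\<Sum>b\<in>B. of_bool (a = b) * omega (\<gamma> b * X)) + \<i> * (\<Sum>b\<in>B. J a b * omega (\<gamma> b * X))"
  proof -
    have "cnj (coeff a b) = of_bool (a = b) + \<i> * J a b" for b
      by (cases "a = b") (simp_all add: coeff_def)
    then show ?thesis by (simp add: distrib_right sum.distrib sum_distrib_left mult.assoc)
  qed
  also have "(\<Sum>b\<in>B. of_bool (a = b) * omega (\<gamma> b * X)) = omega (\<gamma> a * X)"
    by (rule sum_of_bool_mult[OF finB a])
  finally show ?thesis by (simp add: add_eq_0_iff)
qed

text \<open>Wick's theorem in the form needed here: up to the scale \<open>(-\<i> r)^k\<close> a \<open>2k\<close>-point function is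
  the Pfaffian of a \<open>\<plusminus>1\<close> matrix, a signed sum of \<open>(2k-1)!!\<close> units and hence an odd integer.\<close>

lemma omega_word_odd:
  assumes "set xs \<subseteq> B" "distinct xs" "length xs = 2 * k"
  shows "\<exists>z::int. odd z \<and> omega (word xs) = (- \<i> * r) ^ k * of_int z * omega (1\<^sub>m d)"
  using assms
proof (induction k arbitrary: xs)
  case 0
  then show ?case by (intro exI[of _ 1]) simp
next
  case (Suc k)
  then obtain a ys where xs: "xs = a # ys" by (cases xs) auto
  have ys: "set ys \<subseteq> B" "distinct ys" "length ys = 2 * k + 1" "a \<notin> set ys" and a: "a \<in> B"
    using Suc.prems by (auto simp: xs)
  have m: "set ys \<subseteq> modes" "a < 2 * n" using ys a B by auto
  define W where "W = word ys"
  have W: "W \<in> C" using m by (simp add: W_def)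
  have odd_len: "odd (length ys)" using ys by simp
  have gB: "b < 2 * n" "\<gamma> b \<in> C" if "b \<in> B" for b using that B by auto
  \<comment> \<open>The word has odd length, so a generator commutes with it if it occurs in the
    word and anticommutes otherwise.\<close>
  have swap: "omega (\<gamma> b * W) = (if b \<in> set ys then 1 else -1) * omega (W * \<gamma> b)" if "b \<in> B" for b
    using gen_word_commute[OF gB(1)[OF that] m(1) ys(2)] odd_len W gB(2)[OF that]
    by (auto simp: W_def[symmetric] omega_smult)
  have "omega (\<gamma> a * W) = - \<i> * (\<Sum>b\<in>B. J a b * omega (\<gamma> b * W))"
    by (rule omega_left[OF W a])
  moreover have "omega (\<gamma> a * W) = - \<i> * (\<Sum>b\<in>B. J a b * omega (W * \<gamma> b))"
    using omega_right[OF W a] swap[OF a] ys(4) by simp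
  \<comment> \<open>Adding the left and the right relation cancels every b outside the word and
    doubles every b in it; what remains is the expansion of a Pfaffian along its first row.\<close>
  ultimately have "2 * omega (\<gamma> a * W) = - \<i> * (\<Sum>b\<in>B. J a b * (omega (\<gamma> b * W) + omega (W * \<gamma> b)))"
    by (simp add: distrib_left sum.distrib)
  also have "(\<Sum>b\<in>B. J a b * (omega (\<gamma> b * W) + omega (W * \<gamma> b))) =
      (\<Sum>b\<in>set ys. J a b * (omega (\<gamma> b * W) + omega (W * \<gamma> b)))"
    using finB ys(1) by (intro sum.mono_neutral_right) (auto simp: swap)
  also have "\<dots> = (\<Sum>b\<in>set ys. 2 * (J a b * omega (\<gamma> b * W)))"
    using ys(1) by (intro sum.cong refl) (auto simp: swap)
  also have "\<dots> = 2 * (\<Sum>b\<in>set ys. J a b * omega (\<gamma> b * W))"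
    by (rule sum_distrib_left[symmetric])
  also have "- \<i> * (2 * (\<Sum>b\<in>set ys. J a b * omega (\<gamma> b * W))) = 2 * (- \<i> * (\<Sum>b\<in>set ys. J a b * omega (\<gamma> b * W)))"
    by (rule mult.left_commute)
  finally have rec: "omega (\<gamma> a * W) = - \<i> * (\<Sum>b\<in>set ys. J a b * omega (\<gamma> b * W))"
    by (rule mult_left_cancel[THEN iffD1, rotated]) simp
  have "\<exists>z::int. odd z \<and> J a b * omega (\<gamma> b * W) = r * ((- \<i> * r) ^ k * of_int z * omega (1\<^sub>m d))"
    if b: "b \<in> set ys" for b
  proof -
    obtain us vs where sp: "ys = us @ b # vs" using b by (meson split_list)
    have uv: "set (us @ vs) \<subseteq> B" "distinct (us @ vs)" "length (us @ vs) = 2 * k"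
      using ys by (auto simp: sp)
    from Suc.IH[OF uv] obtain z :: int where z: "odd z"
      "omega (word (us @ vs)) = (- \<i> * r) ^ k * of_int z * omega (1\<^sub>m d)" by blast
    have mv: "set (us @ vs) \<subseteq> modes" using uv B by blast
    have bB: "b \<in> B" using b ys by auto
    have "\<gamma> b * W = (-1) ^ length us \<cdot>\<^sub>m word (us @ vs)"
      unfolding W_def sp using ys(2) sp by (intro gen_cancel_left[OF gB(1)[OF bB] mv]) auto
    then have "omega (\<gamma> b * W) = (-1) ^ length us * omega (word (us @ vs))"
      using word_C[OF mv] by (simp add: omega_smult)
    then have "J a b * omega (\<gamma> b * W) = r * ((- \<i> * r) ^ k * of_int (A a b * (-1) ^ length us * z) * omega (1\<^sub>m d))"
      unfolding z(2) by (simp add: J_def mult_ac)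
    moreover have "odd (A a b * (-1) ^ length us * z)"
      using odd_A[OF a bB] z(1) b ys(4) by auto
    ultimately show ?thesis by blast
  qed
  then obtain z :: "nat \<Rightarrow> int" where z: "\<And>b. b \<in> set ys \<Longrightarrow> odd (z b)"
    "\<And>b. b \<in> set ys \<Longrightarrow> J a b * omega (\<gamma> b * W) = r * ((- \<i> * r) ^ k * of_int (z b) * omega (1\<^sub>m d))"
    using bchoice[of "set ys" "\<lambda>b z. odd z \<and> J a b * omega (\<gamma> b * W) = r * ((- \<i> * r) ^ k * of_int (z :: int) * omega (1\<^sub>m d))"]
    by blast
  have "omega (\<gamma> a * W) = - \<i> * (\<Sum>b\<in>set ys. r * ((- \<i> * r) ^ k * of_int (z b) * omega (1\<^sub>m d)))"
    unfolding rec by (simp add: z(2))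
  also have "\<dots> = (- \<i> * r) ^ Suc k * of_int (\<Sum>b\<in>set ys. z b) * omega (1\<^sub>m d)"
    by (simp add: sum_distrib_left sum_distrib_right sum_negf mult_ac)
  finally have "omega (word xs) = (- \<i> * r) ^ Suc k * of_int (\<Sum>b\<in>set ys. z b) * omega (1\<^sub>m d)"
    by (simp add: xs W_def)
  moreover have "odd (\<Sum>b\<in>set ys. z b)"
  proof -
    \<comment> \<open>The sum has \<open>2 * k + 1\<close> summands, all odd, so it is odd.\<close>
    have "{b \<in> set ys. odd (z b)} = set ys" using z(1) by auto
    then show ?thesis using ys by (simp add: even_sum_iff distinct_card)
  qed
  ultimately show ?case by blast
qed

text \<open>After normalisation a 2k-point moment has modulus \<open>r ^ k\<close> times that of an
  odd integer, which is at least 1.\<close>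

lemma state_exists:
  "\<exists>K\<in>C. tr (K * dag K) = 1 \<and>
     (\<forall>S k. S \<subseteq> B \<longrightarrow> card S = 2 * k \<longrightarrow> r ^ k \<le> \<bar>expval (g S) (K * dag K)\<bar>)"
proof -
  obtain q where q: "q > 0" "tr (vac * dag vac) = complex_of_real q"
    using dag_mult_self_nonzero[OF vac(1,2)] by blast
  define K where "K = complex_of_real (1 / sqrt q) \<cdot>\<^sub>m vac"
  have K: "K \<in> C" using vac(1) by (simp add: K_def)
  define s where "s = complex_of_real (1 / sqrt q)"
  have "1 / sqrt q * (1 / sqrt q) = 1 / q" using q by simp
  then have ss: "s * s = complex_of_real (1 / q)"
    unfolding s_def of_real_mult[symmetric] by (rule arg_cong)
  have "cnj s = s" by (simp add: s_def)
  then have "K * dag K = (s * s) \<cdot>\<^sub>m (vac * dag vac)"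
    unfolding K_def s_def[symmetric] dag_smult[OF vac(1)]
    using vac(1) by (simp add: smult_left smult_right smult_smult_mat)
  then have KK: "K * dag K = complex_of_real (1 / q) \<cdot>\<^sub>m (vac * dag vac)"
    unfolding ss .
  have "tr (K * dag K) = 1"
    unfolding KK using vac(1) q by (simp add: tr_smult[of _ d])
  moreover have "r ^ k \<le> \<bar>expval (g S) (K * dag K)\<bar>" if S: "S \<subseteq> B" and k: "card S = 2 * k" for S k
  proof -
    have Sm: "S \<subseteq> modes" using S B by auto
    have fS: "finite S" using Sm fin_modes by blast
    define xs where "xs = sorted_list_of_set S"
    have xs: "set xs \<subseteq> B" "distinct xs" "length xs = 2 * k" "set xs \<subseteq> modes"
      using S k fS Sm by (auto simp: xs_def)
    obtain z :: int where z: "odd z" "omega (word xs) = (- \<i> * r) ^ k * of_int z * omega (1\<^sub>m d)"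
      using omega_word_odd[OF xs(1-3)] by blast
    have o1: "omega (1\<^sub>m d) = complex_of_real q"
      using q vac(1) by (simp add: omega_def one_left)
    have C: "g S \<in> C" "vac * dag vac \<in> C" using Sm vac(1) by auto
    have "tr (g S * (K * dag K)) = complex_of_real (1 / q) * omega (g S)"
      unfolding KK omega_def using C by (simp add: smult_right tr_smult[of _ d])
    also have "omega (g S) = \<i> ^ (card S choose 2) * omega (word xs)"
      unfolding g_word xs_def[symmetric] by (rule omega_smult[OF word_C[OF xs(4)]])
    finally have "cmod (tr (g S * (K * dag K))) = r ^ k * \<bar>real_of_int z\<bar>"
      unfolding z(2) o1 using q r by (simp add: norm_mult norm_power norm_divide)
    moreover have "\<bar>real_of_int z\<bar> \<ge> 1"
      using z(1) by (cases "z = 0") auto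
    moreover have "cmod (tr (g S * (K * dag K))) = \<bar>expval (g S) (K * dag K)\<bar>"
      unfolding expval_state_real[OF Sm K, symmetric] by simp
    moreover have "r ^ k \<ge> 0" using r by simp
    ultimately show ?thesis
      using mult_left_mono[of 1 "\<bar>real_of_int z\<bar>" "r ^ k"] by simp
  qed
  ultimately show ?thesis using K by blast
qed

end

section \<open>Lower bounds from conference matrices\<close>

context majorana_system
begin

lemma conference_state_exists:
  assumes A: "skew_conference N A" and N: "2 \<le> N" and B: "B \<subseteq> modes" "card B = N"
  shows "\<exists>K\<in>C. tr (K * dag K) = 1 \<and>
     (\<forall>S k. S \<subseteq> B \<longrightarrow> card S = 2 * k \<longrightarrow> (1 / sqrt (real N - 1)) ^ k \<le> \<bar>expval (g S) (K * dag K)\<bar>)"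
proof -
  obtain f where f: "bij_betw f B {0..<N}"
    using ex_bij_betw_finite_nat[OF fin_modes[OF B(1)]] B(2) by auto
  have fN: "f a < N" if "a \<in> B" for a using bij_betwE[OF f] that by auto
  have finj: "f a = f b \<longleftrightarrow> a = b" if "a \<in> B" "b \<in> B" for a b
    using f that by (auto simp: bij_betw_def inj_on_def)
  define r where "r = 1 / sqrt (real N - 1)"
  have N1: "real N - 1 > 0" using N by simp
  have rr: "r * r = 1 / (real N - 1)" using N1 by (simp add: r_def)
  interpret conference_state n \<gamma> B "\<lambda>a b. A (f a) (f b)" r
  proof unfold_locales
    show "B \<subseteq> modes" by (rule B)
    show "r > 0" using N1 by (simp add: r_def)
    fix a b assume ab: "a \<in> B" "b \<in> B"
    show "A (f a) (f b) = - A (f b) (f a)"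
      using A fN[OF ab(1)] fN[OF ab(2)] unfolding skew_conference_def by blast
    show "odd (A (f a) (f b))" if "a \<noteq> b"
    proof -
      have "A (f a) (f b) = 1 \<or> A (f a) (f b) = -1"
        using A fN[OF ab(1)] fN[OF ab(2)] finj[OF ab] that unfolding skew_conference_def by blast
      then show ?thesis by auto
    qed
    have "(\<Sum>c\<in>B. A (f a) (f c) * A (f b) (f c)) = (\<Sum>c\<in>{0..<N}. A (f a) c * A (f b) c)"
      by (rule sum.reindex_bij_betw[OF f])
    also have "\<dots> = (if f a = f b then int N - 1 else 0)"
      using A fN[OF ab(1)] fN[OF ab(2)] unfolding skew_conference_def atLeast0LessThan by blast
    finally have s: "(\<Sum>c\<in>B. A (f a) (f c) * A (f b) (f c)) = (if a = b then int N - 1 else 0)"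
      using finj[OF ab] by simp
    have "(\<Sum>c\<in>B. (r * A (f a) (f c)) * (r * A (f b) (f c))) = r * r * real_of_int (\<Sum>c\<in>B. A (f a) (f c) * A (f b) (f c))"
      by (simp add: sum_distrib_left mult_ac)
    also have "\<dots> = (if a = b then 1 else 0)"
      unfolding s rr using N1 by simp
    finally show "(\<Sum>c\<in>B. (r * A (f a) (f c)) * (r * A (f b) (f c))) = (if a = b then 1 else 0)" .
  qed
  show ?thesis using state_exists unfolding r_def .
qed

text \<open>Take one Gaussian state for every N-set B of modes. The sets B containing S contribute
  at least the Pfaffian bound and the others at least 0; the ratio of binomials is the probability
  that a random B contains S. For N = 2n it equals 1, which yields the sharp value in degree
  two.\<close>

lemma eta_star_conference_lower:
  assumes A: "skew_conference N A" and N: "2 \<le> N" "N \<le> 2 * n" and k: "2 * k \<le> N"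
  shows "real ((2 * n - 2 * k) choose (N - 2 * k)) / real ((2 * n) choose N) * (1 / sqrt (real N - 1)) ^ k
      \<le> eta_star n \<gamma> (2 * k)"
proof -
  define r where "r = 1 / sqrt (real N - 1)"
  define T where "T = {B. B \<subseteq> modes \<and> card B = N}"
  have finT: "finite T" by (rule finite_subset[of _ "Pow modes"]) (auto simp: T_def)
  have cardT: "card T = (2 * n) choose N" unfolding T_def by (subst n_subsets) auto
  have Tpos: "card T > 0" unfolding cardT using N by (simp add: zero_less_binomial)
  have "\<forall>B\<in>T. \<exists>K. K \<in> C \<and> tr (K * dag K) = 1 \<and>
     (\<forall>S k. S \<subseteq> B \<longrightarrow> card S = 2 * k \<longrightarrow> r ^ k \<le> \<bar>expval (g S) (K * dag K)\<bar>)"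
    using conference_state_exists[OF A N(1)] unfolding T_def r_def by blast
  from bchoice[OF this] obtain K where K: "\<forall>B\<in>T. K B \<in> C \<and> tr (K B * dag (K B)) = 1 \<and>
     (\<forall>S k. S \<subseteq> B \<longrightarrow> card S = 2 * k \<longrightarrow> r ^ k \<le> \<bar>expval (g S) (K B * dag (K B))\<bar>)" by blast
  have r01: "0 \<le> r" "r \<le> 1" using N(1) by (auto simp: r_def)
  have count: "card {B \<in> T. S \<subseteq> B} = (2 * n - 2 * k) choose (N - 2 * k)" if S: "S \<subseteq> modes" "card S = 2 * k" for S
  proof -
    have fS: "finite S" using fin_modes[OF S(1)] .
    have "bij_betw (\<lambda>D. S \<union> D) {D. D \<subseteq> modes - S \<and> card D = N - 2 * k} {B \<in> T. S \<subseteq> B}"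
    proof (rule bij_betw_byWitness[where f' = "\<lambda>B. B - S"])
      show "(\<lambda>D. S \<union> D) ` {D. D \<subseteq> modes - S \<and> card D = N - 2 * k} \<subseteq> {B \<in> T. S \<subseteq> B}"
      proof
        fix B assume "B \<in> (\<lambda>D. S \<union> D) ` {D. D \<subseteq> modes - S \<and> card D = N - 2 * k}"
        then obtain D where D: "B = S \<union> D" "D \<subseteq> modes - S" "card D = N - 2 * k" by auto
        have "finite D" using D(2) fin_modes[of D] by blast
        then have "card (S \<union> D) = N" using D fS S k by (subst card_Un_disjoint) auto
        with D S show "B \<in> {B \<in> T. S \<subseteq> B}" by (auto simp: T_def)
      qed
      show "(\<lambda>B. B - S) ` {B \<in> T. S \<subseteq> B} \<subseteq> {D. D \<subseteq> modes - S \<and> card D = N - 2 * k}"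
        using S fS by (auto simp: T_def card_Diff_subset)
    qed auto
    then have "card {B \<in> T. S \<subseteq> B} = card {D. D \<subseteq> modes - S \<and> card D = N - 2 * k}"
      by (simp add: bij_betw_same_card)
    also have "\<dots> = card (modes - S) choose (N - 2 * k)" by (rule n_subsets) simp
    also have "card (modes - S) = 2 * n - 2 * k" using S fS by (simp add: card_Diff_subset)
    finally show ?thesis .
  qed
  define c where "c = (2 * n - 2 * k) choose (N - 2 * k)"
  define \<eta> where "\<eta> = real c / real (card T) * r ^ k"
  have cT: "c \<le> card T"
  proof -
    have "{0..<2*k} \<subseteq> modes" "card {0..<2*k} = 2 * k" using k N by auto
    from count[OF this] show ?thesis
      unfolding c_def using card_mono[OF finT, of "{B \<in> T. {0..<2*k} \<subseteq> B}"] by auto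
  qed
  have "compatible (2 * k) \<eta>"
  proof (rule jointly_measurable_lower[where T = T and K = K])
    show "T \<noteq> {}" using Tpos by auto
    show "0 \<le> \<eta>" using r01 by (simp add: \<eta>_def)
    fix S assume "S \<in> subsets_m n (2 * k)"
    then have S: "S \<subseteq> modes" "card S = 2 * k" by (auto simp: subsets_m_iff)
    have "\<eta> * real (card T) = (\<Sum>B\<in>{B \<in> T. S \<subseteq> B}. r ^ k)"
      using Tpos by (simp add: \<eta>_def count[OF S] c_def)
    also have "\<dots> \<le> (\<Sum>B\<in>{B \<in> T. S \<subseteq> B}. \<bar>expval (g S) (K B * dag (K B))\<bar>)"
      using K S by (intro sum_mono) auto
    also have "\<dots> \<le> (\<Sum>B\<in>T. \<bar>expval (g S) (K B * dag (K B))\<bar>)"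
      using finT by (intro sum_mono2) auto
    finally show "\<eta> * real (card T) \<le> (\<Sum>B\<in>T. \<bar>expval (g S) (K B * dag (K B))\<bar>)" .
  qed (use K finT in auto)
  moreover have "0 \<le> \<eta>" "\<eta> \<le> 1"
  proof -
    show "0 \<le> \<eta>" using r01 by (simp add: \<eta>_def)
    have "real c / real (card T) * r ^ k \<le> 1 * 1"
      using cT Tpos r01 by (intro mult_mono power_le_one) (auto simp: divide_le_eq)
    then show "\<eta> \<le> 1" by (simp add: \<eta>_def)
  qed
  ultimately have "\<eta> \<le> eta_star n \<gamma> (2 * k)" by (intro eta_star_ge)
  then show ?thesis by (simp add: \<eta>_def c_def cardT r_def)
qed

lemma eta_star_lower:
  assumes k: "k \<ge> 1" and n: "n \<ge> 2 * k"
  shows "(1 / (4 * real k)) ^ (2 * k) * (1 / sqrt (2 * real n)) ^ k \<le> eta_star n \<gamma> (2 * k)"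
proof -
  \<comment> \<open>The largest power of two up to 2n also exceeds n, which keeps the probability of
    containing a given 2k-set bounded below.\<close>
  obtain t where t: "2 ^ t \<le> 2 * n" "2 * n < 2 ^ (t + 1)"
    using ex_power_ivl1[of 2 "2 * n"] k n by auto
  define N where "N = (2::nat) ^ t"
  have N: "N \<le> 2 * n" "n < N" using t by (auto simp: N_def)
  obtain A where A: "skew_conference N A" unfolding N_def using skew_conference_power_two by blast
  have N2: "2 \<le> N" "2 * k \<le> N" using N n k by auto
  define q where "q = real ((2 * n - 2 * k) choose (N - 2 * k)) / real ((2 * n) choose N)"
  have pos: "real ((2 * n) choose N) > 0" "real ((2 * n) choose (2 * k)) > 0"
    using N N2 by (auto simp: zero_less_binomial)
  have "real ((2 * n) choose N) * real (N choose (2 * k)) = real ((2 * n) choose (2 * k)) * real ((2 * n - 2 * k) choose (N - 2 * k))"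
    using choose_mult[OF N2(2) N(1)] by (metis of_nat_mult)
  then have q: "q = real (N choose (2 * k)) / real ((2 * n) choose (2 * k))"
    using pos by (simp add: q_def field_simps)
  \<comment> \<open>The constant comes from N > n and the estimates (N/2k)^(2k) for the upper and
    (2n)^(2k) for the lower binomial.\<close>
  have "(1 / (4 * real k)) ^ (2 * k) \<le> (real N / real (2 * k)) ^ (2 * k) / real (2 * n) ^ (2 * k)"
  proof -
    have "1 / (4 * real k) \<le> real N / real (2 * k) / real (2 * n)"
      using N k n by (simp add: field_simps)
    then have "(1 / (4 * real k)) ^ (2 * k) \<le> (real N / real (2 * k) / real (2 * n)) ^ (2 * k)"
      by (intro power_mono) auto
    then show ?thesis unfolding power_divide[of "real N / real (2 * k)" "real (2 * n)"] .
  qed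
  also have "\<dots> \<le> q"
    unfolding q
  proof (rule frac_le)
    show "(real N / real (2 * k)) ^ (2 * k) \<le> real (N choose (2 * k))"
      using binomial_ge_n_over_k_pow_k[OF N2(2), where 'a = real] by simp
    show "real ((2 * n) choose (2 * k)) \<le> real (2 * n) ^ (2 * k)"
      using binomial_le_pow[of "2 * k" "2 * n"] n by (metis N N2(2) le_trans of_nat_le_iff of_nat_power)
  qed (use pos in auto)
  finally have 1: "(1 / (4 * real k)) ^ (2 * k) \<le> q" .
  have "(1 / sqrt (2 * real n)) ^ k \<le> (1 / sqrt (real N - 1)) ^ k"
    using N N2 by (intro power_mono divide_left_mono) auto
  with 1 have "(1 / (4 * real k)) ^ (2 * k) * (1 / sqrt (2 * real n)) ^ k \<le> q * (1 / sqrt (real N - 1)) ^ k"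
    by (intro mult_mono) (auto simp: q_def)
  also have "\<dots> \<le> eta_star n \<gamma> (2 * k)"
    unfolding q_def by (rule eta_star_conference_lower[OF A N2(1) N(1) N2(2)])
  finally show ?thesis .
qed

end

section \<open>Order of magnitude in n\<close>

lemma sqrt_binomial_ratio_le:
  assumes k: "k \<ge> 1" and n: "n \<ge> k"
  shows "sqrt (real (n choose k) / real ((2 * n) choose (2 * k))) \<le> real k ^ k * (1 / sqrt (real n)) ^ k"
proof -
  have n0: "real n > 0" "real k > 0" using assms by auto
  have "real (n choose k) / real ((2 * n) choose (2 * k)) \<le> real n ^ k / (real n / real k) ^ (2 * k)"
  proof (rule frac_le)
    show "real (n choose k) \<le> real n ^ k"
      using binomial_le_pow[OF n] by (metis of_nat_le_iff of_nat_power)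
    have "(real (2 * n) / real (2 * k)) ^ (2 * k) \<le> real ((2 * n) choose (2 * k))"
      using n by (intro binomial_ge_n_over_k_pow_k) auto
    then show "(real n / real k) ^ (2 * k) \<le> real ((2 * n) choose (2 * k))" by simp
  qed (use n0 in auto)
  also have "\<dots> = (real k ^ k * (1 / sqrt (real n)) ^ k)\<^sup>2"
  proof -
    have "(sqrt (real n) ^ k)\<^sup>2 = real n ^ k"
      by (metis of_nat_0_le_iff power_mult mult.commute real_sqrt_pow2)
    moreover have "real n ^ (2 * k) = real n ^ k * real n ^ k" by (simp add: mult_2 power_add)
    ultimately show ?thesis
      using n0 by (simp add: power_divide power_mult_distrib power_mult mult.commute)
  qed
  finally have "sqrt (real (n choose k) / real ((2 * n) choose (2 * k))) \<le> sqrt ((real k ^ k * (1 / sqrt (real n)) ^ k)\<^sup>2)"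
    by (rule real_sqrt_le_mono)
  then show ?thesis by simp
qed

lemma eta_star_even_bigtheta:
  assumes k: "1 \<le> k" "k \<le> 5" and \<Gamma>: "\<And>n. majorana n (\<Gamma> n)"
  shows "(\<lambda>n. eta_star n (\<Gamma> n) (2 * k)) \<in> \<Theta>(\<lambda>n. (1 / sqrt (real n)) ^ k)"
proof (rule bigthetaI')
  define c where "c = (1 / (4 * real k)) ^ (2 * k) * (1 / sqrt 2) ^ k"
  show "c > 0" using k by (simp add: c_def)
  show "real k ^ k > 0" using k by simp
  obtain N where N: "\<And>n \<gamma>. n \<ge> N \<Longrightarrow> majorana n \<gamma> \<Longrightarrow>
     eta_star n \<gamma> (2 * k) \<le> sqrt (real (n choose k) / real ((2 * n) choose (2 * k)))"
    using eta_star_even_upper[OF k] by blast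
  show "\<forall>\<^sub>F n in at_top. c * norm ((1 / sqrt (real n)) ^ k) \<le> norm (eta_star n (\<Gamma> n) (2 * k)) \<and>
      norm (eta_star n (\<Gamma> n) (2 * k)) \<le> real k ^ k * norm ((1 / sqrt (real n)) ^ k)"
    using eventually_ge_at_top[of N] eventually_ge_at_top[of "2 * k"]
  proof eventually_elim
    case (elim n)
    interpret majorana_system n "\<Gamma> n" by unfold_locales (rule \<Gamma>)
    have "c * (1 / sqrt (real n)) ^ k \<le> eta_star n (\<Gamma> n) (2 * k)"
      using eta_star_lower[OF k(1) elim(2)] by (simp add: c_def real_sqrt_mult power_mult_distrib power_divide)
    moreover have "eta_star n (\<Gamma> n) (2 * k) \<le> real k ^ k * (1 / sqrt (real n)) ^ k"
      using N[OF elim(1) \<Gamma>] sqrt_binomial_ratio_le[OF k(1), of n] elim(2) by linarith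
    ultimately show ?case using eta_star_nonneg[of "2 * k"] by simp
  qed
qed

section \<open>Rigidity in degree two\<close>

text \<open>The Gram matrix of a covariance matrix close to the extremal value is within \<open>1 / v\<close> of the one
  of its rescaled sign matrix; the latter has integer entries, so it is exactly diagonal.\<close>

lemma near_extremal_orthogonal:
  fixes m :: "nat \<Rightarrow> nat \<Rightarrow> real" and v :: nat
  assumes v: "v \<ge> 2"
    and anti: "\<And>j k. j < v \<Longrightarrow> k < v \<Longrightarrow> m j k = - m k j"
    and row: "\<And>j. j < v \<Longrightarrow> (\<Sum>k<v. (m j k)\<^sup>2) \<le> 1"
    and plus: "\<And>j l. j < v \<Longrightarrow> l < v \<Longrightarrow> j \<noteq> l \<Longrightarrow> (\<Sum>k<v. (m j k + m l k)\<^sup>2) \<le> 2"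
    and minus: "\<And>j l. j < v \<Longrightarrow> l < v \<Longrightarrow> j \<noteq> l \<Longrightarrow> (\<Sum>k<v. (m j k - m l k)\<^sup>2) \<le> 2"
    and big: "(\<Sum>j<v. \<Sum>k<v. \<bar>m j k\<bar>) \<ge> real v * sqrt (real v - 1) - sqrt (real v - 1) / (32 * (real v)\<^sup>2)"
  shows "\<exists>A. skew_conference v A"
proof -
  define \<alpha> where "\<alpha> = sqrt (real v - 1)"
  \<comment> \<open>Chosen as the square of 1/(4v): an error vector of squared norm at most
    \<open>\<delta>\<close> changes an inner product with a vector of norm at most 1 by at most
    1/(4v). The slack allowed in \<open>big\<close> is
    \<open>\<alpha> * \<delta> / 2\<close>.\<close>
  define \<delta> where "\<delta> = 1 / (16 * (real v)\<^sup>2)"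
  have \<alpha>: "\<alpha> > 0" "\<alpha> * \<alpha> = real v - 1" using v by (auto simp: \<alpha>_def)
  have big': "(\<Sum>j<v. \<Sum>k<v. \<bar>m j k\<bar>) \<ge> \<alpha> * (real v - \<delta> / 2)"
    using big by (simp add: \<alpha>_def \<delta>_def algebra_simps)
  \<comment> \<open>Sending 0 to 1, and reading signs only above the diagonal, keeps A skew with
    entries 1 or -1 off the diagonal even where m vanishes.\<close>
  define sg where "sg x = (if x \<ge> 0 then 1 else -1 :: int)" for x :: real
  define A where "A j k = (if j < k then sg (m j k) else if k < j then - sg (m k j) else 0)" for j k
  have A_anti: "A j k = - A k j" for j k by (simp add: A_def)
  have A_pm: "A j k = 1 \<or> A j k = -1" if "j \<noteq> k" for j k using that by (auto simp: A_def sg_def)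
  have A_diag: "A j j = 0" for j by (simp add: A_def)
  have A_sq: "(A j k)\<^sup>2 = (if j = k then 0 else 1)" for j k
    using A_pm[of j k] by (auto simp: A_diag)
  have Am: "A j k * m j k = \<bar>m j k\<bar>" if "j < v" "k < v" for j k
  proof (cases j k rule: linorder_cases)
    case less
    then show ?thesis by (simp add: A_def sg_def)
  next
    case equal
    with anti[OF that] have "m j k = 0" by simp
    then show ?thesis by simp
  next
    case greater
    then show ?thesis using anti[OF that] by (simp add: A_def sg_def)
  qed
  have A_row: "(\<Sum>k<v. (A j k)\<^sup>2) = int v - 1" if "j < v" for j
  proof -
    have "(\<Sum>k<v. (A j k)\<^sup>2) = (\<Sum>k\<in>{..<v} - {j}. 1)"
      unfolding A_sq using that by (intro sum.mono_neutral_cong_right) auto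
    also have "\<dots> = int (card ({..<v} - {j}))" by simp
    also have "\<dots> = int v - 1" using that v by (simp add: of_nat_diff)
    finally show ?thesis .
  qed
  define e where "e j k = A j k / \<alpha> - m j k" for j k
  define s where "s j = (\<Sum>k<v. (m j k)\<^sup>2)" for j
  define E where "E j = (\<Sum>k<v. (e j k)\<^sup>2)" for j
  have E_row: "E j = 1 + s j - 2 / \<alpha> * (\<Sum>k<v. \<bar>m j k\<bar>)" if j: "j < v" for j
  proof -
    have "E j = (\<Sum>k<v. (A j k)\<^sup>2 / (\<alpha> * \<alpha>) + (m j k)\<^sup>2 - 2 / \<alpha> * (A j k * m j k))"
      unfolding E_def e_def by (intro sum.cong refl) (simp add: power2_diff power_divide power2_eq_square[of \<alpha>])
    also have "\<dots> = real_of_int (\<Sum>k<v. (A j k)\<^sup>2) / (\<alpha> * \<alpha>) + s j - 2 / \<alpha> * (\<Sum>k<v. A j k * m j k)"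
      by (simp add: sum.distrib sum_subtractf sum_divide_distrib sum_distrib_left s_def)
    also have "(\<Sum>k<v. A j k * m j k) = (\<Sum>k<v. \<bar>m j k\<bar>)"
      using Am j by (intro sum.cong) auto
    also have "real_of_int (\<Sum>k<v. (A j k)\<^sup>2) / (\<alpha> * \<alpha>) = 1"
      unfolding A_row[OF j] using \<alpha> v by simp
    finally show ?thesis .
  qed
  have E_tot: "(\<Sum>j<v. E j) = real v + (\<Sum>j<v. s j) - 2 / \<alpha> * (\<Sum>j<v. \<Sum>k<v. \<bar>m j k\<bar>)"
    using E_row by (simp add: sum.distrib sum_subtractf sum_distrib_left)
  have "2 / \<alpha> * (\<Sum>j<v. \<Sum>k<v. \<bar>m j k\<bar>) \<ge> 2 / \<alpha> * (\<alpha> * (real v - \<delta> / 2))"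
    using big' \<alpha> by (intro mult_left_mono) auto
  then have E_bound: "(\<Sum>j<v. E j) \<le> (\<Sum>j<v. s j) - real v + \<delta>"
    unfolding E_tot using \<alpha> by simp
  have s1: "s j \<le> 1" if "j < v" for j using row[OF that] by (simp add: s_def)
  have E0: "E j \<ge> 0" for j unfolding E_def by (intro sum_nonneg) auto
  \<comment> \<open>The missing row norms and the squared distances to the rescaled sign rows are
    all nonnegative and together at most \<open>\<delta>\<close>, so each single one is.\<close>
  have defect_tot: "(\<Sum>j<v. 1 - s j) + (\<Sum>j<v. E j) \<le> \<delta>"
    using E_bound by (simp add: sum_subtractf)
  have dE: "1 - s j + E j \<le> \<delta>" if "j < v" for j
  proof -
    have "1 - s j + E j \<le> (\<Sum>j<v. 1 - s j + E j)"
      using that s1 E0 by (intro member_le_sum) (auto simp: add_nonneg_nonneg)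
    with defect_tot show ?thesis by (simp add: sum.distrib)
  qed
  have \<delta>0: "\<delta> > 0" using v by (simp add: \<delta>_def)
  have \<delta>v: "\<delta> = (1 / (4 * real v))\<^sup>2" by (simp add: \<delta>_def power2_eq_square)
  have cs: "\<bar>\<Sum>k<v. x k * y k\<bar> \<le> 1 / (4 * real v)"
    if "(\<Sum>k<v. (x k)\<^sup>2) \<le> 1" "(\<Sum>k<v. (y k)\<^sup>2) \<le> \<delta>" for x y :: "nat \<Rightarrow> real"
  proof -
    have "\<bar>\<Sum>k<v. x k * y k\<bar>\<^sup>2 = (\<Sum>k<v. x k * y k)\<^sup>2" by simp
    also have "\<dots> \<le> (\<Sum>k<v. (x k)\<^sup>2) * (\<Sum>k<v. (y k)\<^sup>2)" by (rule Cauchy_Schwarz_ineq_sum)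
    also have "\<dots> \<le> 1 * \<delta>" using that by (intro mult_mono) (auto intro: sum_nonneg)
    finally have "\<bar>\<Sum>k<v. x k * y k\<bar>\<^sup>2 \<le> (1 / (4 * real v))\<^sup>2" by (simp add: \<delta>v)
    then show ?thesis by (rule power2_le_imp_le) simp
  qed
  have "(\<Sum>c<v. A j c * A l c) = 0" if jl: "j < v" "l < v" "j \<noteq> l" for j l
  proof -
    define x where "x = (\<Sum>c<v. A j c * A l c)"
    have Ej: "E j \<le> \<delta>" "E l \<le> \<delta>" using dE[OF jl(1)] dE[OF jl(2)] s1[OF jl(1)] s1[OF jl(2)] by auto
    have \<delta>1: "\<delta> \<le> 1" unfolding \<delta>v using v by (intro power_le_one) auto
    \<comment> \<open>Polarisation: both squared norms are at most 2 while the two row norms nearly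
      add up to 2, which leaves little room for the inner product.\<close>
    have 1: "\<bar>\<Sum>c<v. m j c * m l c\<bar> \<le> \<delta>"
    proof -
      have "(\<Sum>k<v. (m j k + m l k)\<^sup>2) = s j + s l + 2 * (\<Sum>c<v. m j c * m l c)"
        by (simp add: s_def power2_sum sum.distrib sum_distrib_left mult.assoc)
      moreover have "(\<Sum>k<v. (m j k - m l k)\<^sup>2) = s j + s l - 2 * (\<Sum>c<v. m j c * m l c)"
        by (simp add: s_def power2_diff sum.distrib sum_subtractf sum_distrib_left mult.assoc)
      ultimately show ?thesis
        using plus[OF jl] minus[OF jl] dE[OF jl(1)] dE[OF jl(2)] E0[of j] E0[of l] by linarith
    qed
    have 2: "\<bar>\<Sum>c<v. m j c * e l c\<bar> \<le> 1 / (4 * real v)"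
      using row[OF jl(1)] Ej by (intro cs) (auto simp: E_def)
    have 3: "\<bar>\<Sum>c<v. m l c * e j c\<bar> \<le> 1 / (4 * real v)"
      using row[OF jl(2)] Ej by (intro cs) (auto simp: E_def)
    have 4: "\<bar>\<Sum>c<v. e j c * e l c\<bar> \<le> 1 / (4 * real v)"
      using Ej \<delta>1 by (intro cs) (auto simp: E_def)
    have "real_of_int x / (\<alpha> * \<alpha>) = (\<Sum>c<v. (m j c + e j c) * (m l c + e l c))"
      by (simp add: x_def e_def sum_divide_distrib)
    also have "\<dots> = (\<Sum>c<v. m j c * m l c) + (\<Sum>c<v. m j c * e l c) + (\<Sum>c<v. m l c * e j c) + (\<Sum>c<v. e j c * e l c)"
      by (simp add: sum.distrib algebra_simps)
    \<comment> \<open>The total error is below 1/v, so multiplication by v - 1 leaves an integer of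
      modulus below 1.\<close>
    finally have "\<bar>real_of_int x / (\<alpha> * \<alpha>)\<bar> \<le> \<delta> + 3 / (4 * real v)"
      using 1 2 3 4 by linarith
    also have "\<delta> \<le> 1 / (16 * real v)"
      unfolding \<delta>_def using v by (intro divide_left_mono) (auto simp: power2_eq_square)
    also have "1 / (16 * real v) + 3 / (4 * real v) < 1 / real v"
      using v by (simp add: field_simps)
    finally have "\<bar>real_of_int x\<bar> / (real v - 1) < 1 / real v"
      unfolding \<alpha>(2) using v by (simp add: abs_divide)
    then have "\<bar>real_of_int x\<bar> < (real v - 1) / real v"
      using v by (simp add: field_simps)
    also have "\<dots> \<le> 1" using v by simp
    finally show ?thesis unfolding x_def by linarith
  qed
  moreover have "(\<Sum>c<v. A j c * A j c) = int v - 1" if "j < v" for j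
    using A_row[OF that] by (simp add: power2_eq_square)
  ultimately have "(\<Sum>c<v. A a c * A b c) = (if a = b then int v - 1 else 0)" if "a < v" "b < v" for a b
    using that by (cases "a = b") auto
  then have "skew_conference v A"
    unfolding skew_conference_def using A_anti A_pm by blast
  then show ?thesis by blast
qed

lemma sum_pairs_two_subsets:
  fixes h :: "nat set \<Rightarrow> real" and v :: nat
  shows "(\<Sum>j<v. \<Sum>k<v. if j = k then 0 else h {j, k}) = 2 * (\<Sum>S\<in>{S. S \<subseteq> {0..<v} \<and> card S = 2}. h S)"
proof -
  define P where "P = {(j, k). j < v \<and> k < v \<and> j \<noteq> k}"
  define F where "F = {S. S \<subseteq> {0..<v} \<and> card S = 2}"
  have finP: "finite P" by (rule finite_subset[of _ "{..<v} \<times> {..<v}"]) (auto simp: P_def)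
  have finF: "finite F" by (rule finite_subset[of _ "Pow {0..<v}"]) (auto simp: F_def)
  have "(\<Sum>j<v. \<Sum>k<v. if j = k then 0 else h {j, k}) = (\<Sum>p\<in>{..<v} \<times> {..<v}. if fst p = snd p then 0 else h {fst p, snd p})"
    by (simp add: sum.cartesian_product split_def)
  also have "\<dots> = (\<Sum>p\<in>P. h {fst p, snd p})"
    by (intro sum.mono_neutral_cong_right) (auto simp: P_def)
  also have "\<dots> = (\<Sum>S\<in>F. \<Sum>p\<in>{p \<in> P. {fst p, snd p} = S}. h {fst p, snd p})"
    by (rule sum.group[symmetric, OF finP finF]) (auto simp: P_def F_def)
  also have "\<dots> = (\<Sum>S\<in>F. 2 * h S)"
  proof (rule sum.cong[OF refl])
    fix S assume "S \<in> F"
    then obtain a b where ab: "S = {a, b}" "a \<noteq> b" "a < v" "b < v"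
      by (auto simp: F_def card_2_iff)
    have "{p \<in> P. {fst p, snd p} = S} = {(a, b), (b, a)}"
      using ab by (auto simp: P_def doubleton_eq_iff)
    then show "(\<Sum>p\<in>{p \<in> P. {fst p, snd p} = S}. h {fst p, snd p}) = 2 * h S"
      using ab by (simp add: insert_commute)
  qed
  finally show ?thesis by (simp add: sum_distrib_left F_def)
qed

section \<open>Covariance matrices of positive operators\<close>

context majorana_system
begin

lemma psd_trace_real: assumes "is_psd d G" shows "Im (tr G) = 0"
proof -
  have GC: "G \<in> C" using assms by (simp add: is_psd_def)
  have "Im (G $$ (i, i)) = 0" if "i < d" for i
  proof -
    define w where "w a = (of_bool (a = i) :: complex)" for a :: nat
    have "(\<Sum>a<d. \<Sum>b<d. cnj (w a) * G $$ (a, b) * w b) = (\<Sum>a<d. \<Sum>b<d. if b = i then (if a = i then G $$ (a, b) else 0) else 0)"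
      by (intro sum.cong refl) (auto simp: w_def)
    also have "\<dots> = G $$ (i, i)" using that by simp
    finally have "(\<Sum>a<d. \<Sum>b<d. cnj (w a) * G $$ (a, b) * w b) = G $$ (i, i)" .
    moreover have "Im (\<Sum>a<d. \<Sum>b<d. cnj (w a) * G $$ (a, b) * w b) = 0"
      using assms unfolding is_psd_def Let_def by blast
    ultimately show ?thesis by simp
  qed
  then show ?thesis using GC by (auto simp: tr_def)
qed

definition covar :: "complex mat \<Rightarrow> nat \<Rightarrow> nat \<Rightarrow> real" where
  "covar G j k = expval G (\<i> \<cdot>\<^sub>m (\<gamma> j * \<gamma> k))"

lemma covar_antisym:
  assumes G: "is_psd d G" and jk: "j < 2 * n" "k < 2 * n"
  shows "covar G j k = - covar G k j"
proof -
  have GC: "G \<in> C" using G by (simp add: is_psd_def)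
  show ?thesis
  proof (cases "j = k")
    case True
    \<comment> \<open>On the diagonal the operator is the imaginary unit times the identity, so its
      real moment vanishes because the trace of G is real.\<close>
    have "covar G j j = - Im (tr G)"
      using GC jk by (simp add: covar_def expval_def gen_sq smult_right one_right tr_smult[of _ d])
    then show ?thesis using True psd_trace_real[OF G] by simp
  next
    case False
    have "\<i> \<cdot>\<^sub>m (\<gamma> j * \<gamma> k) = complex_of_real (-1) \<cdot>\<^sub>m (\<i> \<cdot>\<^sub>m (\<gamma> k * \<gamma> j))"
      unfolding gen_anti[OF jk False] by (simp add: smult_smult_mat)
    then show ?thesis
      unfolding covar_def using GC jk by (simp only: expval_smult[OF GC] smult_carrier_mat mult_C gen_C)
  qed
qed

lemma covar_g:
  assumes "j < k" "k < 2 * n"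
  shows "covar G j k = expval G (g {j, k})"
proof -
  have "sorted_list_of_set {j, k} = [j, k]" using assms by (simp add: insort_insert_insort)
  moreover have "card {j, k} choose 2 = 1"
  proof -
    have "card {j, k} = 2" using assms by simp
    then show ?thesis by (simp only: binomial_n_n)
  qed
  ultimately show ?thesis
    using assms by (simp only: covar_def g_word) (simp add: one_right)
qed

text \<open>Positivity of the moment of \<open>dag X * X\<close> for X the sum of \<open>p j\<close>
  times \<open>\<gamma> j\<close> plus the imaginary unit times the sum of \<open>q k\<close> times
  \<open>\<gamma> k\<close>. Anticommutation collapses the pp and qq terms to norms, and the mixed
  terms are covariances.\<close>

lemma covar_quadratic:
  assumes G: "is_psd d G"
  shows "0 \<le> Re (tr G) * ((\<Sum>j<2*n. (p j)\<^sup>2) + (\<Sum>j<2*n. (q j)\<^sup>2)) + 2 * (\<Sum>j<2*n. \<Sum>k<2*n. p j * q k * covar G j k)"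
proof -
  have GC: "G \<in> C" using G by (simp add: is_psd_def)
  define I where "I = {..<2*n} <+> {..<2*n}"
  define X where "X = case_sum \<gamma> (\<lambda>k. \<i> \<cdot>\<^sub>m \<gamma> k)"
  define c where "c = case_sum p q"
  have X: "X i \<in> C" if "i \<in> I" for i using that by (auto simp: I_def X_def)
  have sumI: "(\<Sum>i\<in>I. f i) = (\<Sum>j<2*n. f (Inl j)) + (\<Sum>j<2*n. f (Inr j))" for f :: "nat + nat \<Rightarrow> real"
    unfolding I_def by (subst sum.Plus) auto
  have LL: "expval G (dag (X (Inl j)) * X (Inl k)) = expval G (\<gamma> j * \<gamma> k)" if "j < 2*n" "k < 2*n" for j k
    using that by (simp add: X_def gen_dag)
  have RR: "expval G (dag (X (Inr j)) * X (Inr k)) = expval G (\<gamma> j * \<gamma> k)" if "j < 2*n" "k < 2*n" for j k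
    using that by (simp add: X_def gen_dag dag_smult[of _ d] mat_simps smult_smult_mat)
  have LR: "expval G (dag (X (Inl j)) * X (Inr k)) = covar G j k" if "j < 2*n" "k < 2*n" for j k
    using that by (simp add: X_def gen_dag mat_simps covar_def)
  have RL: "expval G (dag (X (Inr k)) * X (Inl j)) = covar G j k" if "j < 2*n" "k < 2*n" for j k
  proof -
    have "dag (X (Inr k)) * X (Inl j) = complex_of_real (-1) \<cdot>\<^sub>m (\<i> \<cdot>\<^sub>m (\<gamma> k * \<gamma> j))"
      using that by (simp add: X_def gen_dag dag_smult[of _ d] mat_simps smult_smult_mat)
    then have "expval G (dag (X (Inr k)) * X (Inl j)) = - covar G k j"
      unfolding covar_def using that by (simp only: expval_smult[OF GC] smult_carrier_mat mult_C gen_C)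
    then show ?thesis using covar_antisym[OF G that] by simp
  qed
  have diag: "(\<Sum>j<2*n. \<Sum>k<2*n. y j * y k * expval G (\<gamma> j * \<gamma> k)) = Re (tr G) * (\<Sum>j<2*n. (y j)\<^sup>2)" for y :: "nat \<Rightarrow> real"
  proof -
    define D where "D = (\<Sum>j<2*n. \<Sum>k<2*n. y j * y k * expval G (\<gamma> j * \<gamma> k))"
    have "D = (\<Sum>j<2*n. \<Sum>k<2*n. y j * y k * expval G (\<gamma> k * \<gamma> j))"
      unfolding D_def by (subst sum.swap) (simp add: mult.commute mult.left_commute)
    then have "D + D = (\<Sum>j<2*n. \<Sum>k<2*n. y j * y k * expval G (\<gamma> j * \<gamma> k)) + (\<Sum>j<2*n. \<Sum>k<2*n. y j * y k * expval G (\<gamma> k * \<gamma> j))"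
      by (simp add: D_def)
    also have "\<dots> = (\<Sum>j<2*n. \<Sum>k<2*n. y j * y k * (expval G (\<gamma> j * \<gamma> k) + expval G (\<gamma> k * \<gamma> j)))"
      by (simp only: sum.distrib distrib_left)
    also have "\<dots> = (\<Sum>j<2*n. \<Sum>k<2*n. if j = k then 2 * Re (tr G) * (y j)\<^sup>2 else 0)"
    proof (intro sum.cong refl)
      fix j k assume "j \<in> {..<2*n}" "k \<in> {..<2*n}"
      then have jk: "j < 2 * n" "k < 2 * n" by auto
      have "expval G (\<gamma> j * \<gamma> k) + expval G (\<gamma> k * \<gamma> j) = expval G (\<gamma> j * \<gamma> k + \<gamma> k * \<gamma> j)"
        using jk by (intro expval_add[OF GC, symmetric] mult_C gen_C)
      also have "\<dots> = expval G (complex_of_real (if j = k then 2 else 0) \<cdot>\<^sub>m 1\<^sub>m d)"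
        unfolding gen_acomm[OF jk] by simp
      also have "\<dots> = (if j = k then 2 else 0) * Re (tr G)"
        by (subst expval_smult[OF GC]) (auto simp: expval_one[OF G])
      finally show "y j * y k * (expval G (\<gamma> j * \<gamma> k) + expval G (\<gamma> k * \<gamma> j)) = (if j = k then 2 * Re (tr G) * (y j)\<^sup>2 else 0)"
        by (simp add: power2_eq_square)
    qed
    also have "\<dots> = 2 * (Re (tr G) * (\<Sum>j<2*n. (y j)\<^sup>2))"
      by (simp add: sum_distrib_left mult.assoc)
    finally show ?thesis unfolding D_def by simp
  qed
  have "0 \<le> (\<Sum>i\<in>I. \<Sum>j\<in>I. c i * c j * expval G (dag (X i) * X j))"
    by (rule psd_gram[OF G X])
  also have "\<dots> = (\<Sum>j<2*n. \<Sum>k<2*n. p j * p k * expval G (\<gamma> j * \<gamma> k)) + (\<Sum>j<2*n. \<Sum>k<2*n. p j * q k * covar G j k)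
      + ((\<Sum>k<2*n. \<Sum>j<2*n. q k * p j * covar G j k) + (\<Sum>j<2*n. \<Sum>k<2*n. q j * q k * expval G (\<gamma> j * \<gamma> k)))"
    unfolding sumI by (simp add: c_def LL RR LR RL sum.distrib)
  also have "(\<Sum>k<2*n. \<Sum>j<2*n. q k * p j * covar G j k) = (\<Sum>j<2*n. \<Sum>k<2*n. p j * q k * covar G j k)"
    by (subst sum.swap) (simp add: mult_ac)
  finally show ?thesis unfolding diag by (simp add: algebra_simps)
qed

text \<open>The quadratic inequality is used at q equal to minus the transposed normalised
  covariance matrix applied to p; it then says that this matrix has operator norm at most 1.\<close>

lemma covar_contraction:
  assumes G: "is_psd d G" and \<tau>: "Re (tr G) > 0"
  shows "(\<Sum>k<2*n. (\<Sum>j<2*n. p j * (covar G j k / Re (tr G)))\<^sup>2) \<le> (\<Sum>j<2*n. (p j)\<^sup>2)"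
proof -
  define \<tau> where "\<tau> = Re (tr G)"
  define q where "q k = (\<Sum>j<2*n. p j * (covar G j k / \<tau>))" for k
  have t: "\<tau> > 0" using assms(2) by (simp add: \<tau>_def)
  have "(\<Sum>j<2*n. \<Sum>k<2*n. p j * - q k * covar G j k) = - (\<tau> * (\<Sum>k<2*n. (q k)\<^sup>2))"
  proof -
    have "(\<Sum>j<2*n. \<Sum>k<2*n. p j * - q k * covar G j k) = (\<Sum>k<2*n. \<Sum>j<2*n. p j * - q k * covar G j k)"
      by (rule sum.swap)
    also have "\<dots> = (\<Sum>k<2*n. - (\<tau> * (q k)\<^sup>2))"
    proof (rule sum.cong[OF refl])
      fix k
      have "(\<Sum>j<2*n. p j * - q k * covar G j k) = - (\<tau> * q k) * (\<Sum>j<2*n. p j * (covar G j k / \<tau>))"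
        unfolding sum_distrib_left using t by (intro sum.cong refl) simp
      then show "(\<Sum>j<2*n. p j * - q k * covar G j k) = - (\<tau> * (q k)\<^sup>2)"
        unfolding q_def[of k, symmetric] by (simp add: power2_eq_square mult.assoc)
    qed
    finally show ?thesis by (simp add: sum_negf sum_distrib_left)
  qed
  with covar_quadratic[OF G, of p "\<lambda>k. - q k"]
  have "0 \<le> \<tau> * ((\<Sum>j<2*n. (p j)\<^sup>2) - (\<Sum>k<2*n. (q k)\<^sup>2))"
    by (simp add: \<tau>_def[symmetric] algebra_simps)
  then show ?thesis
    using t by (simp add: zero_le_mult_iff q_def \<tau>_def)
qed

end

section \<open>The main theorem\<close>

lemma choose_two_real: "real (m choose 2) = real m * (real m - 1) / 2"
  by (induction m) (simp_all add: choose_two_rec field_simps)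

lemma skew_hadamard_of_conference:
  assumes A: "skew_conference v A"
  shows "\<exists>H. is_skew_hadamard v H"
proof -
  have anti: "A a b = - A b a" and orth: "(\<Sum>c<v. A a c * A b c) = (if a = b then int v - 1 else 0)"
    and pm: "a \<noteq> b \<Longrightarrow> A a b = 1 \<or> A a b = -1" if "a < v" "b < v" for a b
    using A that unfolding skew_conference_def by blast+
  have diag: "A a a = 0" if "a < v" for a using anti[OF that that] by simp
  define h where "h a b = (if a = b then 1 else real_of_int (A a b))" for a b
  define H where "H = mat v v (\<lambda>(a, b). h a b)"
  have hA: "h a b = of_bool (a = b) + real_of_int (A a b)" if "a < v" "b < v" for a b
    using diag that by (auto simp: h_def)
  have hh: "(\<Sum>c<v. h a c * h b c) = (if a = b then real v else 0)" if ab: "a < v" "b < v" for a b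
  proof -
    have d: "(\<Sum>c<v. of_bool (x = c) * f c) = f x" if "x < v" for x and f :: "nat \<Rightarrow> real"
      using that by (intro sum_of_bool_mult) auto
    have "(\<Sum>c<v. h a c * h b c) = (\<Sum>c<v. (of_bool (a = c) + real_of_int (A a c)) * (of_bool (b = c) + real_of_int (A b c)))"
      using ab by (intro sum.cong refl) (auto simp: hA)
    also have "\<dots> = (\<Sum>c<v. of_bool (a = c) * of_bool (b = c)) + (\<Sum>c<v. of_bool (a = c) * real_of_int (A b c))
        + (\<Sum>c<v. of_bool (b = c) * real_of_int (A a c)) + real_of_int (\<Sum>c<v. A a c * A b c)"
      by (simp add: sum.distrib distrib_left distrib_right mult.commute add_ac)
    also have "\<dots> = of_bool (b = a) + real_of_int (A b a) + real_of_int (A a b) + real_of_int (if a = b then int v - 1 else 0)"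
      unfolding d[OF ab(1)] d[OF ab(2)] orth[OF ab] ..
    finally show ?thesis using anti[OF ab] by (auto split: if_splits)
  qed
  have HC: "H \<in> carrier_mat v v" by (simp add: H_def)
  have "is_skew_hadamard v H"
    unfolding is_skew_hadamard_def is_hadamard_def
  proof (intro conjI allI impI)
    show "H \<in> carrier_mat v v" by (rule HC)
    show "H $$ (a, b) \<in> {1, -1}" if "a < v" "b < v" for a b
      using that pm[OF that] by (auto simp: H_def h_def)
    show "H * transpose_mat H = real v \<cdot>\<^sub>m 1\<^sub>m v"
    proof (rule eq_matI)
      fix a b assume "a < dim_row (real v \<cdot>\<^sub>m 1\<^sub>m v)" "b < dim_col (real v \<cdot>\<^sub>m 1\<^sub>m v)"
      then have ab: "a < v" "b < v" by auto
      have "(H * transpose_mat H) $$ (a, b) = (\<Sum>c<v. h a c * h b c)"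
        unfolding mult_entry[OF HC transpose_carrier_mat[THEN iffD2, OF HC] ab]
        using ab by (intro sum.cong refl) (simp add: H_def)
      then show "(H * transpose_mat H) $$ (a, b) = (real v \<cdot>\<^sub>m 1\<^sub>m v) $$ (a, b)"
        using ab hh[OF ab] by simp
    qed (simp_all add: H_def)
    show "H + transpose_mat H = 2 \<cdot>\<^sub>m 1\<^sub>m v"
    proof (rule eq_matI)
      fix a b assume "a < dim_row (2 \<cdot>\<^sub>m 1\<^sub>m v :: real mat)" "b < dim_col (2 \<cdot>\<^sub>m 1\<^sub>m v :: real mat)"
      then have ab: "a < v" "b < v" by auto
      show "(H + transpose_mat H) $$ (a, b) = (2 \<cdot>\<^sub>m 1\<^sub>m v) $$ (a, b)"
        using ab anti[OF ab] by (simp add: H_def h_def)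
    qed (simp_all add: H_def)
  qed
  then show ?thesis by blast
qed

lemma conference_of_skew_hadamard:
  assumes H: "is_skew_hadamard v H"
  shows "\<exists>A. skew_conference v A"
proof -
  define h where "h a b = H $$ (a, b)" for a b
  have HC: "H \<in> carrier_mat v v" and HH: "H * transpose_mat H = real v \<cdot>\<^sub>m 1\<^sub>m v"
    and HS: "H + transpose_mat H = 2 \<cdot>\<^sub>m 1\<^sub>m v"
    and pm: "\<And>a b. a < v \<Longrightarrow> b < v \<Longrightarrow> h a b = 1 \<or> h a b = -1"
    using H unfolding is_skew_hadamard_def is_hadamard_def h_def by auto
  have dims: "dim_row H = v" "dim_col H = v" using HC by auto
  have skew: "h a b + h b a = 2 * of_bool (a = b)" if "a < v" "b < v" for a b
  proof -
    have "(H + transpose_mat H) $$ (a, b) = (2 \<cdot>\<^sub>m 1\<^sub>m v) $$ (a, b)" unfolding HS ..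
    then show ?thesis using that dims by (auto simp: h_def)
  qed
  have orth: "(\<Sum>c<v. h a c * h b c) = (if a = b then real v else 0)" if ab: "a < v" "b < v" for a b
  proof -
    have "(H * transpose_mat H) $$ (a, b) = (\<Sum>c<v. h a c * h b c)"
      using ab dims by (simp add: mult_entry[OF HC transpose_carrier_mat[THEN iffD2, OF HC] ab] h_def del: index_mult_mat)
    moreover have "(H * transpose_mat H) $$ (a, b) = (if a = b then real v else 0)"
      unfolding HH using ab by simp
    ultimately show ?thesis by simp
  qed
  define A where "A a b = (if a = b then 0 else if h a b = 1 then 1 else (-1::int))" for a b
  have Ah: "real_of_int (A a b) = h a b - of_bool (a = b)" if "a < v" "b < v" for a b
    using pm[OF that] skew[OF that] by (auto simp: A_def)
  have d: "(\<Sum>c<v. of_bool (x = c) * f c) = f x" if "x < v" for x and f :: "nat \<Rightarrow> real"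
    using that by (intro sum_of_bool_mult) auto
  have "skew_conference v A"
    unfolding skew_conference_def
  proof (intro conjI allI impI)
    fix a b assume ab: "a < v" "b < v"
    have "real_of_int (A a b) = real_of_int (- A b a)"
      using skew[OF ab] Ah[OF ab] Ah[OF ab(2,1)] by (auto simp: of_bool_def split: if_splits)
    then show "A a b = - A b a" by (simp only: of_int_eq_iff)
    show "A a b = 1 \<or> A a b = -1" if "a \<noteq> b" using that by (simp add: A_def)
    have "real_of_int (\<Sum>c<v. A a c * A b c) = (\<Sum>c<v. (h a c - of_bool (a = c)) * (h b c - of_bool (b = c)))"
      using ab by (simp add: Ah)
    also have "\<dots> = (\<Sum>c<v. h a c * h b c) - (\<Sum>c<v. of_bool (a = c) * h b c)
        - (\<Sum>c<v. of_bool (b = c) * h a c) + (\<Sum>c<v. of_bool (a = c) * of_bool (b = c))"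
      by (simp add: sum.distrib sum_subtractf left_diff_distrib right_diff_distrib mult.commute)
    also have "\<dots> = (if a = b then real v else 0) - h b a - h a b + of_bool (b = a)"
      unfolding d[OF ab(1)] d[OF ab(2)] orth[OF ab] ..
    also have "\<dots> = real_of_int (if a = b then int v - 1 else 0)"
      using skew[OF ab] by (auto split: if_splits)
    finally show "(\<Sum>c<v. A a c * A b c) = (if a = b then int v - 1 else 0)"
      by (simp only: of_int_eq_iff)
  qed
  then show ?thesis by blast
qed

text \<open>In degree one the kernel is 2(ps - q^2): it is -8 for disjoint 2-sets and 8(n - 1) for
  equal ones, hence the weight 1/8. Being explicit, this certificate serves every n.\<close>

lemma dual_certificate_one: "dual_certificate n 1 (\<lambda>_. 1 / 8)"
  by (simp add: dual_certificate_def odd_kernel_def)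

context majorana_system
begin

lemma eta_star_two_le:
  assumes n: "n \<ge> 1"
  shows "eta_star n \<gamma> 2 \<le> 1 / sqrt (2 * real n - 1)"
proof -
  have "eta_star n \<gamma> (2 * 1) \<le> sqrt (real (n choose 1) / real ((2 * n) choose (2 * 1)))"
    using n by (intro eta_star_even_le[OF _ _ dual_certificate_one]) auto
  moreover have "real ((2 * n) choose 2) = real n * (2 * real n - 1)"
    using n by (simp add: choose_two_real field_simps)
  ultimately show ?thesis using n by (simp add: real_sqrt_divide)
qed

text \<open>If every element of positive trace failed the inequality, summation over the parent POVM
  would contradict the averaged one. Elements of trace 0 contribute nothing, since the bound on
  squared moments makes all their moments 0.\<close>

lemma near_optimal_state:
  assumes n: "n \<ge> 1" and c: "compatible 2 \<eta>"
  shows "\<exists>G. is_psd d G \<and> Re (tr G) > 0 \<and>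
     \<eta> * real (card (subsets_m n 2)) * Re (tr G) \<le> (\<Sum>S\<in>subsets_m n 2. \<bar>expval G (g S)\<bar>)"
proof (rule ccontr)
  assume neg: "\<not> ?thesis"
  define F where "F = subsets_m n 2"
  obtain \<Lambda> :: "nat set" and G where povm: "is_povm d \<Lambda> G"
    and le: "\<eta> * real (card F) * real d \<le> (\<Sum>l\<in>\<Lambda>. \<Sum>S\<in>F. \<bar>expval (G l) (g S)\<bar>)"
    unfolding F_def using jointly_measurable_upper[OF c] .
  have G: "is_psd d (G l)" if "l \<in> \<Lambda>" for l using povm that by (simp add: is_povm_def)
  have fin: "finite \<Lambda>" using povm by (simp add: is_povm_def)
  have strict: "(\<Sum>S\<in>F. \<bar>expval (G l) (g S)\<bar>) < \<eta> * real (card F) * Re (tr (G l))"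
    if "l \<in> \<Lambda>" "Re (tr (G l)) > 0" for l
    using neg G[OF that(1)] that(2) unfolding F_def by (meson not_le)
  have weak: "(\<Sum>S\<in>F. \<bar>expval (G l) (g S)\<bar>) \<le> \<eta> * real (card F) * Re (tr (G l))" if l: "l \<in> \<Lambda>" for l
  proof (cases "Re (tr (G l)) = 0")
    case True
    have "(\<Sum>S\<in>subsets_m n (2*1). (expval (G l) (g S))\<^sup>2) \<le> real (n choose 1) * (Re (tr (G l)))\<^sup>2"
      by (rule sum_sq_expval_le[OF G[OF l] _ dual_certificate_one]) simp
    then have "(\<Sum>S\<in>F. (expval (G l) (g S))\<^sup>2) \<le> 0" using True by (simp add: F_def)
    then have "\<forall>S\<in>F. (expval (G l) (g S))\<^sup>2 = 0"
      by (subst sum_nonneg_eq_0_iff[symmetric]) (auto simp: F_def intro!: antisym sum_nonneg)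
    with True show ?thesis by simp
  next
    case False
    with psd_trace_nonneg[OF G[OF l]] strict[OF l] show ?thesis by simp
  qed
  have tot: "(\<Sum>l\<in>\<Lambda>. Re (tr (G l))) = real d"
    using arg_cong[OF povm_trace[OF povm], of Re] by simp
  have "\<exists>l\<in>\<Lambda>. Re (tr (G l)) > 0"
  proof (rule ccontr)
    assume "\<not> (\<exists>l\<in>\<Lambda>. Re (tr (G l)) > 0)"
    then have "(\<Sum>l\<in>\<Lambda>. Re (tr (G l))) \<le> 0" by (intro sum_nonpos) force
    moreover have "real d > 0" by simp
    ultimately show False using tot by linarith
  qed
  then have "(\<Sum>l\<in>\<Lambda>. \<Sum>S\<in>F. \<bar>expval (G l) (g S)\<bar>) < (\<Sum>l\<in>\<Lambda>. \<eta> * real (card F) * Re (tr (G l)))"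
    using weak strict by (intro sum_strict_mono_ex1[OF fin]) auto
  also have "\<dots> = \<eta> * real (card F) * real d"
    unfolding sum_distrib_left[symmetric] tot ..
  finally show False using le by simp
qed

lemma conference_of_eta_star_two:
  assumes n: "n \<ge> 1" and eq: "eta_star n \<gamma> 2 = 1 / sqrt (2 * real n - 1)"
  shows "\<exists>A. skew_conference (2 * n) A"
proof -
  define v where "v = 2 * n"
  define \<alpha> where "\<alpha> = sqrt (real v - 1)"
  \<comment> \<open>The supremum need not be known to be attained, so a level within
    \<open>\<epsilon>\<close> of it is used; multiplied by \<open>v * \<alpha>^2\<close> this loss
    is exactly the slack that the rigidity lemma tolerates.\<close>
  define \<epsilon> where "\<epsilon> = 1 / (32 * real v ^ 3 * \<alpha>)"
  have v: "v \<ge> 2" using n by (simp add: v_def)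
  have \<alpha>: "\<alpha> > 0" "\<alpha> * \<alpha> = real v - 1" using v by (auto simp: \<alpha>_def)
  have "\<epsilon> > 0" using v \<alpha> by (simp add: \<epsilon>_def)
  then have "1 / \<alpha> - \<epsilon> < eta_star n \<gamma> 2" using eq by (simp add: \<alpha>_def v_def)
  then obtain \<eta> where \<eta>: "1 / \<alpha> - \<epsilon> < \<eta>" "compatible 2 \<eta>" by (rule less_eta_star)
  obtain G where G: "is_psd d G" and t: "Re (tr G) > 0"
    and le: "\<eta> * real (card (subsets_m n 2)) * Re (tr G) \<le> (\<Sum>S\<in>subsets_m n 2. \<bar>expval G (g S)\<bar>)"
    using near_optimal_state[OF n \<eta>(2)] by blast
  define \<tau> where "\<tau> = Re (tr G)"
  have \<tau>: "\<tau> > 0" using t by (simp add: \<tau>_def)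
  define m where "m j k = covar G j k / \<tau>" for j k
  have anti: "m j k = - m k j" if "j < v" "k < v" for j k
    using covar_antisym[OF G, of j k] that by (simp add: m_def v_def)
  have contr: "(\<Sum>k<v. (\<Sum>j<v. p j * m j k)\<^sup>2) \<le> (\<Sum>j<v. (p j)\<^sup>2)" for p
    using covar_contraction[OF G t, of p] by (simp add: m_def v_def \<tau>_def)
  have pick: "(\<Sum>i<v. of_bool (j = i) * f i) = f j" if "j < v" for j and f :: "nat \<Rightarrow> real"
    using that by (intro sum_of_bool_mult) auto
  have row: "(\<Sum>k<v. (m j k)\<^sup>2) \<le> 1" if j: "j < v" for j
  proof -
    have "{..<v} \<inter> {j} = {j}" using j by auto
    then show ?thesis
      using contr[of "\<lambda>i. of_bool (j = i)"] unfolding pick[OF j] by (simp add: power2_eq_square)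
  qed
  \<comment> \<open>The contraction applied to a unit vector plus c times another; c = 1 and c = -1
    are the polarisation inequalities.\<close>
  have two: "(\<Sum>k<v. (m j k + c * m l k)\<^sup>2) \<le> 1 + c\<^sup>2" if jl: "j < v" "l < v" "j \<noteq> l" for j l c
  proof -
    have "(\<Sum>i<v. (of_bool (j = i) + c * of_bool (l = i)) * f i) = f j + c * f l" for f :: "nat \<Rightarrow> real"
    proof -
      have "(\<Sum>i<v. (of_bool (j = i) + c * of_bool (l = i)) * f i) =
          (\<Sum>i<v. of_bool (j = i) * f i) + c * (\<Sum>i<v. of_bool (l = i) * f i)"
        by (simp only: distrib_right sum.distrib sum_distrib_left mult.assoc)
      then show ?thesis unfolding pick[OF jl(1)] pick[OF jl(2)] .
    qed
    moreover have "(\<Sum>i<v. (of_bool (j = i) + c * of_bool (l = i))\<^sup>2) = 1 + c\<^sup>2"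
    proof -
      have "(\<Sum>i<v. (of_bool (j = i) + c * of_bool (l = i))\<^sup>2) = (\<Sum>i<v. of_bool (j = i) * 1) + (\<Sum>i<v. of_bool (l = i) * c\<^sup>2)"
        unfolding sum.distrib[symmetric] using jl(3) by (intro sum.cong refl) (auto simp: power_mult_distrib)
      then show ?thesis unfolding pick[OF jl(1)] pick[OF jl(2)] .
    qed
    ultimately show ?thesis
      using contr[of "\<lambda>i. of_bool (j = i) + c * of_bool (l = i)"] by simp
  qed
  have big: "real v * \<alpha> - \<alpha> / (32 * (real v)\<^sup>2) \<le> (\<Sum>j<v. \<Sum>k<v. \<bar>m j k\<bar>)"
  proof -
    have m_g: "\<bar>m j k\<bar> = (if j = k then 0 else \<bar>expval G (g {j, k})\<bar> / \<tau>)" if "j < v" "k < v" for j k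
    proof (cases j k rule: linorder_cases)
      case less
      then show ?thesis using covar_g[of j k] that \<tau> by (simp add: m_def v_def abs_divide)
    next
      case equal
      then show ?thesis using anti[OF that] by simp
    next
      case greater
      have "\<bar>m j k\<bar> = \<bar>m k j\<bar>" using anti[OF that] by (metis abs_minus_cancel)
      then show ?thesis using greater covar_g[of k j] that \<tau>
        by (simp add: m_def v_def abs_divide insert_commute)
    qed
    have card: "real (card (subsets_m n 2)) = real v * (real v - 1) / 2"
      by (simp add: card_subsets_m choose_two_real v_def)
    have "(\<Sum>j<v. \<Sum>k<v. \<bar>m j k\<bar>) = (\<Sum>j<v. \<Sum>k<v. if j = k then 0 else \<bar>expval G (g {j, k})\<bar> / \<tau>)"
      using m_g by (intro sum.cong refl) auto
    also have "\<dots> = 2 * (\<Sum>S\<in>subsets_m n 2. \<bar>expval G (g S)\<bar> / \<tau>)"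
      by (subst sum_pairs_two_subsets[where h = "\<lambda>S. \<bar>expval G (g S)\<bar> / \<tau>"]) (simp add: subsets_m_def v_def)
    also have "\<dots> = 2 * ((\<Sum>S\<in>subsets_m n 2. \<bar>expval G (g S)\<bar>) / \<tau>)"
      by (simp add: sum_divide_distrib)
    also have "\<dots> \<ge> 2 * (\<eta> * real (card (subsets_m n 2)))"
      using le \<tau> by (simp add: \<tau>_def[symmetric] field_simps)
    finally have "\<eta> * (real v * (\<alpha> * \<alpha>)) \<le> (\<Sum>j<v. \<Sum>k<v. \<bar>m j k\<bar>)"
      unfolding card \<alpha>(2) by simp
    moreover have "(1 / \<alpha> - \<epsilon>) * (real v * (\<alpha> * \<alpha>)) \<le> \<eta> * (real v * (\<alpha> * \<alpha>))"
      using \<eta>(1) \<alpha>(1) by (intro mult_right_mono) auto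
    moreover have "(1 / \<alpha> - \<epsilon>) * (real v * (\<alpha> * \<alpha>)) = real v * \<alpha> - \<alpha> / (32 * (real v)\<^sup>2)"
      using \<alpha>(1) v by (simp add: \<epsilon>_def field_simps power2_eq_square power3_eq_cube)
    ultimately show ?thesis by linarith
  qed
  have "\<exists>A. skew_conference v A"
  proof (rule near_extremal_orthogonal[OF v anti row])
    show "(\<Sum>k<v. (m j k + m l k)\<^sup>2) \<le> 2" if "j < v" "l < v" "j \<noteq> l" for j l
      using two[OF that, of 1] by simp
    show "(\<Sum>k<v. (m j k - m l k)\<^sup>2) \<le> 2" if "j < v" "l < v" "j \<noteq> l" for j l
      using two[OF that, of "-1"] by simp
    show "real v * sqrt (real v - 1) - sqrt (real v - 1) / (32 * (real v)\<^sup>2) \<le> (\<Sum>j<v. \<Sum>k<v. \<bar>m j k\<bar>)"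
      using big unfolding \<alpha>_def .
  qed
  then show ?thesis by (simp add: v_def)
qed

lemma eta_star_two_eq_iff:
  assumes n: "n \<ge> 1"
  shows "eta_star n \<gamma> 2 = 1 / sqrt (2 * real n - 1) \<longleftrightarrow> (\<exists>H. is_skew_hadamard (2 * n) H)"
proof
  assume "eta_star n \<gamma> 2 = 1 / sqrt (2 * real n - 1)"
  from conference_of_eta_star_two[OF n this] show "\<exists>H. is_skew_hadamard (2 * n) H"
    using skew_hadamard_of_conference by blast
next
  assume "\<exists>H. is_skew_hadamard (2 * n) H"
  then obtain A where A: "skew_conference (2 * n) A" using conference_of_skew_hadamard by blast
  \<comment> \<open>With order N = 2n the only mode set is the full one, so no factor is lost to
    averaging.\<close>
  have "1 / sqrt (2 * real n - 1) \<le> eta_star n \<gamma> 2"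
    using eta_star_conference_lower[OF A, of 1] n by simp
  with eta_star_two_le[OF n] show "eta_star n \<gamma> 2 = 1 / sqrt (2 * real n - 1)" by (rule antisym)
qed

end

theorem theorem2:
  shows
   "(\<forall>n \<ge> 1. \<forall>\<gamma>. majorana n \<gamma> \<longrightarrow>
        eta_star n \<gamma> 2 \<le> 1 / sqrt (2 * real n - 1) \<and>
        (eta_star n \<gamma> 2 = 1 / sqrt (2 * real n - 1) \<longleftrightarrow>
           (\<exists>H. is_skew_hadamard (2 * n) H)))
    \<and> (\<forall>\<Gamma> :: nat \<Rightarrow> nat \<Rightarrow> complex mat. (\<forall>n. majorana n (\<Gamma> n)) \<longrightarrow>
        (\<lambda>n. eta_star n (\<Gamma> n) 2) \<in> \<Theta>(\<lambda>n. 1 / sqrt (real n)))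
    \<and> (\<forall>k::nat. 1 \<le> k \<and> k \<le> 5 \<longrightarrow>
        (\<exists>N. \<forall>n \<ge> N. \<forall>\<gamma>. majorana n \<gamma> \<longrightarrow>
            eta_star n \<gamma> (2 * k) \<le> sqrt (real (n choose k) / real ((2 * n) choose (2 * k))))
        \<and> (\<forall>\<Gamma> :: nat \<Rightarrow> nat \<Rightarrow> complex mat. (\<forall>n. majorana n (\<Gamma> n)) \<longrightarrow>
            (\<lambda>n. eta_star n (\<Gamma> n) (2 * k)) \<in> \<Theta>(\<lambda>n. real n powr (- real k / 2))))"
proof (intro conjI allI impI)
  fix n :: nat and \<gamma> assume n: "n \<ge> 1" and "majorana n \<gamma>"
  then interpret majorana_system n \<gamma> by unfold_locales
  show "eta_star n \<gamma> 2 \<le> 1 / sqrt (2 * real n - 1)" by (rule eta_star_two_le[OF n])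
  show "eta_star n \<gamma> 2 = 1 / sqrt (2 * real n - 1) \<longleftrightarrow> (\<exists>H. is_skew_hadamard (2 * n) H)"
    by (rule eta_star_two_eq_iff[OF n])
next
  fix \<Gamma> :: "nat \<Rightarrow> nat \<Rightarrow> complex mat" assume "\<forall>n. majorana n (\<Gamma> n)"
  then show "(\<lambda>n. eta_star n (\<Gamma> n) 2) \<in> \<Theta>(\<lambda>n. 1 / sqrt (real n))"
    using eta_star_even_bigtheta[of 1 \<Gamma>] by simp
next
  fix k :: nat assume k: "1 \<le> k \<and> k \<le> 5"
  then show "\<exists>N. \<forall>n\<ge>N. \<forall>\<gamma>. majorana n \<gamma> \<longrightarrow>
      eta_star n \<gamma> (2 * k) \<le> sqrt (real (n choose k) / real ((2 * n) choose (2 * k)))"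
    using eta_star_even_upper by blast
  fix \<Gamma> :: "nat \<Rightarrow> nat \<Rightarrow> complex mat" assume "\<forall>n. majorana n (\<Gamma> n)"
  then have "(\<lambda>n. eta_star n (\<Gamma> n) (2 * k)) \<in> \<Theta>(\<lambda>n. (1 / sqrt (real n)) ^ k)"
    using eta_star_even_bigtheta[of k \<Gamma>] k by blast
  also have "(\<lambda>n. (1 / sqrt (real n)) ^ k) \<in> \<Theta>(\<lambda>n. real n powr (- real k / 2))"
  proof (rule bigthetaI_cong)
    show "\<forall>\<^sub>F n in at_top. (1 / sqrt (real n)) ^ k = real n powr (- real k / 2)"
      using eventually_gt_at_top[of "0::nat"]
    proof eventually_elim
      case (elim n)
      then have "1 / sqrt (real n) = real n powr (- 1 / 2)"
        by (simp add: powr_half_sqrt[symmetric] powr_minus_divide)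
      with elim show ?case by (simp add: powr_powr flip: powr_realpow)
    qed
  qed
  finally show "(\<lambda>n. eta_star n (\<Gamma> n) (2 * k)) \<in> \<Theta>(\<lambda>n. real n powr (- real k / 2))" .
qed

end
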